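(* Let $m\ge 2$ be an integer and let $G\in\mathcal{H}_1$ be a graph on the vertex set $[n]$. Then $$\mathrm{depth}(S/\mathcal{J}_{K_m,G})=(m-2)+f(G)+d(G)=m+n-\kappa(G).$$
   Context: Let $K$ be a field, $m\ge 2$, $n\ge 1$ integers, $[n]=\{1,\dots,n\}$, and $S=K[x_{ij}: i\in[m],\, j\in[n]]$. For a finite simple graph $G$ on $[n]$ with edge set $E(G)$, the generalized binomial edge ideal of $G$ is $$\mathcal{J}_{K_m,G}=\big(x_{ik}x_{jl}-x_{il}x_{jk} : 1\le i<j\le m,\ \{k,l\}\in E(G),\ k<l\big)\subseteq S.$$ Depth is taken with respect to the homogeneous maximal ideal of $S$. A clique of $G$ is an induced complete subgraph. $\mathcal{H}_1$ is the class of non-complete connected finite simple graphs $G$ for which there exists a complete subgraph $K_s$ of $G$ such that any two distinct maximal cliques of $G$ intersect exactly in $K_s$ (the same $K_s$ for all pairs). A vertex $v$ of $G$ is free if the induced subgraph of $G$ on the set of neighbours of $v$ is complete; $f(G)$ is the number of free vertices of $G$. $d(G)=i(G)+\sum_j\mathrm{diam}(G_j)$, where $i(G)$ is the number of isolated vertices of $G$, the $G_j$ are the connected components of $G$, and $\mathrm{diam}$ is the maximum distance between two vertices. The vertex-connectivity $\kappa(G)$ of a connected non-complete graph $G$ is the minimum cardinality of a set $T\subseteq V(G)$ such that the induced subgraph on $V(G)\setminus T$ is disconnected. *)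

theory Defs
  imports
    "HOL-Algebra.QuotRing"
    "HOL-Algebra.Module"
    "HOL-Library.Poly_Mapping"
    "HOL-Library.Extended_Nat"
    "Graph_Theory.Graph_Theory"
begin

section \<open>Depth of a module with respect to an ideal\<close>

text \<open>The submodule \<open>(x\<^sub>1, \<dots>, x\<^sub>r) M\<close>; it is the zero submodule for the empty sequence.\<close>

definition seq_submodule :: "('a, 'b, 'c) module_scheme \<Rightarrow> 'a list \<Rightarrow> 'b set" where
  "seq_submodule M xs =
    {finsum M (\<lambda>i. (xs ! i) \<odot>\<^bsub>M\<^esub> u i) {..<length xs} | u. u \<in> {..<length xs} \<rightarrow> carrier M}"

text \<open>
  \<open>x\<^sub>i\<close> is a nonzerodivisor on \<open>M / (x\<^sub>1, \<dots>, x\<^sub>i\<^sub>-\<^sub>1) M\<close> for every \<open>i\<close>,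
  and \<open>M \<noteq> (x\<^sub>1, \<dots>, x\<^sub>r) M\<close>. The nonzerodivisor condition is written out for
  representatives in \<open>M\<close>; list positions start at 0.
\<close>

definition regular_sequence ::
    "('a, 'r) ring_scheme \<Rightarrow> ('a, 'b, 'c) module_scheme \<Rightarrow> 'a list \<Rightarrow> bool" where
  "regular_sequence R M xs \<longleftrightarrow>
     set xs \<subseteq> carrier R \<and>
     (\<forall>i < length xs. \<forall>u \<in> carrier M.
        (xs ! i) \<odot>\<^bsub>M\<^esub> u \<in> seq_submodule M (take i xs) \<longrightarrow> u \<in> seq_submodule M (take i xs)) \<and>
     seq_submodule M xs \<noteq> carrier M"

text \<open>
  Supremum of the lengths of the \<open>M\<close>-regular sequences in \<open>I\<close>, taken in \<^typ>\<open>enat\<close>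
  so that an unbounded set of lengths gives \<open>\<infinity>\<close>.
\<close>

definition depth ::
    "('a, 'r) ring_scheme \<Rightarrow> 'a set \<Rightarrow> ('a, 'b, 'c) module_scheme \<Rightarrow> enat" where
  "depth R I M = (SUP xs \<in> {xs. set xs \<subseteq> I \<and> regular_sequence R M xs}. enat (length xs))"

text \<open>The quotient ring \<open>R Quot J\<close> regarded as a module over \<open>R\<close>.\<close>

definition quot_module :: "('a, 'r) ring_scheme \<Rightarrow> 'a set \<Rightarrow> ('a, 'a set) module" where
  "quot_module R J =
     ring.extend (R Quot J) \<lparr>smult = (\<lambda>a X. (J +>\<^bsub>R\<^esub> a) \<otimes>\<^bsub>R Quot J\<^esub> X)\<rparr>"

lemma quot_module_simps [simp]:
  "carrier (quot_module R J) = carrier (R Quot J)"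
  "monoid.mult (quot_module R J) = monoid.mult (R Quot J)"
  "\<one>\<^bsub>quot_module R J\<^esub> = \<one>\<^bsub>R Quot J\<^esub>"
  "\<zero>\<^bsub>quot_module R J\<^esub> = \<zero>\<^bsub>R Quot J\<^esub>"
  "ring.add (quot_module R J) = ring.add (R Quot J)"
  "a \<odot>\<^bsub>quot_module R J\<^esub> X = (J +>\<^bsub>R\<^esub> a) \<otimes>\<^bsub>R Quot J\<^esub> X"
  by (simp_all add: quot_module_def ring.defs)

lemma module_quot_module:
  assumes "cring R" "ideal J R"
  shows "Module.module R (quot_module R J)"
proof -
  interpret R: cring R by fact
  interpret J: ideal J R by fact
  interpret Q: cring "R Quot J" by (rule J.quotient_is_cring) (rule R.cring_axioms)
  interpret h: ring_hom_ring R "R Quot J" "(+>\<^bsub>R\<^esub>) J" by (rule J.rcos_ring_hom_ring)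
  have ab: "abelian_group (quot_module R J)"
  proof (rule abelian_groupI)
    fix x assume "x \<in> carrier (quot_module R J)"
    then show "\<exists>y \<in> carrier (quot_module R J). y \<oplus>\<^bsub>quot_module R J\<^esub> x = \<zero>\<^bsub>quot_module R J\<^esub>"
      by (intro bexI[of _ "\<ominus>\<^bsub>R Quot J\<^esub> x"]) (simp_all add: Q.l_neg)
  qed (simp_all add: Q.a_ac)
  show ?thesis
    by (rule moduleI[OF R.cring_axioms ab])
      (auto simp: Q.l_distr Q.r_distr Q.m_assoc)
qed

section \<open>Polynomial rings\<close>

text \<open>A polynomial maps monomials (exponent vectors of finite support) to coefficients.\<close>

type_synonym ('x, 'k) mpoly = "('x \<Rightarrow>\<^sub>0 nat) \<Rightarrow>\<^sub>0 'k"

definition mpoly_ring :: "'x set \<Rightarrow> ('x, 'k::comm_ring_1) mpoly ring" where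
  "mpoly_ring X =
    \<lparr>carrier = {p. \<forall>t \<in> Poly_Mapping.keys p. Poly_Mapping.keys t \<subseteq> X},
     monoid.mult = (*), one = 1, zero = 0, add = (+)\<rparr>"

definition mvar :: "'x \<Rightarrow> ('x, 'k::comm_ring_1) mpoly" where
  "mvar x = Poly_Mapping.single (Poly_Mapping.single x 1) 1"

lemma mpoly_ring_simps [simp]:
  "monoid.mult (mpoly_ring X) = (*)" "\<one>\<^bsub>mpoly_ring X\<^esub> = 1"
  "\<zero>\<^bsub>mpoly_ring X\<^esub> = 0" "ring.add (mpoly_ring X) = (+)"
  by (simp_all add: mpoly_ring_def)

lemma mpoly_ring_carrier:
  "p \<in> carrier (mpoly_ring X) \<longleftrightarrow> (\<forall>t \<in> Poly_Mapping.keys p. Poly_Mapping.keys t \<subseteq> X)"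
  by (simp add: mpoly_ring_def)

lemma mvar_closed: "x \<in> X \<Longrightarrow> mvar x \<in> carrier (mpoly_ring X)"
  by (simp add: mpoly_ring_carrier mvar_def)

lemma uminus_mpoly_closed: "p \<in> carrier (mpoly_ring X) \<Longrightarrow> - p \<in> carrier (mpoly_ring X)"
  by (simp add: mpoly_ring_carrier)

lemma cring_mpoly_ring: "cring (mpoly_ring X :: ('x, 'k::comm_ring_1) mpoly ring)"
proof (rule cringI)
  show "abelian_group (mpoly_ring X :: ('x, 'k) mpoly ring)"
  proof (rule abelian_groupI)
    fix p q :: "('x, 'k) mpoly"
    assume "p \<in> carrier (mpoly_ring X)" "q \<in> carrier (mpoly_ring X)"
    then show "p \<oplus>\<^bsub>mpoly_ring X\<^esub> q \<in> carrier (mpoly_ring X)"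
      using Poly_Mapping.keys_add[of p q] by (auto simp: mpoly_ring_carrier)
  next
    fix p :: "('x, 'k) mpoly"
    assume "p \<in> carrier (mpoly_ring X)"
    then show "\<exists>q \<in> carrier (mpoly_ring X). q \<oplus>\<^bsub>mpoly_ring X\<^esub> p = \<zero>\<^bsub>mpoly_ring X\<^esub>"
      by (intro bexI[of _ "- p"]) (auto simp: uminus_mpoly_closed)
  qed (auto simp: mpoly_ring_carrier algebra_simps)
  show "comm_monoid (mpoly_ring X :: ('x, 'k) mpoly ring)"
  proof (rule comm_monoidI)
    fix p q :: "('x, 'k) mpoly"
    assume pq: "p \<in> carrier (mpoly_ring X)" "q \<in> carrier (mpoly_ring X)"
    have "Poly_Mapping.keys t \<subseteq> X" if t: "t \<in> Poly_Mapping.keys (p * q)" for t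
    proof -
      obtain a b where "t = a + b" "a \<in> Poly_Mapping.keys p" "b \<in> Poly_Mapping.keys q"
        using t keys_mult[of p q] by blast
      then show ?thesis
        using pq Poly_Mapping.keys_add[of a b] unfolding mpoly_ring_carrier by blast
    qed
    then show "p \<otimes>\<^bsub>mpoly_ring X\<^esub> q \<in> carrier (mpoly_ring X)"
      by (simp add: mpoly_ring_carrier)
  qed (auto simp: mpoly_ring_carrier algebra_simps)
qed (auto simp: algebra_simps)

lemma a_minus_mpoly_ring:
  assumes "p \<in> carrier (mpoly_ring X)" "q \<in> carrier (mpoly_ring X)"
  shows "p \<ominus>\<^bsub>mpoly_ring X\<^esub> q = p - q"
proof -
  interpret cring "mpoly_ring X" by (rule cring_mpoly_ring)
  have "\<ominus>\<^bsub>mpoly_ring X\<^esub> q = - q"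
    using assms(2) uminus_mpoly_closed[OF assms(2)] by (intro minus_equality) auto
  then show ?thesis by (simp add: a_minus_def)
qed

section \<open>Simple graphs\<close>

text \<open>
  A finite simple graph is a \<^locale>\<open>pair_graph\<close>: a finite loop-free symmetric digraph,
  an edge \<open>{k, l}\<close> being the pair of arcs \<open>(k, l)\<close>, \<open>(l, k)\<close>.
  Cliques, being induced subgraphs, are given by their vertex sets.
\<close>

definition is_complete :: "('a, 'b) pre_digraph \<Rightarrow> bool" where
  "is_complete G \<longleftrightarrow> complete_digraph (card (verts G)) G"

definition clique :: "('a, 'b) pre_digraph \<Rightarrow> 'a set \<Rightarrow> bool" where
  "clique G A \<longleftrightarrow> A \<subseteq> verts G \<and> is_complete (G \<restriction> A)"

definition maximal_clique :: "('a, 'b) pre_digraph \<Rightarrow> 'a set \<Rightarrow> bool" where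
  "maximal_clique G A \<longleftrightarrow> clique G A \<and> (\<forall>B. clique G B \<and> A \<subseteq> B \<longrightarrow> B = A)"

definition H1 :: "'a pair_pre_digraph set" where
  "H1 = {G. pair_graph G \<and> connected (with_proj G) \<and> \<not> is_complete (with_proj G) \<and>
     (\<exists>C. clique (with_proj G) C \<and>
        (\<forall>A B. maximal_clique (with_proj G) A \<and> maximal_clique (with_proj G) B \<and> A \<noteq> B
            \<longrightarrow> A \<inter> B = C))}"

definition neighbours :: "('a, 'b) pre_digraph \<Rightarrow> 'a \<Rightarrow> 'a set" where
  "neighbours G v = {u. (v, u) \<in> arcs_ends G}"

definition free_vertex :: "('a, 'b) pre_digraph \<Rightarrow> 'a \<Rightarrow> bool" where
  "free_vertex G v \<longleftrightarrow> v \<in> verts G \<and> is_complete (G \<restriction> neighbours G v)"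

definition num_free :: "('a, 'b) pre_digraph \<Rightarrow> nat" where
  "num_free G = card {v. free_vertex G v}"

definition num_isolated :: "('a, 'b) pre_digraph \<Rightarrow> nat" where
  "num_isolated G = card {v \<in> verts G. neighbours G v = {}}"

text \<open>Length of a shortest walk from \<open>u\<close> to \<open>v\<close>; only meaningful if there is one.\<close>

definition graph_dist :: "('a, 'b) pre_digraph \<Rightarrow> 'a \<Rightarrow> 'a \<Rightarrow> nat" where
  "graph_dist G u v = (LEAST k. \<exists>p. pre_digraph.awalk G u p v \<and> length p = k)"

definition diam :: "('a, 'b) pre_digraph \<Rightarrow> nat" where
  "diam G = Max {graph_dist G u v | u v. u \<in> verts G \<and> v \<in> verts G}"

text \<open>
  The invariant \<open>d(G)\<close>. In a symmetric digraph the strongly connected components are the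
  connected components of the graph.
\<close>

definition diam_sum :: "('a, 'b) pre_digraph \<Rightarrow> nat" where
  "diam_sum G = num_isolated G + (\<Sum>H \<in> pre_digraph.sccs G. diam H)"

text \<open>
  \<^const>\<open>connected\<close> fails for the graph without vertices, which does not count as disconnected
  here; hence the condition that \<open>T\<close> is a proper subset of the vertices. For a complete graph
  no such \<open>T\<close> exists and the value is unspecified.
\<close>

definition vertex_connectivity :: "('a, 'b) pre_digraph \<Rightarrow> nat" where
  "vertex_connectivity G =
     Min (card ` {T. T \<subset> verts G \<and> \<not> connected (G \<restriction> (verts G - T))})"

section \<open>Generalized binomial edge ideals\<close>

abbreviation gbei_ring :: "nat \<Rightarrow> nat \<Rightarrow> (nat \<times> nat, 'k::field) mpoly ring" where
  "gbei_ring m n \<equiv> mpoly_ring ({1..m} \<times> {1..n})"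

definition hom_max_ideal :: "nat \<Rightarrow> nat \<Rightarrow> (nat \<times> nat, 'k::field) mpoly set" where
  "hom_max_ideal m n = Idl\<^bsub>gbei_ring m n\<^esub> (mvar ` ({1..m} \<times> {1..n}))"

definition gbei ::
    "nat \<Rightarrow> nat \<Rightarrow> nat pair_pre_digraph \<Rightarrow> (nat \<times> nat, 'k::field) mpoly set" where
  "gbei m n G = Idl\<^bsub>gbei_ring m n\<^esub>
     {mvar (i, k) * mvar (j, l) - mvar (i, l) * mvar (j, k) | i j k l.
        1 \<le> i \<and> i < j \<and> j \<le> m \<and> (k, l) \<in> parcs G \<and> k < l}"

lemma ideal_gbei:
  assumes "pair_wf_digraph G" "pverts G = {1..n}"
  shows "ideal (gbei m n G :: (nat \<times> nat, 'k::field) mpoly set) (gbei_ring m n)"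
proof -
  interpret S: cring "gbei_ring m n :: (nat \<times> nat, 'k) mpoly ring" by (rule cring_mpoly_ring)
  interpret G: pair_wf_digraph G by fact
  have "mvar (i, k) * mvar (j, l) - mvar (i, l) * mvar (j, k)
      \<in> carrier (gbei_ring m n :: (nat \<times> nat, 'k) mpoly ring)"
    if "1 \<le> i" "i < j" "j \<le> m" "(k, l) \<in> parcs G" for i j k l
  proof -
    have "k \<in> {1..n}" "l \<in> {1..n}"
      using that(4) G.wellformed' assms(2) by blast+
    then have v: "mvar (x, y) \<in> carrier (gbei_ring m n :: (nat \<times> nat, 'k) mpoly ring)"
      if "x \<in> {i, j}" "y \<in> {k, l}" for x y
      using that \<open>1 \<le> i\<close> \<open>i < j\<close> \<open>j \<le> m\<close> by (intro mvar_closed) auto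
    have c: "mvar (i, k) * mvar (j, l) \<in> carrier (gbei_ring m n :: (nat \<times> nat, 'k) mpoly ring)"
      "mvar (i, l) * mvar (j, k) \<in> carrier (gbei_ring m n :: (nat \<times> nat, 'k) mpoly ring)"
      using S.m_closed[OF v v, of i k j l] S.m_closed[OF v v, of i l j k] by auto
    show ?thesis using S.minus_closed[OF c] a_minus_mpoly_ring[OF c] by simp
  qed
  then show ?thesis unfolding gbei_def by (intro S.genideal_ideal) auto
qed

end

theory Submission
  imports Defs "HOL-Library.Product_Lexorder"
begin

text \<open>
  Let \<open>s\<close> be the number of vertices of \<open>C\<close>, the common intersection of the maximal cliques. The
  vertices of \<open>C\<close> are joined to all others, and outside \<open>C\<close> adjacency is an equivalence relation
  with \<open>r \<ge> 2\<close> classes, the blocks (\<open>H1_structure\<close>). So the free vertices are the \<open>n - s\<close> vertices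
  off \<open>C\<close>, the diameter is 2 and the connectivity is \<open>s\<close>; it remains to see that the depth is
  \<open>m + n - s\<close>.

  Let \<open>J\<close> be the edge ideal. It is spanned by differences of monomials, and two monomials are
  congruent modulo \<open>J\<close> if and only if their margins agree: row and column sums if they involve a
  column in \<open>C\<close>, because an entry in such a column makes exchanges between different blocks
  possible, and otherwise column sums and the row sums of every block. This says that \<open>J\<close> is the
  intersection of the ideal \<open>L\<^sub>A\<close> of 2-minors of the whole matrix and the ideal \<open>L\<^sub>B\<close> generated
  by the variables in \<open>C\<close> and the 2-minors of the blocks (\<open>gbei_eq_Int\<close>). The ideal
  \<open>L\<^sub>A + L\<^sub>B\<close> belongs to the matrix without the columns in \<open>C\<close>.

  All three are instances of one family, the ideals of matrices decomposed into blocks of rows and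
  columns, whose depth is the sum of (rows + columns - 1) over the blocks
  (\<open>koszul_depth_margin_ideal\<close>). Indeed a variable of a block is a nonzerodivisor, and killing it
  yields the intersection of the two ideals in which its row, respectively its column, has been
  removed from the block; their sum is the ideal with both removed. So induction applies, with
  the exact sequence \<open>0 \<rightarrow> R/(I \<inter> I') \<rightarrow> R/I \<oplus> R/I' \<rightarrow> R/(I + I') \<rightarrow> 0\<close>: if the depth of the last
  term is smaller than those of the two summands of the middle one, then that of the first is one
  more. For \<open>L\<^sub>A\<close>, \<open>L\<^sub>B\<close> and their sum the depths are \<open>m + n - 1\<close>, \<open>n - s + r (m - 1)\<close> and
  \<open>m + n - s - 1\<close>, and the same sequence gives \<open>m + n - s\<close> for \<open>J\<close>.

  To use exact sequences, depth is replaced by the first degree in which Koszul cohomology does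
  not vanish. A regular sequence of length \<open>k\<close> makes the cohomology vanish below degree \<open>k\<close>.
  Conversely, if it vanishes in degree 0, then there is no socle, and over a Noetherian ring prime
  avoidance produces a nonzerodivisor; dividing by it shifts the cohomology, so that one obtains
  a regular sequence as long as the range of vanishing (\<open>depth_eq_koszul_depth\<close>).

  All ideals live in the polynomial ring in all variables indexed by pairs of natural numbers and
  contain the variables outside the matrix. The quotients are those of the ring in \<open>m * n\<close>
  variables, and carrier sets are avoided until the end.
\<close>

section \<open>Ideals of a commutative ring\<close>

definition is_ideal :: "'a::comm_ring_1 set \<Rightarrow> bool" where
  "is_ideal L \<longleftrightarrow> 0 \<in> L \<and> (\<forall>u\<in>L. \<forall>v\<in>L. u + v \<in> L) \<and> (\<forall>a. \<forall>u\<in>L. a * u \<in> L)"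

lemma is_ideal_zero: "is_ideal L \<Longrightarrow> 0 \<in> L"
  and is_ideal_add: "is_ideal L \<Longrightarrow> u \<in> L \<Longrightarrow> v \<in> L \<Longrightarrow> u + v \<in> L"
  and is_ideal_mult: "is_ideal L \<Longrightarrow> u \<in> L \<Longrightarrow> a * u \<in> L"
  by (auto simp: is_ideal_def)

lemma is_ideal_uminus: "is_ideal L \<Longrightarrow> u \<in> L \<Longrightarrow> - u \<in> L"
  using is_ideal_mult[of L u "-1"] by simp

lemma is_ideal_diff: "is_ideal L \<Longrightarrow> u \<in> L \<Longrightarrow> v \<in> L \<Longrightarrow> u - v \<in> L"
  using is_ideal_add[of L u "- v"] is_ideal_uminus[of L v] by simp

lemma is_ideal_sum: "is_ideal L \<Longrightarrow> (\<And>i. i \<in> A \<Longrightarrow> f i \<in> L) \<Longrightarrow> sum f A \<in> L"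
  by (induction A rule: infinite_finite_induct) (auto intro: is_ideal_zero is_ideal_add)

lemma is_ideal_diff_commute: "is_ideal L \<Longrightarrow> u - v \<in> L \<Longrightarrow> v - u \<in> L"
  using is_ideal_uminus[of L "u - v"] by simp

lemma is_ideal_mem_iff: "is_ideal L \<Longrightarrow> u - v \<in> L \<Longrightarrow> u \<in> L \<longleftrightarrow> v \<in> L"
  using is_ideal_add[of L "u - v" v] is_ideal_diff[of L u "u - v"] by auto

lemma is_ideal_Int: "is_ideal L1 \<Longrightarrow> is_ideal L2 \<Longrightarrow> is_ideal (L1 \<inter> L2)"
  by (auto simp: is_ideal_def)

lemma is_ideal_hull: "is_ideal (is_ideal hull A)"
  by (rule hull_in) (auto simp: is_ideal_def)

definition ideal_sum :: "'a::comm_ring_1 set \<Rightarrow> 'a set \<Rightarrow> 'a set" where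
  "ideal_sum L1 L2 = {u + v | u v. u \<in> L1 \<and> v \<in> L2}"

definition adjoin :: "'a::comm_ring_1 set \<Rightarrow> 'a \<Rightarrow> 'a set" where
  "adjoin L z = {u + z * v | u v. u \<in> L}"

lemma adjoin_iff: "u \<in> adjoin L z \<longleftrightarrow> (\<exists>v. u - z * v \<in> L)"
proof
  assume "\<exists>v. u - z * v \<in> L"
  then obtain v where "u - z * v \<in> L" by blast
  moreover have "u = (u - z * v) + z * v" by simp
  ultimately show "u \<in> adjoin L z" unfolding adjoin_def by blast
next
  assume "u \<in> adjoin L z"
  then obtain a v where "u = a + z * v" "a \<in> L" unfolding adjoin_def by blast
  then have "u - z * v \<in> L" by simp
  then show "\<exists>v. u - z * v \<in> L" by blast
qed

lemma ideal_sum_iff: "u \<in> ideal_sum L1 L2 \<longleftrightarrow> (\<exists>v\<in>L1. u - v \<in> L2)"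
  unfolding ideal_sum_def by (force simp: diff_eq_eq)

lemma is_ideal_ideal_sum:
  assumes "is_ideal L1" "is_ideal L2"
  shows "is_ideal (ideal_sum L1 L2)"
  unfolding is_ideal_def
proof (intro conjI ballI allI)
  show "0 \<in> ideal_sum L1 L2"
    using assms is_ideal_zero unfolding ideal_sum_def by (force intro: exI[of _ 0])
next
  fix u v assume "u \<in> ideal_sum L1 L2" "v \<in> ideal_sum L1 L2"
  then obtain a b a' b' where "u = a + b" "v = a' + b'" "a \<in> L1" "a' \<in> L1" "b \<in> L2" "b' \<in> L2"
    unfolding ideal_sum_def by blast
  then have "u + v = (a + a') + (b + b')" "a + a' \<in> L1" "b + b' \<in> L2"
    using assms is_ideal_add by (auto simp: algebra_simps)
  then show "u + v \<in> ideal_sum L1 L2" unfolding ideal_sum_def by blast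
next
  fix c u assume "u \<in> ideal_sum L1 L2"
  then obtain a b where "u = a + b" "a \<in> L1" "b \<in> L2"
    unfolding ideal_sum_def by blast
  then have "c * u = c * a + c * b" "c * a \<in> L1" "c * b \<in> L2"
    using assms is_ideal_mult by (auto simp: algebra_simps)
  then show "c * u \<in> ideal_sum L1 L2" unfolding ideal_sum_def by blast
qed

lemma adjoin_eq_ideal_sum: "adjoin L z = ideal_sum L (range ((*) z))"
  by (auto simp: adjoin_def ideal_sum_def)

lemma is_ideal_range_mult: "is_ideal (range ((*) z))"
  unfolding is_ideal_def
  by (auto simp: image_iff) (metis mult_zero_right, metis distrib_left, metis mult.left_commute)

lemma is_ideal_adjoin: "is_ideal L \<Longrightarrow> is_ideal (adjoin L z)"
  by (simp add: adjoin_eq_ideal_sum is_ideal_ideal_sum is_ideal_range_mult)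

lemma adjoin_superset: "L \<subseteq> adjoin L z"
  unfolding adjoin_def by (force intro: exI[of _ 0])

lemma mult_in_adjoin: "is_ideal L \<Longrightarrow> z * v \<in> adjoin L z"
  unfolding adjoin_def using is_ideal_zero by force

lemma ideal_sum_left: "is_ideal L2 \<Longrightarrow> L1 \<subseteq> ideal_sum L1 L2"
  unfolding ideal_sum_def using is_ideal_zero by force

lemma ideal_sum_right: "is_ideal L1 \<Longrightarrow> L2 \<subseteq> ideal_sum L1 L2"
  unfolding ideal_sum_def using is_ideal_zero by force

definition regular_mod :: "'a::comm_ring_1 set \<Rightarrow> 'a \<Rightarrow> bool" where
  "regular_mod L z \<longleftrightarrow> (\<forall>u. z * u \<in> L \<longrightarrow> u \<in> L)"

section \<open>Koszul cohomology\<close>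

text \<open>
  The Koszul complex of \<open>x # xs\<close> is the mapping cone of multiplication by \<open>x\<close> on the complex
  of \<open>xs\<close>. A basis element of the exterior algebra is coded by the characteristic word of a
  subset of the list, its degree being the number of letters \<open>True\<close>; the recursion then
  takes care of all signs.
\<close>

fun koszul_d :: "'a::comm_ring_1 list \<Rightarrow> (bool list \<Rightarrow> 'a) \<Rightarrow> bool list \<Rightarrow> 'a" where
  "koszul_d (x # xs) f (False # w) = koszul_d xs (\<lambda>v. f (False # v)) w"
| "koszul_d (x # xs) f (True # w) = x * f (False # w) - koszul_d xs (\<lambda>v. f (True # v)) w"
| "koszul_d _ f _ = 0"

definition words :: "nat \<Rightarrow> nat \<Rightarrow> bool list set" where
  "words N i = {w. length w = N \<and> count_list w True = i}"

lemma words_0 [simp]: "words 0 i = (if i = 0 then {[]} else {})"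
  by (auto simp: words_def)

lemma words_Suc_iff:
  "w \<in> words (Suc N) i \<longleftrightarrow> (\<exists>v. w = False # v \<and> v \<in> words N i) \<or>
     (\<exists>v j. i = Suc j \<and> w = True # v \<and> v \<in> words N j)"
  by (cases w; cases "hd w"; cases i) (auto simp: words_def)

lemma koszul_d_degree_0: "w \<in> words (length xs) 0 \<Longrightarrow> koszul_d xs f w = 0"
  by (induction xs arbitrary: f w) (auto simp: words_Suc_iff)

lemma koszul_d_linear: "koszul_d xs (\<lambda>w. a * f w + b * g w) v = a * koszul_d xs f v + b * koszul_d xs g v"
proof (induction xs f v arbitrary: g rule: koszul_d.induct)
  case (1 x xs f w)
  show ?case using "1.IH"[of "\<lambda>v. g (False # v)"] by simp
next
  case (2 x xs f w)
  show ?case using "2.IH"[of "\<lambda>v. g (True # v)"] by (simp add: algebra_simps del: koszul_d.simps(3))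
qed auto

lemma koszul_d_add: "koszul_d xs (\<lambda>w. f w + g w) v = koszul_d xs f v + koszul_d xs g v"
  using koszul_d_linear[of xs 1 f 1 g v] by simp

lemma koszul_d_diff: "koszul_d xs (\<lambda>w. f w - g w) v = koszul_d xs f v - koszul_d xs g v"
  using koszul_d_linear[of xs 1 f "-1" g v] by simp

lemma koszul_d_mult: "koszul_d xs (\<lambda>w. a * f w) v = a * koszul_d xs f v"
  using koszul_d_linear[of xs a f 0 f v] by simp

lemma koszul_d_zero: "koszul_d xs (\<lambda>w. 0) v = 0"
  using koszul_d_mult[of xs 0 "\<lambda>w. 0" v] by simp

lemma koszul_d_d: "koszul_d xs (koszul_d xs f) v = 0"
proof (induction xs f v rule: koszul_d.induct)
  case (2 x xs f w)
  have "koszul_d (x # xs) (koszul_d (x # xs) f) (True # w)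
      = x * koszul_d xs (\<lambda>v. f (False # v)) w
        - koszul_d xs (\<lambda>v. x * f (False # v) - koszul_d xs (\<lambda>v. f (True # v)) v) w"
    by simp
  then show ?case using 2 by (simp add: koszul_d_diff koszul_d_mult)
qed (auto simp: koszul_d_zero)

lemma koszul_d_mem:
  assumes "is_ideal L" "\<And>w. w \<in> words (length xs) i \<Longrightarrow> f w \<in> L" "v \<in> words (length xs) (Suc i)"
  shows "koszul_d xs f v \<in> L"
  using assms(2,3)
proof (induction xs arbitrary: f v i)
  case Nil
  then show ?case by simp
next
  case (Cons x xs)
  show ?case
  proof (cases "\<exists>w. v = False # w")
    case True
    then obtain w where w: "v = False # w" "w \<in> words (length xs) (Suc i)"
      using Cons.prems(2) by (auto simp: words_Suc_iff)
    have "koszul_d xs (\<lambda>w. f (False # w)) w \<in> L"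
      by (rule Cons.IH[OF _ w(2)]) (use Cons.prems(1) in \<open>auto simp: words_Suc_iff\<close>)
    then show ?thesis using w by simp
  next
    case False
    then obtain w where w: "v = True # w" "w \<in> words (length xs) i"
      using Cons.prems(2) by (auto simp: words_Suc_iff)
    have 1: "x * f (False # w) \<in> L"
      using Cons.prems(1)[of "False # w"] w assms(1) by (auto simp: words_Suc_iff is_ideal_mult)
    have 2: "koszul_d xs (\<lambda>w. f (True # w)) w \<in> L"
    proof (cases i)
      case 0
      then show ?thesis using w koszul_d_degree_0 is_ideal_zero[OF assms(1)] by metis
    next
      case (Suc j)
      show ?thesis
        by (rule Cons.IH[of j]) (use Cons.prems(1) w Suc in \<open>auto simp: words_Suc_iff\<close>)
    qed
    show ?thesis using w 1 2 by (simp add: is_ideal_diff[OF assms(1)])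
  qed
qed

text \<open>
  Contraction with the basis element of the \<open>j\<close>-th list entry. By \<open>koszul_homotopy\<close> it is a chain
  homotopy from multiplication by that entry to zero.
\<close>

fun koszul_h :: "nat \<Rightarrow> (bool list \<Rightarrow> 'a::comm_ring_1) \<Rightarrow> bool list \<Rightarrow> 'a" where
  "koszul_h 0 f (False # w) = f (True # w)"
| "koszul_h (Suc j) f (False # w) = koszul_h j (\<lambda>v. f (False # v)) w"
| "koszul_h (Suc j) f (True # w) = - koszul_h j (\<lambda>v. f (True # v)) w"
| "koszul_h _ f _ = 0"

lemma koszul_h_linear: "koszul_h j (\<lambda>w. a * f w + b * g w) v = a * koszul_h j f v + b * koszul_h j g v"
proof (induction j f v arbitrary: g rule: koszul_h.induct)
  case (2 j f w)
  show ?case using "2.IH"[of "\<lambda>v. g (False # v)"] by simp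
next
  case (3 j f w)
  show ?case using "3.IH"[of "\<lambda>v. g (True # v)"] by simp
qed auto

lemma koszul_h_diff: "koszul_h j (\<lambda>w. f w - g w) v = koszul_h j f v - koszul_h j g v"
  using koszul_h_linear[of j 1 f "-1" g v] by simp

lemma koszul_h_mult: "koszul_h j (\<lambda>w. a * f w) v = a * koszul_h j f v"
  using koszul_h_linear[of j a f 0 f v] by simp

lemma koszul_homotopy:
  assumes "j < length xs" "length v = length xs"
  shows "koszul_d xs (koszul_h j f) v + koszul_h j (koszul_d xs f) v = xs ! j * f v"
  using assms
proof (induction xs arbitrary: f v j)
  case (Cons x xs)
  obtain b w where v: "v = b # w" and w: "length w = length xs"
    using Cons.prems by (cases v) auto
  show ?case
  proof (cases j)
    case 0
    then show ?thesis using v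
      by (cases b) (auto simp: koszul_d_zero)
  next
    case (Suc k)
    have k: "k < length xs" using Suc Cons.prems by simp
    show ?thesis
    proof (cases b)
      case False
      then show ?thesis using v Suc Cons.IH[OF k w, of "\<lambda>v. f (False # v)"] by simp
    next
      case True
      have "koszul_d xs (\<lambda>v. - koszul_h k (\<lambda>v. f (True # v)) v) w
          = - koszul_d xs (koszul_h k (\<lambda>v. f (True # v))) w"
        using koszul_d_mult[of xs "-1" "koszul_h k (\<lambda>v. f (True # v))" w] by simp
      then show ?thesis using v Suc True Cons.IH[OF k w, of "\<lambda>v. f (True # v)"]
        by (simp add: koszul_h_diff koszul_h_mult algebra_simps)
    qed
  qed
qed simp

lemma koszul_h_mem:
  assumes "is_ideal L" "\<And>w. w \<in> words N (Suc i) \<Longrightarrow> f w \<in> L" "v \<in> words N i" "j < N"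
  shows "koszul_h j f v \<in> L"
  using assms(2-4)
proof (induction j f v arbitrary: i N rule: koszul_h.induct)
  case (1 f w)
  then show ?case by (cases N) (auto simp: words_Suc_iff)
next
  case (2 j f w)
  then obtain N' where N: "N = Suc N'" "j < N'" "w \<in> words N' i"
    by (cases N) (auto simp: words_Suc_iff)
  have "koszul_h j (\<lambda>v. f (False # v)) w \<in> L"
    by (rule "2.IH"[OF _ N(3,2)]) (use "2.prems"(1) N in \<open>auto simp: words_Suc_iff\<close>)
  then show ?case by simp
next
  case (3 j f w)
  then obtain N' i' where N: "N = Suc N'" "j < N'" "w \<in> words N' i'" "i = Suc i'"
    by (cases N) (auto simp: words_Suc_iff)
  have "koszul_h j (\<lambda>v. f (True # v)) w \<in> L"
    by (rule "3.IH"[OF _ N(3,2)]) (use "3.prems"(1) N in \<open>auto simp: words_Suc_iff\<close>)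
  then show ?case by (simp add: is_ideal_uminus[OF assms(1)])
qed (auto simp: is_ideal_zero[OF assms(1)])

text \<open>
  Vanishing of the \<open>i\<close>-th Koszul cohomology of the module \<open>R / L\<close>. Cochains are not required to
  be zero on words of other degrees, since the differential at words of degree \<open>i + 1\<close> depends
  only on the values at words of degree \<open>i\<close>.
\<close>

definition koszul_vanish :: "'a::comm_ring_1 list \<Rightarrow> 'a set \<Rightarrow> nat \<Rightarrow> bool" where
  "koszul_vanish xs L i \<longleftrightarrow>
     (\<forall>f. (\<forall>w \<in> words (length xs) (Suc i). koszul_d xs f w \<in> L) \<longrightarrow>
        (\<exists>e. \<forall>w \<in> words (length xs) i. f w - koszul_d xs e w \<in> L))"

lemma koszul_vanishD:
  assumes "koszul_vanish xs L i" "\<And>w. w \<in> words (length xs) (Suc i) \<Longrightarrow> koszul_d xs f w \<in> L"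
  obtains e where "\<And>w. w \<in> words (length xs) i \<Longrightarrow> f w - koszul_d xs e w \<in> L"
  using assms unfolding koszul_vanish_def by blast

text \<open>
  The generators of the ideal act on cohomology as zero because of the contraction homotopies, and
  for a given cocycle the ring elements that multiply it to a coboundary form an ideal.
\<close>

lemma koszul_annihilated:
  assumes L: "is_ideal L" and z: "z \<in> is_ideal hull (set xs)"
    and f: "\<And>w. w \<in> words (length xs) (Suc i) \<Longrightarrow> koszul_d xs f w \<in> L"
  obtains b where "\<And>w. w \<in> words (length xs) i \<Longrightarrow> z * f w - koszul_d xs b w \<in> L"
proof -
  define Z where "Z = {z. \<exists>b. \<forall>w \<in> words (length xs) i. z * f w - koszul_d xs b w \<in> L}"
  have "is_ideal hull (set xs) \<subseteq> Z"
  proof (rule hull_minimal)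
    show "set xs \<subseteq> Z"
    proof
      fix x assume "x \<in> set xs"
      then obtain j where j: "j < length xs" "x = xs ! j" by (auto simp: in_set_conv_nth)
      have "x * f w - koszul_d xs (koszul_h j f) w \<in> L" if w: "w \<in> words (length xs) i" for w
      proof -
        have "x * f w - koszul_d xs (koszul_h j f) w = koszul_h j (koszul_d xs f) w"
          using koszul_homotopy[OF j(1), of w f] w j by (auto simp: words_def algebra_simps)
        then show ?thesis using koszul_h_mem[OF L f w j(1)] by simp
      qed
      then show "x \<in> Z" unfolding Z_def by blast
    qed
  next
    show "is_ideal Z" unfolding is_ideal_def
    proof (intro conjI ballI allI)
      show "0 \<in> Z" unfolding Z_def
        by (auto intro!: exI[of _ "\<lambda>w. 0"] simp: koszul_d_zero is_ideal_zero[OF L])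
    next
      fix u v assume "u \<in> Z" "v \<in> Z"
      then obtain b c where
        "\<forall>w \<in> words (length xs) i. u * f w - koszul_d xs b w \<in> L"
        "\<forall>w \<in> words (length xs) i. v * f w - koszul_d xs c w \<in> L"
        unfolding Z_def by blast
      then have "\<forall>w \<in> words (length xs) i. (u + v) * f w - koszul_d xs (\<lambda>w. b w + c w) w \<in> L"
        by (auto simp: koszul_d_add algebra_simps dest: is_ideal_add[OF L])
          (metis (no_types, lifting) L add_diff_add is_ideal_add)
      then show "u + v \<in> Z" unfolding Z_def by blast
    next
      fix a u assume "u \<in> Z"
      then obtain b where "\<forall>w \<in> words (length xs) i. u * f w - koszul_d xs b w \<in> L"
        unfolding Z_def by blast
      then have "\<forall>w \<in> words (length xs) i. (a * u) * f w - koszul_d xs (\<lambda>w. a * b w) w \<in> L"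
        using is_ideal_mult[OF L, of _ a] by (fastforce simp: koszul_d_mult algebra_simps)
      then show "a * u \<in> Z" unfolding Z_def by blast
    qed
  qed
  then show ?thesis using z that unfolding Z_def by blast
qed

text \<open>
  One half of the long exact sequence of \<open>0 \<rightarrow> R/L \<rightarrow> R/L \<rightarrow> R/(L + z) \<rightarrow> 0\<close>, the first map being
  multiplication by \<open>z\<close>. A cocycle \<open>f\<close> has \<open>z f = d b\<close> since \<open>z\<close> kills cohomology; then \<open>b\<close> is a
  cocycle modulo \<open>z\<close>, hence \<open>b = d e + z c\<close>, and cancelling \<open>z\<close> from \<open>z f = z (d c)\<close> exhibits
  \<open>f\<close> as a coboundary.
\<close>

lemma koszul_vanish_of_adjoin:
  assumes L: "is_ideal L" and z: "z \<in> is_ideal hull (set xs)" "regular_mod L z"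
    and van: "i = 0 \<or> koszul_vanish xs (adjoin L z) (i - 1)"
  shows "koszul_vanish xs L i"
  unfolding koszul_vanish_def
proof (intro allI impI)
  let ?W = "words (length xs)"
  fix f assume f: "\<forall>w \<in> ?W (Suc i). koszul_d xs f w \<in> L"
  obtain b where b: "\<And>w. w \<in> ?W i \<Longrightarrow> z * f w - koszul_d xs b w \<in> L"
    using koszul_annihilated[OF L z(1), of i f] f by blast
  show "\<exists>e. \<forall>w\<in>?W i. f w - koszul_d xs e w \<in> L"
  proof (cases i)
    case 0
    have "f w \<in> L" if "w \<in> ?W i" for w
      using b[OF that] that z(2) 0 by (auto simp: koszul_d_degree_0 regular_mod_def)
    then show ?thesis by (intro exI[of _ "\<lambda>w. 0"]) (auto simp: koszul_d_zero)
  next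
    case (Suc j)
    have "koszul_d xs b w \<in> adjoin L z" if "w \<in> ?W (Suc j)" for w
    proof -
      have "koszul_d xs b w - z * f w \<in> L"
        using b that Suc is_ideal_diff_commute[OF L] by blast
      then show ?thesis unfolding adjoin_iff by blast
    qed
    then obtain e where e: "\<And>w. w \<in> ?W j \<Longrightarrow> b w - koszul_d xs e w \<in> adjoin L z"
      using van Suc koszul_vanishD[of xs "adjoin L z" j b] by auto
    then have "\<forall>w. \<exists>c. w \<in> ?W j \<longrightarrow> b w - koszul_d xs e w - z * c \<in> L"
      unfolding adjoin_iff by blast
    then obtain c where c: "\<And>w. w \<in> ?W j \<Longrightarrow> b w - koszul_d xs e w - z * c w \<in> L"
      by metis
    have "f w - koszul_d xs c w \<in> L" if w: "w \<in> ?W i" for w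
    proof -
      have "koszul_d xs (\<lambda>w. b w - koszul_d xs e w - z * c w) w \<in> L"
        using koszul_d_mem[OF L, of xs j "\<lambda>w. b w - koszul_d xs e w - z * c w" w] c w Suc by blast
      then have "koszul_d xs b w - z * koszul_d xs c w \<in> L"
        by (simp add: koszul_d_diff koszul_d_mult koszul_d_d)
      from is_ideal_add[OF L b[OF w] this] have "z * (f w - koszul_d xs c w) \<in> L"
        by (simp add: algebra_simps)
      then show ?thesis using z(2) by (auto simp: regular_mod_def)
    qed
    then show ?thesis by blast
  qed
qed

text \<open>
  The other half. If \<open>d f = z c\<close>, then \<open>c\<close> is a cocycle because \<open>z\<close> can be cancelled, hence
  \<open>c = d b\<close>, and \<open>f - z b\<close> is a cocycle that represents \<open>f\<close> modulo \<open>z\<close>.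
\<close>

lemma koszul_vanish_adjoin:
  assumes L: "is_ideal L" and z: "regular_mod L z"
    and van: "koszul_vanish xs L i" "koszul_vanish xs L (Suc i)"
  shows "koszul_vanish xs (adjoin L z) i"
  unfolding koszul_vanish_def
proof (intro allI impI)
  let ?W = "words (length xs)"
  fix f assume f: "\<forall>w \<in> ?W (Suc i). koszul_d xs f w \<in> adjoin L z"
  then have "\<forall>w. \<exists>c. w \<in> ?W (Suc i) \<longrightarrow> koszul_d xs f w - z * c \<in> L"
    unfolding adjoin_iff by blast
  then obtain c where c: "\<And>w. w \<in> ?W (Suc i) \<Longrightarrow> koszul_d xs f w - z * c w \<in> L"
    by metis
  have "koszul_d xs c w \<in> L" if w: "w \<in> ?W (Suc (Suc i))" for w
  proof -
    have "koszul_d xs (\<lambda>w. koszul_d xs f w - z * c w) w \<in> L"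
      using koszul_d_mem[OF L, of xs "Suc i" "\<lambda>w. koszul_d xs f w - z * c w" w] c w by blast
    then have "z * koszul_d xs c w \<in> L"
      using is_ideal_uminus[OF L] by (fastforce simp: koszul_d_diff koszul_d_mult koszul_d_d)
    then show ?thesis using z by (auto simp: regular_mod_def)
  qed
  then obtain b where b: "\<And>w. w \<in> ?W (Suc i) \<Longrightarrow> c w - koszul_d xs b w \<in> L"
    using koszul_vanishD[OF van(2), of c] by blast
  have "koszul_d xs (\<lambda>w. f w - z * b w) w \<in> L" if w: "w \<in> ?W (Suc i)" for w
  proof -
    have "(koszul_d xs f w - z * c w) + z * (c w - koszul_d xs b w) \<in> L"
      using c[OF w] b[OF w] L is_ideal_add is_ideal_mult by blast
    then show ?thesis by (simp add: koszul_d_diff koszul_d_mult algebra_simps)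
  qed
  then obtain e where e: "\<And>w. w \<in> ?W i \<Longrightarrow> f w - z * b w - koszul_d xs e w \<in> L"
    using koszul_vanishD[OF van(1), of "\<lambda>w. f w - z * b w"] by blast
  have "f w - koszul_d xs e w \<in> adjoin L z" if "w \<in> ?W i" for w
  proof -
    have "f w - koszul_d xs e w = (f w - z * b w - koszul_d xs e w) + z * b w" by simp
    then show ?thesis unfolding adjoin_def using e[OF that] by blast
  qed
  then show "\<exists>e. \<forall>w\<in>?W i. f w - koszul_d xs e w \<in> adjoin L z" by blast
qed

text \<open>
  This and the next lemma are the parts needed of the long exact sequence of
  \<open>0 \<rightarrow> R/(L1 \<inter> L2) \<rightarrow> R/L1 \<oplus> R/L2 \<rightarrow> R/(L1 + L2) \<rightarrow> 0\<close>. Here \<open>f\<close> is the coboundary of \<open>e1\<close> modulo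
  \<open>L1\<close> and of \<open>e2\<close> modulo \<open>L2\<close>; the difference is a cocycle modulo the sum, and correcting \<open>e1\<close>
  by its primitive yields a cochain that works for both ideals.
\<close>

lemma koszul_vanish_Int:
  assumes L: "is_ideal L1" "is_ideal L2"
    and van: "koszul_vanish xs L1 i" "koszul_vanish xs L2 i"
      "i = 0 \<or> koszul_vanish xs (ideal_sum L1 L2) (i - 1)"
  shows "koszul_vanish xs (L1 \<inter> L2) i"
  unfolding koszul_vanish_def
proof (intro allI impI)
  let ?W = "words (length xs)"
  fix f assume f: "\<forall>w \<in> ?W (Suc i). koszul_d xs f w \<in> L1 \<inter> L2"
  obtain e1 where e1: "\<And>w. w \<in> ?W i \<Longrightarrow> f w - koszul_d xs e1 w \<in> L1"
    using koszul_vanishD[OF van(1), of f] f by blast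
  obtain e2 where e2: "\<And>w. w \<in> ?W i \<Longrightarrow> f w - koszul_d xs e2 w \<in> L2"
    using koszul_vanishD[OF van(2), of f] f by blast
  show "\<exists>e. \<forall>w\<in>?W i. f w - koszul_d xs e w \<in> L1 \<inter> L2"
  proof (cases i)
    case 0
    have "f w \<in> L1 \<inter> L2" if "w \<in> ?W i" for w
      using e1[OF that] e2[OF that] that 0 by (auto simp: koszul_d_degree_0)
    then show ?thesis by (intro exI[of _ "\<lambda>w. 0"]) (auto simp: koszul_d_zero)
  next
    case (Suc j)
    have "koszul_d xs (\<lambda>w. e1 w - e2 w) w \<in> ideal_sum L1 L2" if "w \<in> ?W (Suc j)" for w
    proof -
      have "koszul_d xs (\<lambda>w. e1 w - e2 w) w
          = - (f w - koszul_d xs e1 w) + (f w - koszul_d xs e2 w)"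
        by (simp add: koszul_d_diff)
      moreover have "- (f w - koszul_d xs e1 w) \<in> L1" "f w - koszul_d xs e2 w \<in> L2"
        using e1 e2 that Suc is_ideal_uminus[OF L(1)] by blast+
      ultimately show ?thesis unfolding ideal_sum_def by blast
    qed
    then obtain g where g: "\<And>w. w \<in> ?W j \<Longrightarrow> e1 w - e2 w - koszul_d xs g w \<in> ideal_sum L1 L2"
      using van(3) Suc koszul_vanishD[of xs "ideal_sum L1 L2" j "\<lambda>w. e1 w - e2 w"] by auto
    then have "\<forall>w. \<exists>u. w \<in> ?W j \<longrightarrow> u \<in> L1 \<and> e1 w - e2 w - koszul_d xs g w - u \<in> L2"
      unfolding ideal_sum_iff by blast
    then obtain u where u: "\<And>w. w \<in> ?W j \<Longrightarrow> u w \<in> L1"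
        "\<And>w. w \<in> ?W j \<Longrightarrow> e1 w - e2 w - koszul_d xs g w - u w \<in> L2"
      by metis
    define e where "e w = e1 w - koszul_d xs g w - u w" for w
    have "f w - koszul_d xs e w \<in> L1 \<inter> L2" if w: "w \<in> ?W i" for w
    proof -
      have "koszul_d xs e w = koszul_d xs e1 w - koszul_d xs u w"
        unfolding e_def by (simp add: koszul_d_diff koszul_d_d)
      moreover have "koszul_d xs u w \<in> L1" using koszul_d_mem[OF L(1), of xs j u w] u(1) w Suc by blast
      moreover have "f w - (koszul_d xs e1 w - koszul_d xs u w)
          = (f w - koszul_d xs e1 w) + koszul_d xs u w" by simp
      ultimately have 1: "f w - koszul_d xs e w \<in> L1"
        using is_ideal_add[OF L(1) e1[OF w], of "koszul_d xs u w"] by argo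
      have "koszul_d xs (\<lambda>w. e1 w - e2 w - koszul_d xs g w - u w) w \<in> L2"
        using koszul_d_mem[OF L(2), of xs j "\<lambda>w. e1 w - e2 w - koszul_d xs g w - u w" w] u(2) w Suc by blast
      then have "koszul_d xs e1 w - koszul_d xs e2 w - koszul_d xs u w \<in> L2"
        by (simp add: koszul_d_diff koszul_d_d)
      moreover have "koszul_d xs e1 w - koszul_d xs e2 w - koszul_d xs u w
          = koszul_d xs e w - koszul_d xs e2 w"
        unfolding e_def by (simp add: koszul_d_diff koszul_d_d)
      ultimately have "koszul_d xs e w - koszul_d xs e2 w \<in> L2" by simp
      from is_ideal_diff[OF L(2) e2[OF w] this] have "f w - koszul_d xs e w \<in> L2" by simp
      with 1 show ?thesis by blast
    qed
    then show ?thesis by blast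
  qed
qed

text \<open>
  Splitting \<open>d f\<close> into a part \<open>u\<close> in \<open>L1\<close> and a part in \<open>L2\<close> makes \<open>u\<close> a cocycle modulo the
  intersection, which is the connecting homomorphism.
\<close>

lemma koszul_vanish_ideal_sum:
  assumes L: "is_ideal L1" "is_ideal L2"
    and van: "koszul_vanish xs L1 i" "koszul_vanish xs L2 i" "koszul_vanish xs (L1 \<inter> L2) (Suc i)"
  shows "koszul_vanish xs (ideal_sum L1 L2) i"
  unfolding koszul_vanish_def
proof (intro allI impI)
  let ?W = "words (length xs)"
  fix f assume "\<forall>w \<in> ?W (Suc i). koszul_d xs f w \<in> ideal_sum L1 L2"
  then have "\<forall>w. \<exists>u. w \<in> ?W (Suc i) \<longrightarrow> u \<in> L1 \<and> koszul_d xs f w - u \<in> L2"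
    unfolding ideal_sum_iff by blast
  then obtain u where u: "\<And>w. w \<in> ?W (Suc i) \<Longrightarrow> u w \<in> L1"
      "\<And>w. w \<in> ?W (Suc i) \<Longrightarrow> koszul_d xs f w - u w \<in> L2"
    by metis
  have "koszul_d xs u w \<in> L1 \<inter> L2" if w: "w \<in> ?W (Suc (Suc i))" for w
  proof -
    have "koszul_d xs (\<lambda>w. koszul_d xs f w - u w) w \<in> L2"
      using koszul_d_mem[OF L(2), of xs "Suc i" "\<lambda>w. koszul_d xs f w - u w" w] u(2) w by blast
    then have "koszul_d xs u w \<in> L2"
      using is_ideal_uminus[OF L(2)] by (fastforce simp: koszul_d_diff koszul_d_d)
    then show ?thesis using koszul_d_mem[OF L(1), of xs "Suc i" u w] u(1) w by blast
  qed
  then obtain e where e: "\<And>w. w \<in> ?W (Suc i) \<Longrightarrow> u w - koszul_d xs e w \<in> L1 \<inter> L2"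
    using koszul_vanishD[OF van(3), of u] by blast
  have "koszul_d xs e w \<in> L1" if "w \<in> ?W (Suc i)" for w
    using is_ideal_diff[OF L(1), of "u w" "u w - koszul_d xs e w"] e[OF that] u(1)[OF that] by simp
  then obtain g1 where g1: "\<And>w. w \<in> ?W i \<Longrightarrow> e w - koszul_d xs g1 w \<in> L1"
    using koszul_vanishD[OF van(1), of e] by blast
  have "koszul_d xs (\<lambda>w. f w - e w) w \<in> L2" if "w \<in> ?W (Suc i)" for w
    using is_ideal_add[OF L(2), of "koszul_d xs f w - u w" "u w - koszul_d xs e w"]
      e[OF that] u(2)[OF that] by (simp add: koszul_d_diff)
  then obtain g2 where g2: "\<And>w. w \<in> ?W i \<Longrightarrow> f w - e w - koszul_d xs g2 w \<in> L2"
    using koszul_vanishD[OF van(2), of "\<lambda>w. f w - e w"] by blast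
  have "f w - koszul_d xs (\<lambda>w. g1 w + g2 w) w \<in> ideal_sum L1 L2" if "w \<in> ?W i" for w
  proof -
    have "f w - koszul_d xs (\<lambda>w. g1 w + g2 w) w
        = (e w - koszul_d xs g1 w) + (f w - e w - koszul_d xs g2 w)"
      by (simp add: koszul_d_add)
    then show ?thesis unfolding ideal_sum_def using g1[OF that] g2[OF that] by blast
  qed
  then show "\<exists>e. \<forall>w\<in>?W i. f w - koszul_d xs e w \<in> ideal_sum L1 L2" by blast
qed

definition koszul_depth :: "'a::comm_ring_1 list \<Rightarrow> 'a set \<Rightarrow> nat \<Rightarrow> bool" where
  "koszul_depth xs L d \<longleftrightarrow> (\<forall>i<d. koszul_vanish xs L i) \<and> \<not> koszul_vanish xs L d"

lemma koszul_depth_Suc: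
  assumes "is_ideal L" "z \<in> is_ideal hull (set xs)" "regular_mod L z"
    and "koszul_depth xs (adjoin L z) d"
  shows "koszul_depth xs L (Suc d)"
proof -
  have van: "koszul_vanish xs L i" if "i < Suc d" for i
    using koszul_vanish_of_adjoin[OF assms(1-3), of i] assms(4) that
    by (cases i) (auto simp: koszul_depth_def)
  then show ?thesis
    using koszul_vanish_adjoin[OF assms(1,3), of xs d] assms(4) by (auto simp: koszul_depth_def)
qed

lemma koszul_depth_Int:
  assumes "is_ideal L1" "is_ideal L2"
    and "\<And>i. i \<le> d \<Longrightarrow> koszul_vanish xs L1 i" "\<And>i. i \<le> d \<Longrightarrow> koszul_vanish xs L2 i"
    and "koszul_depth xs (ideal_sum L1 L2) d"
  shows "koszul_depth xs (L1 \<inter> L2) (Suc d)"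
proof -
  have "koszul_vanish xs (L1 \<inter> L2) i" if "i < Suc d" for i
    using that assms(5) koszul_vanish_Int[OF assms(1,2) assms(3)[of i] assms(4)[of i]]
    by (cases i) (auto simp: koszul_depth_def)
  then show ?thesis
    using koszul_vanish_ideal_sum[OF assms(1,2) assms(3)[of d] assms(4)[of d]] assms(5)
    by (auto simp: koszul_depth_def)
qed

lemma words_degree_0: "words N 0 = {replicate N False}"
proof (induction N)
  case (Suc N)
  have "w \<in> words (Suc N) 0 \<longleftrightarrow> w = replicate (Suc N) False" for w
    using Suc by (auto simp: words_Suc_iff)
  then show ?case by blast
qed simp

lemma ball_words_Suc:
  "(\<forall>w\<in>words (Suc N) (Suc i). P w) \<longleftrightarrow>
     (\<forall>w\<in>words N (Suc i). P (False # w)) \<and> (\<forall>w\<in>words N i. P (True # w))"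
  by (auto simp: words_Suc_iff)

lemma koszul_cocycle_0_iff:
  assumes "is_ideal L"
  shows "(\<forall>w \<in> words (length xs) (Suc 0). koszul_d xs f w \<in> L)
    \<longleftrightarrow> (\<forall>x \<in> set xs. x * f (replicate (length xs) False) \<in> L)"
proof (induction xs arbitrary: f)
  case (Cons x xs)
  have "(\<forall>w \<in> words (length (x # xs)) (Suc 0). koszul_d (x # xs) f w \<in> L)
    \<longleftrightarrow> (\<forall>w \<in> words (length xs) (Suc 0). koszul_d xs (\<lambda>v. f (False # v)) w \<in> L) \<and>
        (\<forall>w \<in> words (length xs) 0. x * f (False # w) \<in> L)"
    by (simp add: ball_words_Suc koszul_d_degree_0)
  then show ?case using Cons.IH[of "\<lambda>v. f (False # v)"] by (auto simp: words_degree_0)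
qed simp

text \<open>
  In degree 0 the cohomology is the socle of \<open>R / L\<close>.
\<close>

lemma koszul_vanish_0_iff:
  assumes "is_ideal L"
  shows "koszul_vanish xs L 0 \<longleftrightarrow> (\<forall>u. (\<forall>x\<in>set xs. x * u \<in> L) \<longrightarrow> u \<in> L)"
proof -
  have "koszul_vanish xs L 0 \<longleftrightarrow> (\<forall>f. (\<forall>x \<in> set xs. x * f (replicate (length xs) False) \<in> L)
      \<longrightarrow> f (replicate (length xs) False) \<in> L)"
    unfolding koszul_vanish_def koszul_cocycle_0_iff[OF assms]
    by (auto simp: words_degree_0 koszul_d_degree_0)
  also have "\<dots> \<longleftrightarrow> (\<forall>u. (\<forall>x\<in>set xs. x * u \<in> L) \<longrightarrow> u \<in> L)"
  proof safe
    fix u assume *: "\<forall>f. (\<forall>x \<in> set xs. x * f (replicate (length xs) False) \<in> L)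
      \<longrightarrow> f (replicate (length xs) False) \<in> L" and "\<forall>x\<in>set xs. x * u \<in> L"
    then show "u \<in> L" using spec[OF *, of "\<lambda>_. u"] by simp
  qed auto
  finally show ?thesis .
qed

section \<open>Regular sequences\<close>

fun regular_seq :: "'a::comm_ring_1 set \<Rightarrow> 'a list \<Rightarrow> bool" where
  "regular_seq L [] \<longleftrightarrow> True"
| "regular_seq L (y # ys) \<longleftrightarrow> regular_mod L y \<and> regular_seq (adjoin L y) ys"

text \<open>
  This bounds the length of every regular sequence in the ideal by the first degree with
  nonvanishing cohomology, and so gives the upper bound for the depth.
\<close>

lemma koszul_vanish_of_regular_seq:
  assumes "is_ideal L" "set ys \<subseteq> is_ideal hull (set xs)" "regular_seq L ys" "i < length ys"
  shows "koszul_vanish xs L i"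
  using assms
proof (induction ys arbitrary: L i)
  case (Cons y ys)
  then have "i = 0 \<or> koszul_vanish xs (adjoin L y) (i - 1)"
    using Cons.IH[of "adjoin L y" "i - 1"] is_ideal_adjoin by (cases i) auto
  then show ?case using Cons.prems by (intro koszul_vanish_of_adjoin[of L y]) auto
qed simp

section \<open>Existence of regular elements\<close>

definition noetherian_above :: "'a::comm_ring_1 set \<Rightarrow> bool" where
  "noetherian_above L0 \<longleftrightarrow> (\<forall>\<C>. \<C> \<noteq> {} \<longrightarrow> (\<forall>L\<in>\<C>. is_ideal L \<and> L0 \<subseteq> L) \<longrightarrow>
     (\<exists>M\<in>\<C>. \<forall>L\<in>\<C>. M \<subseteq> L \<longrightarrow> L = M))"

lemma noetherian_above_mono: "noetherian_above L0 \<Longrightarrow> L0 \<subseteq> L1 \<Longrightarrow> noetherian_above L1"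
  unfolding noetherian_above_def by (meson subset_trans)

definition prime_ideal :: "'a::comm_ring_1 set \<Rightarrow> bool" where
  "prime_ideal P \<longleftrightarrow> is_ideal P \<and> 1 \<notin> P \<and> (\<forall>a b. a * b \<in> P \<longrightarrow> a \<in> P \<or> b \<in> P)"

lemma prime_ideal_is_ideal: "prime_ideal P \<Longrightarrow> is_ideal P"
  and prime_ideal_mult: "prime_ideal P \<Longrightarrow> a \<notin> P \<Longrightarrow> b \<notin> P \<Longrightarrow> a * b \<notin> P"
  by (auto simp: prime_ideal_def)

lemma exists_in_all_but_not_in_prime:
  assumes "finite \<Q>" "prime_ideal P" "is_ideal I" "\<not> I \<subseteq> P"
    and "\<forall>Q\<in>\<Q>. is_ideal Q \<and> \<not> Q \<subseteq> P"
  shows "\<exists>w\<in>I. w \<notin> P \<and> (\<forall>Q\<in>\<Q>. w \<in> Q)"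
  using assms(1,5)
proof (induction \<Q> rule: finite_induct)
  case empty
  then show ?case using assms(4) by blast
next
  case (insert Q \<Q>)
  from insert.prems have "\<forall>Q\<in>\<Q>. is_ideal Q \<and> \<not> Q \<subseteq> P" by simp
  then obtain w where w: "w \<in> I" "w \<notin> P" "\<forall>Q\<in>\<Q>. w \<in> Q"
    using insert.IH by meson
  obtain q where q: "q \<in> Q" "q \<notin> P"
    using insert.prems by (meson insertI1 subsetI)
  have "q * w \<in> I" "q * w \<notin> P"
    using w q assms(2,3) by (simp_all add: prime_ideal_mult is_ideal_mult)
  moreover have "\<forall>R\<in>\<Q>. q * w \<in> R"
    using w(3) insert.prems by (simp add: is_ideal_mult)
  moreover have "q * w \<in> Q"
    using is_ideal_mult[of Q q w] q(1) insert.prems by (simp add: mult.commute)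
  ultimately show ?case by (intro bexI[of _ "q * w"]) simp_all
qed

lemma prime_avoidance:
  assumes "finite \<P>" "is_ideal I" "\<forall>P\<in>\<P>. prime_ideal P \<and> \<not> I \<subseteq> P"
    and "\<forall>P\<in>\<P>. \<forall>Q\<in>\<P>. P \<subseteq> Q \<longrightarrow> P = Q"
  shows "\<exists>z\<in>I. \<forall>P\<in>\<P>. z \<notin> P"
  using assms(1,3,4)
proof (induction \<P> rule: finite_induct)
  case empty
  then show ?case using is_ideal_zero[OF assms(2)] by blast
next
  case (insert P \<P>)
  have "\<exists>z\<in>I. \<forall>Q\<in>\<P>. z \<notin> Q"
    by (rule insert.IH) (use insert.prems in simp_all)
  then obtain z where z: "z \<in> I" "\<forall>Q\<in>\<P>. z \<notin> Q" by meson
  show ?case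
  proof (cases "z \<in> P")
    case True
    have "\<forall>Q\<in>\<P>. is_ideal Q \<and> \<not> Q \<subseteq> P"
    proof
      fix Q assume "Q \<in> \<P>"
      then show "is_ideal Q \<and> \<not> Q \<subseteq> P"
        using insert.prems insert.hyps(2) prime_ideal_is_ideal[of Q] by (metis insertCI)
    qed
    moreover have "prime_ideal P" "\<not> I \<subseteq> P" using insert.prems by simp_all
    ultimately obtain w where w: "w \<in> I" "w \<notin> P" "\<forall>Q\<in>\<P>. w \<in> Q"
      using exists_in_all_but_not_in_prime[OF insert.hyps(1) _ assms(2)] by meson
    \<comment> \<open>Adding \<open>w\<close> moves \<open>z\<close> out of \<open>P\<close> without changing it modulo the other primes.\<close>
    have "z + w \<notin> P"
    proof
      assume "z + w \<in> P"
      then have "z + w - z \<in> P"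
        using True insert.prems(1) prime_ideal_is_ideal[of P] by (intro is_ideal_diff) simp_all
      then show False using w(2) by simp
    qed
    moreover have "z + w \<notin> Q" if Q: "Q \<in> \<P>" for Q
    proof
      assume "z + w \<in> Q"
      then have "z + w - w \<in> Q"
        using w(3) Q insert.prems(1) prime_ideal_is_ideal[of Q] by (intro is_ideal_diff) simp_all
      then show False using z(2) Q by simp
    qed
    ultimately show ?thesis
      using is_ideal_add[OF assms(2) z(1) w(1)] by (intro bexI[of _ "z + w"]) simp_all
  next
    case False
    then show ?thesis using z by blast
  qed
qed

lemma is_ideal_colon: "is_ideal L \<Longrightarrow> is_ideal {a. a * u \<in> L}"
  by (simp add: is_ideal_def distrib_right mult.assoc)

text \<open>
  The zero divisors modulo \<open>L\<close> are covered by the maximal ones among the annihilators of single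
  nonzero elements of \<open>R / L\<close>. These are prime, and by the Noetherian condition there are only
  finitely many of them. None contains \<open>I\<close>, since the element annihilated would lie in the socle,
  so prime avoidance applies.
\<close>

lemma exists_regular_element:
  assumes L: "is_ideal L" "noetherian_above L" and I: "is_ideal I"
    and no_socle: "\<And>u. (\<forall>x\<in>I. x * u \<in> L) \<Longrightarrow> u \<in> L"
  shows "\<exists>z\<in>I. regular_mod L z"
proof (rule ccontr)
  assume "\<not> ?thesis"
  then have zd: "\<exists>u. u \<notin> L \<and> z * u \<in> L" if "z \<in> I" for z
    using that unfolding regular_mod_def by blast
  define colon where "colon u = {a. a * u \<in> L}" for u
  have colon_ideal: "is_ideal (colon u)" for u
    unfolding colon_def using L(1) by (rule is_ideal_colon)
  have colon_sup: "L \<subseteq> colon u" for u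
    unfolding colon_def using is_ideal_mult[OF L(1), of _ u] by (auto simp: mult.commute)
  define Max where
    "Max = {v. v \<notin> L \<and> (\<forall>u. u \<notin> L \<longrightarrow> colon v \<subseteq> colon u \<longrightarrow> colon u = colon v)}"
  then have MaxD: "colon u = colon v"
    if "v \<in> Max" "u \<in> Max" "colon v \<subseteq> colon u" for u v
    using that by simp
  have ex_Max: "\<exists>v\<in>Max. colon u \<subseteq> colon v" if u: "u \<notin> L" for u
  proof -
    let ?C = "{colon v | v. v \<notin> L \<and> colon u \<subseteq> colon v}"
    have "?C \<noteq> {}" using u by blast
    moreover have "\<forall>M\<in>?C. is_ideal M \<and> L \<subseteq> M" using colon_ideal colon_sup by blast
    ultimately obtain M where M: "M \<in> ?C" "\<And>N. N \<in> ?C \<Longrightarrow> M \<subseteq> N \<Longrightarrow> N = M"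
      using L(2) unfolding noetherian_above_def by meson
    then obtain v where v: "M = colon v" "v \<notin> L" "colon u \<subseteq> colon v" by blast
    have "v \<in> Max" unfolding Max_def
    proof (intro CollectI conjI allI impI v(2))
      fix w assume "w \<notin> L" "colon v \<subseteq> colon w"
      then show "colon w = colon v" using M(2)[of "colon w"] v by blast
    qed
    then show ?thesis using v by blast
  qed
  have prime: "prime_ideal (colon v)" if v: "v \<in> Max" for v
    unfolding prime_ideal_def
  proof (intro conjI allI impI colon_ideal)
    show "1 \<notin> colon v" using v unfolding Max_def colon_def by simp
    fix a b assume ab: "a * b \<in> colon v"
    show "a \<in> colon v \<or> b \<in> colon v"
    proof (cases "b * v \<in> L")
      case False
      have "colon v \<subseteq> colon (b * v)"
      proof
        fix x assume "x \<in> colon v"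
        then have "b * (x * v) \<in> L" unfolding colon_def using is_ideal_mult[OF L(1)] by simp
        then show "x \<in> colon (b * v)" unfolding colon_def by (simp add: mult.left_commute)
      qed
      then have "colon (b * v) = colon v" using v False unfolding Max_def by blast
      moreover have "a \<in> colon (b * v)" using ab unfolding colon_def by (simp add: mult.assoc)
      ultimately show ?thesis by blast
    qed (simp add: colon_def)
  qed
  \<comment> \<open>A maximal ideal \<open>M\<close> among those generated by \<open>L\<close> and finitely many elements of \<open>Max\<close>
    contains all of \<open>Max\<close>; this leads to finitely many annihilators.\<close>
  let ?D = "{is_ideal hull (L \<union> F) | F. finite F \<and> F \<subseteq> Max}"
  have "?D \<noteq> {}" by blast
  moreover have "\<forall>M\<in>?D. is_ideal M \<and> L \<subseteq> M"
    using is_ideal_hull hull_subset[of _ is_ideal] by blast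
  ultimately obtain M where M: "M \<in> ?D" "\<And>N. N \<in> ?D \<Longrightarrow> M \<subseteq> N \<Longrightarrow> N = M"
    using L(2) unfolding noetherian_above_def by meson
  then obtain F where F: "M = is_ideal hull (L \<union> F)" "finite F" "F \<subseteq> Max" by blast
  have MaxM: "v \<in> M" if v: "v \<in> Max" for v
  proof -
    have "is_ideal hull (L \<union> insert v F) \<in> ?D" using F v by blast
    moreover have "M \<subseteq> is_ideal hull (L \<union> insert v F)" unfolding F(1) by (rule hull_mono) blast
    ultimately show ?thesis using M(2) hull_inc[of v "L \<union> insert v F" is_ideal] by blast
  qed
  \<comment> \<open>Otherwise some \<open>w\<close> annihilates all elements of \<open>F\<close>, hence all of \<open>M\<close>, but not \<open>v \<in> M\<close>.\<close>
  have cover: "\<exists>f\<in>F. colon v = colon f" if v: "v \<in> Max" for v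
  proof (rule ccontr)
    assume neg: "\<not> ?thesis"
    have "\<not> colon f \<subseteq> colon v" if f: "f \<in> F" for f
    proof
      assume "colon f \<subseteq> colon v"
      then have "colon v = colon f" using f F(3) v by (intro MaxD) auto
      then show False using neg f by blast
    qed
    then have "\<exists>w\<in>UNIV. w \<notin> colon v \<and> (\<forall>Q\<in>colon ` F. w \<in> Q)"
      using F(2) prime[OF v] colon_ideal
      by (intro exists_in_all_but_not_in_prime) (auto simp: is_ideal_def prime_ideal_def[of "colon v"])
    then obtain w where "w \<notin> colon v \<and> (\<forall>Q\<in>colon ` F. w \<in> Q)" by (elim bexE)
    then have w: "w \<notin> colon v" "\<And>f. f \<in> F \<Longrightarrow> w * f \<in> L"
      by (auto simp: colon_def)
    have "M \<subseteq> {u. u * w \<in> L}" unfolding F(1)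
    proof (rule hull_minimal)
      show "L \<union> F \<subseteq> {u. u * w \<in> L}"
        using w(2) is_ideal_mult[OF L(1), of _ w] by (auto simp: mult.commute)
    qed (rule is_ideal_colon[OF L(1)])
    then have "M \<subseteq> {u. w * u \<in> L}" by (simp add: mult.commute)
    then show False using MaxM[OF v] w(1) unfolding colon_def by auto
  qed
  have "\<exists>z\<in>I. \<forall>P\<in>colon ` F. z \<notin> P"
  proof (rule prime_avoidance)
    show "\<forall>P\<in>colon ` F. prime_ideal P \<and> \<not> I \<subseteq> P"
    proof safe
      fix f assume "f \<in> F"
      then show "prime_ideal (colon f)" using prime F(3) by blast
      assume "I \<subseteq> colon f"
      then have "f \<in> L" using no_socle unfolding colon_def by blast
      then show False using \<open>f \<in> F\<close> F(3) unfolding Max_def by blast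
    qed
    show "\<forall>P\<in>colon ` F. \<forall>Q\<in>colon ` F. P \<subseteq> Q \<longrightarrow> P = Q"
    proof (intro ballI impI)
      fix P Q assume "P \<in> colon ` F" "Q \<in> colon ` F" "P \<subseteq> Q"
      then obtain f g where "f \<in> F" "g \<in> F" "P = colon f" "Q = colon g" by blast
      then show "P = Q" using MaxD[of f g] F(3) \<open>P \<subseteq> Q\<close> by auto
    qed
  qed (use F I in auto)
  then obtain z where "z \<in> I" and "\<forall>P\<in>colon ` F. z \<notin> P" by (elim bexE)
  then have z: "z \<in> I" "\<And>f. f \<in> F \<Longrightarrow> z \<notin> colon f" by simp_all
  obtain u where "u \<notin> L" "z * u \<in> L" using zd[OF z(1)] by blast
  then have "z \<in> colon u" by (simp add: colon_def)
  then obtain v where "v \<in> Max" "z \<in> colon v" using ex_Max[OF \<open>u \<notin> L\<close>] by (elim bexE) blast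
  then obtain f where "f \<in> F" "z \<in> colon f" using cover[OF \<open>v \<in> Max\<close>] by (elim bexE) simp
  then show False using z(2) by simp
qed

lemma exists_regular_seq:
  assumes "is_ideal L" "noetherian_above L" "\<forall>i<t. koszul_vanish xs L i"
  shows "\<exists>ys. length ys = t \<and> set ys \<subseteq> is_ideal hull (set xs) \<and> regular_seq L ys"
  using assms
proof (induction t arbitrary: L)
  case (Suc t)
  have "\<exists>z \<in> is_ideal hull (set xs). regular_mod L z"
  proof (rule exists_regular_element[OF Suc.prems(1,2) is_ideal_hull])
    fix u assume "\<forall>x\<in>is_ideal hull (set xs). x * u \<in> L"
    then have "\<forall>x\<in>set xs. x * u \<in> L" by (simp add: hull_inc)
    then show "u \<in> L" using Suc.prems koszul_vanish_0_iff[of L xs] by auto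
  qed
  then obtain z where z: "z \<in> is_ideal hull (set xs)" "regular_mod L z" by blast
  have "\<exists>ys. length ys = t \<and> set ys \<subseteq> is_ideal hull (set xs) \<and> regular_seq (adjoin L z) ys"
  proof (rule Suc.IH)
    show "\<forall>i<t. koszul_vanish xs (adjoin L z) i"
      using koszul_vanish_adjoin[OF Suc.prems(1) z(2)] Suc.prems(3) by auto
  qed (use Suc.prems is_ideal_adjoin noetherian_above_mono adjoin_superset in blast)+
  then obtain ys where "length ys = t" "set ys \<subseteq> is_ideal hull (set xs)" "regular_seq (adjoin L z) ys"
    by blast
  then show ?case using z by (intro exI[of _ "z # ys"]) auto
qed simp

section \<open>Ideals given by a labelling of the monomials\<close>

lemma poly_eq_sum_single:
  fixes p :: "'m \<Rightarrow>\<^sub>0 'k::comm_monoid_add"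
  shows "p = (\<Sum>t\<in>Poly_Mapping.keys p. Poly_Mapping.single t (Poly_Mapping.lookup p t))"
proof (rule poly_mapping_eqI)
  fix s
  show "Poly_Mapping.lookup p s
    = Poly_Mapping.lookup (\<Sum>t\<in>Poly_Mapping.keys p. Poly_Mapping.single t (Poly_Mapping.lookup p t)) s"
    by (simp add: lookup_sum lookup_single when_def in_keys_iff)
qed

lemma keys_plus_nat:
  fixes s t :: "'x \<Rightarrow>\<^sub>0 nat"
  shows "Poly_Mapping.keys (s + t) = Poly_Mapping.keys s \<union> Poly_Mapping.keys t"
  by (auto simp: in_keys_iff lookup_add)

lemma split_off_variable:
  fixes t :: "'x \<Rightarrow>\<^sub>0 nat"
  assumes "x \<in> Poly_Mapping.keys t"
  obtains u where "t = Poly_Mapping.single x 1 + u"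
proof
  have 0: "Poly_Mapping.lookup t x \<noteq> 0" using assms by (simp add: in_keys_iff)
  show "t = Poly_Mapping.single x 1 + (t - Poly_Mapping.single x 1)"
  proof (rule poly_mapping_eqI)
    fix y
    show "Poly_Mapping.lookup t y
      = Poly_Mapping.lookup (Poly_Mapping.single x 1 + (t - Poly_Mapping.single x 1)) y"
      using 0 by (cases "x = y") (auto simp: lookup_add lookup_minus lookup_single)
  qed
qed

lemma lookup_single_mult:
  fixes p :: "'m::cancel_comm_monoid_add \<Rightarrow>\<^sub>0 'k::comm_semiring_1"
  shows "Poly_Mapping.lookup (Poly_Mapping.single s c * p) (s + t) = c * Poly_Mapping.lookup p t"
proof -
  have "Poly_Mapping.single s c * p
      = (\<Sum>u\<in>Poly_Mapping.keys p. Poly_Mapping.single (s + u) (c * Poly_Mapping.lookup p u))"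
    by (subst poly_eq_sum_single[of p]) (simp add: sum_distrib_left mult_single)
  then show ?thesis
    by (simp add: lookup_sum lookup_single when_def in_keys_iff)
qed

text \<open>
  Multiplication by constants makes this the notion of a linear subspace. It is weaker than
  \<open>is_ideal\<close> so that it also covers ideals of a polynomial ring in fewer variables.
\<close>

definition is_subspace :: "('m::comm_monoid_add \<Rightarrow>\<^sub>0 'k::field) set \<Rightarrow> bool" where
  "is_subspace W \<longleftrightarrow> 0 \<in> W \<and> (\<forall>u\<in>W. \<forall>v\<in>W. u + v \<in> W) \<and>
     (\<forall>c. \<forall>u\<in>W. Poly_Mapping.single 0 c * u \<in> W)"

lemma is_ideal_is_subspace: "is_ideal W \<Longrightarrow> is_subspace W"
  by (auto simp: is_ideal_def is_subspace_def)

lemma is_subspace_sum: "is_subspace W \<Longrightarrow> (\<And>i. i \<in> A \<Longrightarrow> f i \<in> W) \<Longrightarrow> sum f A \<in> W"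
  by (induction A rule: infinite_finite_induct) (auto simp: is_subspace_def)

definition class_sum :: "('m \<Rightarrow> 'c) \<Rightarrow> ('m \<Rightarrow>\<^sub>0 'k::comm_monoid_add) \<Rightarrow> 'c \<Rightarrow> 'k" where
  "class_sum lab p c = (\<Sum>t\<in>Poly_Mapping.keys p. if lab t = c then Poly_Mapping.lookup p t else 0)"

lemma class_sum_superset:
  assumes "finite A" "Poly_Mapping.keys p \<subseteq> A"
  shows "class_sum lab p c = (\<Sum>t\<in>A. if lab t = c then Poly_Mapping.lookup p t else 0)"
  unfolding class_sum_def using assms
  by (intro sum.mono_neutral_left) (auto simp: in_keys_iff)

lemma class_sum_zero [simp]: "class_sum lab 0 c = 0"
  by (simp add: class_sum_def)

lemma class_sum_add: "class_sum lab (p + q) c = class_sum lab p c + class_sum lab q c"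
proof -
  let ?A = "Poly_Mapping.keys p \<union> Poly_Mapping.keys q"
  have "class_sum lab (p + q) c
      = (\<Sum>t\<in>?A. if lab t = c then Poly_Mapping.lookup (p + q) t else 0)"
    by (rule class_sum_superset) (auto simp: Poly_Mapping.keys_add)
  also have "\<dots> = class_sum lab p c + class_sum lab q c"
    by (subst (1 2) class_sum_superset[of ?A])
      (auto simp: lookup_add sum.distrib[symmetric] intro!: sum.cong)
  finally show ?thesis .
qed

lemma class_sum_single: "class_sum lab (Poly_Mapping.single t a) c = (if lab t = c then a else 0)"
  by (subst class_sum_superset[of "{t}"]) auto

lemma class_sum_single_mult:
  fixes p :: "'m::cancel_comm_monoid_add \<Rightarrow>\<^sub>0 'k::comm_semiring_1"
  shows "class_sum lab (Poly_Mapping.single s a * p) c = a * class_sum (\<lambda>t. lab (s + t)) p c"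
proof -
  have k: "Poly_Mapping.keys (Poly_Mapping.single s a * p) \<subseteq> (+) s ` Poly_Mapping.keys p"
    using keys_mult[of "Poly_Mapping.single s a" p] by (auto split: if_splits)
  have "class_sum lab (Poly_Mapping.single s a * p) c
      = (\<Sum>t\<in>Poly_Mapping.keys p. if lab (s + t) = c
          then Poly_Mapping.lookup (Poly_Mapping.single s a * p) (s + t) else 0)"
    by (subst class_sum_superset[OF _ k]) (auto simp: sum.reindex)
  then show ?thesis
    by (simp add: lookup_single_mult class_sum_def sum_distrib_left if_distrib cong: if_cong)
qed

text \<open>
  The tool by which all inclusions between the ideals below are proved. The terms of a polynomial
  in one class can be collected modulo \<open>W\<close> at a single monomial, where the coefficients add up to
  the class sum.
\<close>

lemma mem_subspace_by_classes:
  fixes p :: "'m::comm_monoid_add \<Rightarrow>\<^sub>0 'k::field"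
  assumes W: "is_subspace W"
    and diff: "\<And>t t'. t \<in> Poly_Mapping.keys p \<Longrightarrow> t' \<in> Poly_Mapping.keys p \<Longrightarrow> lab t = lab t' \<Longrightarrow>
      Poly_Mapping.single t 1 - Poly_Mapping.single t' 1 \<in> W"
    and sum: "\<And>t. t \<in> Poly_Mapping.keys p \<Longrightarrow>
      class_sum lab p (lab t) = 0 \<or> Poly_Mapping.single t 1 \<in> W"
  shows "p \<in> W"
proof -
  let ?K = "Poly_Mapping.keys p"
  let ?x = "\<lambda>t. Poly_Mapping.single t (Poly_Mapping.lookup p t)"
  have "(\<Sum>t | t \<in> ?K \<and> lab t = lab t0. ?x t) \<in> W" if t0: "t0 \<in> ?K" for t0
  proof -
    let ?D = "{t \<in> ?K. lab t = lab t0}"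
    have 1: "Poly_Mapping.single 0 (Poly_Mapping.lookup p t)
        * (Poly_Mapping.single t 1 - Poly_Mapping.single t0 1) \<in> W" if "t \<in> ?D" for t
      using diff[of t t0] that t0 W by (auto simp: is_subspace_def)
    have 2: "Poly_Mapping.single 0 (class_sum lab p (lab t0)) * Poly_Mapping.single t0 1 \<in> W"
      using sum[OF t0] W by (auto simp: is_subspace_def)
    have "(\<Sum>t\<in>?D. ?x t)
        = (\<Sum>t\<in>?D. ?x t - Poly_Mapping.single t0 (Poly_Mapping.lookup p t))
          + (\<Sum>t\<in>?D. Poly_Mapping.single t0 (Poly_Mapping.lookup p t))"
      by (simp add: sum_subtractf)
    also have "(\<Sum>t\<in>?D. Poly_Mapping.single t0 (Poly_Mapping.lookup p t))
        = Poly_Mapping.single t0 (class_sum lab p (lab t0))"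
    proof -
      have "class_sum lab p (lab t0) = (\<Sum>t\<in>?D. Poly_Mapping.lookup p t)"
        unfolding class_sum_def by (simp add: sum.If_cases Int_def)
      moreover have "Poly_Mapping.single t0 (\<Sum>t\<in>A. f t) = (\<Sum>t\<in>A. Poly_Mapping.single t0 (f t))"
        for f :: "'m \<Rightarrow> 'k" and A
        by (induction A rule: infinite_finite_induct) (simp_all add: single_add)
      ultimately show ?thesis by simp
    qed
    also have "(\<Sum>t\<in>?D. ?x t - Poly_Mapping.single t0 (Poly_Mapping.lookup p t))
        = (\<Sum>t\<in>?D. Poly_Mapping.single 0 (Poly_Mapping.lookup p t)
             * (Poly_Mapping.single t 1 - Poly_Mapping.single t0 1))"
      by (simp add: right_diff_distrib mult_single)
    finally have eq: "(\<Sum>t\<in>?D. ?x t) = (\<Sum>t\<in>?D. Poly_Mapping.single 0 (Poly_Mapping.lookup p t)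
             * (Poly_Mapping.single t 1 - Poly_Mapping.single t0 1))
        + Poly_Mapping.single 0 (class_sum lab p (lab t0)) * Poly_Mapping.single t0 1"
      by (simp add: mult_single)
    have "(\<Sum>t\<in>?D. Poly_Mapping.single 0 (Poly_Mapping.lookup p t)
             * (Poly_Mapping.single t 1 - Poly_Mapping.single t0 1)) \<in> W"
      by (rule is_subspace_sum[OF W 1])
    then show ?thesis using 2 W unfolding eq by (simp add: is_subspace_def)
  qed
  then have "(\<Sum>t | t \<in> ?K \<and> lab t = c. ?x t) \<in> W" if "c \<in> lab ` ?K" for c
    using that by blast
  then have "(\<Sum>c\<in>lab ` ?K. \<Sum>t | t \<in> ?K \<and> lab t = c. ?x t) \<in> W"
    by (rule is_subspace_sum[OF W])
  also have "(\<Sum>c\<in>lab ` ?K. \<Sum>t | t \<in> ?K \<and> lab t = c. ?x t) = (\<Sum>t\<in>?K. ?x t)"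
    by (rule sum.group) auto
  also have "\<dots> = p" by (rule poly_eq_sum_single[symmetric])
  finally show ?thesis .
qed

text \<open>
  The span of the monomials labelled \<open>None\<close> and of the differences of monomials with equal labels.
  If the labels are compatible with multiplication, the quotient is the algebra of the monoid of
  classes, the class labelled \<open>None\<close> being zero.
\<close>

definition class_ideal :: "('m \<Rightarrow> 'c option) \<Rightarrow> ('m \<Rightarrow>\<^sub>0 'k::field) set" where
  "class_ideal lab = {p. \<forall>c. class_sum lab p (Some c) = 0}"

lemma single_mem_class_ideal: "lab t = None \<Longrightarrow> Poly_Mapping.single t a \<in> class_ideal lab"
  by (simp add: class_ideal_def class_sum_single)

lemma binomial_mem_class_ideal:
  assumes "lab t = lab t'"
  shows "Poly_Mapping.single t a - Poly_Mapping.single t' a \<in> class_ideal lab"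
proof -
  have eq: "Poly_Mapping.single t a - Poly_Mapping.single t' a
      = Poly_Mapping.single t a + Poly_Mapping.single t' (- a)"
    by (simp add: single_uminus)
  show ?thesis
    unfolding eq class_ideal_def using assms by (simp add: class_sum_add class_sum_single del: single_uminus)
qed

lemma class_ideal_class_sum:
  assumes "p \<in> class_ideal lab"
  shows "class_sum lab p (lab t) = 0 \<or> lab t = None"
  using assms by (cases "lab t") (auto simp: class_ideal_def)

lemma is_subspace_class_ideal:
  "is_subspace (class_ideal lab :: ('m::cancel_comm_monoid_add \<Rightarrow>\<^sub>0 'k::field) set)"
  by (auto simp: is_subspace_def class_ideal_def class_sum_add class_sum_single_mult)

lemma class_ideal_subset:
  fixes lab :: "'m::cancel_comm_monoid_add \<Rightarrow> 'c option"
  assumes "\<And>t t'. lab t = lab t' \<Longrightarrow> lab' t = lab' t'" "\<And>t. lab t = None \<Longrightarrow> lab' t = None"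
  shows "(class_ideal lab :: ('m \<Rightarrow>\<^sub>0 'k::field) set) \<subseteq> class_ideal lab'"
proof
  fix p :: "'m \<Rightarrow>\<^sub>0 'k" assume p: "p \<in> class_ideal lab"
  show "p \<in> class_ideal lab'"
  proof (rule mem_subspace_by_classes[of _ _ lab])
    fix t t' assume "lab t = lab t'"
    then show "Poly_Mapping.single t 1 - Poly_Mapping.single t' 1 \<in> class_ideal lab'"
      by (intro binomial_mem_class_ideal assms(1))
  next
    fix t
    show "class_sum lab p (lab t) = 0 \<or> Poly_Mapping.single t 1 \<in> class_ideal lab'"
      using class_ideal_class_sum[OF p, of t]
      by (auto intro!: single_mem_class_ideal intro: assms(2))
  qed (rule is_subspace_class_ideal)
qed

definition additive_labelling :: "('m::cancel_comm_monoid_add \<Rightarrow> 'c option) \<Rightarrow> bool" where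
  "additive_labelling lab \<longleftrightarrow> (\<forall>s t t'. lab t = lab t' \<longrightarrow> lab (s + t) = lab (s + t')) \<and>
     (\<forall>s t. lab t = None \<longrightarrow> lab (s + t) = None)"

lemma is_ideal_class_ideal:
  fixes lab :: "'m::cancel_comm_monoid_add \<Rightarrow> 'c option"
  assumes "additive_labelling lab"
  shows "is_ideal (class_ideal lab :: ('m \<Rightarrow>\<^sub>0 'k::field) set)"
proof -
  let ?I = "class_ideal lab :: ('m \<Rightarrow>\<^sub>0 'k) set"
  have single: "Poly_Mapping.single s a * p \<in> ?I" if p: "p \<in> ?I" for s a p
  proof -
    have "p \<in> {q. Poly_Mapping.single s a * q \<in> ?I}"
    proof (rule mem_subspace_by_classes[of _ _ lab])
      show "is_subspace {q. Poly_Mapping.single s a * q \<in> ?I}"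
        using is_subspace_class_ideal[of lab]
        by (auto simp: is_subspace_def distrib_left mult.left_commute[of "Poly_Mapping.single s a"])
      fix t t' assume "lab t = lab t'"
      then have "lab (s + t) = lab (s + t')" using assms unfolding additive_labelling_def by blast
      then show "Poly_Mapping.single t 1 - Poly_Mapping.single t' 1
          \<in> {q. Poly_Mapping.single s a * q \<in> ?I}"
        by (simp add: right_diff_distrib mult_single binomial_mem_class_ideal)
    next
      fix t
      show "class_sum lab p (lab t) = 0 \<or>
          Poly_Mapping.single t 1 \<in> {q. Poly_Mapping.single s a * q \<in> ?I}"
      proof (cases "lab t = None")
        case True
        then have "lab (s + t) = None" using assms unfolding additive_labelling_def by blast
        then show ?thesis by (simp add: mult_single single_mem_class_ideal)
      next
        case False
        then show ?thesis using class_ideal_class_sum[OF p, of t] by metis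
      qed
    qed
    then show ?thesis by simp
  qed
  show ?thesis unfolding is_ideal_def
  proof (intro conjI allI ballI)
    fix a p assume p: "p \<in> ?I"
    have "a * p = (\<Sum>t\<in>Poly_Mapping.keys a. Poly_Mapping.single t (Poly_Mapping.lookup a t) * p)"
      unfolding sum_distrib_right[symmetric] poly_eq_sum_single[of a, symmetric] ..
    then show "a * p \<in> ?I"
      using is_subspace_sum[OF is_subspace_class_ideal single[OF p]] by simp
  qed (use is_subspace_class_ideal[of lab] in \<open>auto simp: is_subspace_def\<close>)
qed

text \<open>
  Multiplication by the monomial \<open>s\<close> shifts the coefficients and takes distinct classes to
  distinct classes, so class sums are preserved.
\<close>

lemma regular_mod_class_ideal:
  fixes lab :: "'m::cancel_comm_monoid_add \<Rightarrow> 'c option"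
  assumes "\<And>t t'. lab (s + t) = lab (s + t') \<Longrightarrow> lab t = lab t'"
    and "\<And>t t'. lab t = lab t' \<Longrightarrow> lab (s + t) = lab (s + t')"
    and "\<And>t. lab t \<noteq> None \<Longrightarrow> lab (s + t) \<noteq> None"
  shows "regular_mod (class_ideal lab :: ('m \<Rightarrow>\<^sub>0 'k::field) set) (Poly_Mapping.single s 1)"
  unfolding regular_mod_def
proof (intro allI impI)
  fix u :: "'m \<Rightarrow>\<^sub>0 'k" assume u: "Poly_Mapping.single s 1 * u \<in> class_ideal lab"
  show "u \<in> class_ideal lab" unfolding class_ideal_def
  proof safe
    fix c
    show "class_sum lab u (Some c) = 0"
    proof (cases "\<exists>t0. lab t0 = Some c")
      case True
      then obtain t0 where t0: "lab t0 = Some c" by blast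
      then obtain d where d: "lab (s + t0) = Some d" using assms(3)[of t0] by auto
      have "lab (s + t) = Some d \<longleftrightarrow> lab t = Some c" for t
        using assms(1)[of t t0] assms(2)[of t t0] t0 d by metis
      then have "class_sum lab u (Some c) = class_sum (\<lambda>t. lab (s + t)) u (Some d)"
        by (simp add: class_sum_def)
      also have "\<dots> = class_sum lab (Poly_Mapping.single s 1 * u) (Some d)"
        by (simp add: class_sum_single_mult)
      finally show ?thesis using u by (simp add: class_ideal_def)
    next
      case False
      then show ?thesis by (simp add: class_sum_def)
    qed
  qed
qed

lemma ideal_sum_class_ideal:
  fixes lab :: "'m::cancel_comm_monoid_add \<Rightarrow> 'c option"
    and lab1 :: "'m \<Rightarrow> 'd option" and lab2 :: "'m \<Rightarrow> 'e option"
  assumes "additive_labelling lab" "additive_labelling lab1" "additive_labelling lab2"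
    and sub: "(class_ideal lab1 :: ('m \<Rightarrow>\<^sub>0 'k::field) set) \<subseteq> class_ideal lab"
      "(class_ideal lab2 :: ('m \<Rightarrow>\<^sub>0 'k) set) \<subseteq> class_ideal lab"
    and lab1: "\<And>t t'. lab t = lab t' \<Longrightarrow> lab t \<noteq> None \<Longrightarrow> lab1 t = lab1 t'"
    and None: "\<And>t. lab t = None \<Longrightarrow> lab1 t = None \<or> lab2 t = None"
  shows "ideal_sum (class_ideal lab1) (class_ideal lab2) = (class_ideal lab :: ('m \<Rightarrow>\<^sub>0 'k) set)"
proof
  let ?W = "ideal_sum (class_ideal lab1) (class_ideal lab2) :: ('m \<Rightarrow>\<^sub>0 'k) set"
  have I: "is_ideal (class_ideal lab :: ('m \<Rightarrow>\<^sub>0 'k) set)"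
    "is_ideal (class_ideal lab1 :: ('m \<Rightarrow>\<^sub>0 'k) set)"
    "is_ideal (class_ideal lab2 :: ('m \<Rightarrow>\<^sub>0 'k) set)"
    using assms(1-3) by (simp_all add: is_ideal_class_ideal)
  then have W: "is_ideal ?W" by (simp add: is_ideal_ideal_sum)
  have left: "class_ideal lab1 \<subseteq> ?W" and right: "class_ideal lab2 \<subseteq> ?W"
    using I by (simp_all add: ideal_sum_left ideal_sum_right)
  show "?W \<subseteq> class_ideal lab"
    using sub is_ideal_add[OF I(1)] unfolding ideal_sum_def by blast
  have killed: "Poly_Mapping.single t 1 \<in> ?W" if "lab t = None" for t
  proof (cases "lab1 t = None")
    case True
    then show ?thesis by (intro subsetD[OF left] single_mem_class_ideal)
  next
    case False
    then have "lab2 t = None" using None[OF that] by metis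
    then show ?thesis by (intro subsetD[OF right] single_mem_class_ideal)
  qed
  show "class_ideal lab \<subseteq> ?W"
  proof
    fix p :: "'m \<Rightarrow>\<^sub>0 'k" assume p: "p \<in> class_ideal lab"
    show "p \<in> ?W"
    proof (rule mem_subspace_by_classes[of _ _ lab])
      fix t t' assume eq: "lab t = lab t'"
      show "Poly_Mapping.single t 1 - Poly_Mapping.single t' 1 \<in> ?W"
      proof (cases "lab t = None")
        case True
        then show ?thesis using eq by (intro is_ideal_diff[OF W] killed) simp_all
      next
        case False
        then show ?thesis by (intro subsetD[OF left] binomial_mem_class_ideal lab1[OF eq])
      qed
    next
      fix t
      show "class_sum lab p (lab t) = 0 \<or> Poly_Mapping.single t 1 \<in> ?W"
        using class_ideal_class_sum[OF p, of t] by (auto intro: killed)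
    qed (rule is_ideal_is_subspace[OF W])
  qed
qed

section \<open>Row and column margins\<close>

definition degree_in :: "'x set \<Rightarrow> ('x \<Rightarrow>\<^sub>0 nat) \<Rightarrow> nat" where
  "degree_in Q t = (\<Sum>x\<in>Poly_Mapping.keys t \<inter> Q. Poly_Mapping.lookup t x)"

lemma degree_in_superset:
  assumes "finite A" "Poly_Mapping.keys t \<subseteq> A"
  shows "degree_in Q t = (\<Sum>x\<in>A \<inter> Q. Poly_Mapping.lookup t x)"
  unfolding degree_in_def using assms
  by (intro sum.mono_neutral_left) (auto simp: in_keys_iff)

lemma degree_in_add: "degree_in Q (s + t) = degree_in Q s + degree_in Q t"
proof -
  let ?A = "Poly_Mapping.keys s \<union> Poly_Mapping.keys t"
  have "degree_in Q (s + t) = (\<Sum>x\<in>?A \<inter> Q. Poly_Mapping.lookup (s + t) x)"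
    by (rule degree_in_superset) (auto simp: Poly_Mapping.keys_add)
  also have "\<dots> = degree_in Q s + degree_in Q t"
    by (subst (1 2) degree_in_superset[of ?A]) (auto simp: lookup_add sum.distrib)
  finally show ?thesis .
qed

lemma degree_in_single: "degree_in Q (Poly_Mapping.single x a) = (if x \<in> Q then a else 0)"
  by (subst degree_in_superset[of "{x}"]) auto

lemma degree_in_eq_0_iff: "degree_in Q t = 0 \<longleftrightarrow> Poly_Mapping.keys t \<inter> Q = {}"
  by (auto simp: degree_in_def in_keys_iff)

definition column :: "nat \<Rightarrow> (nat \<times> nat) set" where
  "column k = {x. snd x = k}"

definition block_row :: "(nat \<Rightarrow> 'b) \<Rightarrow> nat \<Rightarrow> 'b \<Rightarrow> (nat \<times> nat) set" where
  "block_row \<beta> i b = {x. fst x = i \<and> \<beta> (snd x) = b}"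

lemma mem_column [simp]: "(i, k) \<in> column l \<longleftrightarrow> k = l"
  by (simp add: column_def)

lemma mem_block_row [simp]: "(i, k) \<in> block_row \<beta> j b \<longleftrightarrow> i = j \<and> \<beta> k = b"
  by (simp add: block_row_def)

definition same_margins :: "(nat \<Rightarrow> 'b) \<Rightarrow> (nat \<times> nat \<Rightarrow>\<^sub>0 nat) \<Rightarrow> (nat \<times> nat \<Rightarrow>\<^sub>0 nat) \<Rightarrow> bool" where
  "same_margins \<beta> t t' \<longleftrightarrow> (\<forall>k. degree_in (column k) t = degree_in (column k) t') \<and>
     (\<forall>i b. degree_in (block_row \<beta> i b) t = degree_in (block_row \<beta> i b) t')"

text \<open>
  Columns with the same value of \<open>\<beta>\<close> form a block. Among the monomials supported
  in \<open>F\<close>, those with equal labels have the same image under the Segre maps of the blocks, which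
  send the variable at \<open>(i, k)\<close> to a product of a variable for \<open>i\<close> and \<open>\<beta> k\<close> and one for \<open>k\<close>.
\<close>

definition margin_label ::
    "(nat \<Rightarrow> 'b) \<Rightarrow> (nat \<times> nat) set \<Rightarrow> (nat \<times> nat \<Rightarrow>\<^sub>0 nat)
      \<Rightarrow> ((nat \<Rightarrow> nat) \<times> (nat \<Rightarrow> 'b \<Rightarrow> nat)) option" where
  "margin_label \<beta> F t = (if Poly_Mapping.keys t \<subseteq> F
     then Some (\<lambda>k. degree_in (column k) t, \<lambda>i b. degree_in (block_row \<beta> i b) t) else None)"

lemma margin_label_eq_None_iff: "margin_label \<beta> F t = None \<longleftrightarrow> \<not> Poly_Mapping.keys t \<subseteq> F"
  by (simp add: margin_label_def)

lemma margin_label_eq_iff: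
  "margin_label \<beta> F t = margin_label \<beta> F t' \<longleftrightarrow>
     (if Poly_Mapping.keys t \<subseteq> F then Poly_Mapping.keys t' \<subseteq> F \<and> same_margins \<beta> t t'
      else \<not> Poly_Mapping.keys t' \<subseteq> F)"
  by (auto simp: margin_label_def same_margins_def fun_eq_iff)

lemma same_margins_add_left: "same_margins \<beta> (s + t) (s + t') \<longleftrightarrow> same_margins \<beta> t t'"
  by (simp add: same_margins_def degree_in_add)

lemma same_margins_swap:
  assumes "\<beta> k = \<beta> l"
  shows "same_margins \<beta> (Poly_Mapping.single (i, k) 1 + (Poly_Mapping.single (j, l) 1 + u))
    (Poly_Mapping.single (i, l) 1 + (Poly_Mapping.single (j, k) 1 + u))"
  using assms by (auto simp: same_margins_def degree_in_add degree_in_single)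

lemma additive_margin_label: "additive_labelling (margin_label \<beta> F)"
  by (auto simp: additive_labelling_def margin_label_eq_iff margin_label_eq_None_iff
      keys_plus_nat same_margins_add_left split: if_splits)

text \<open>
  If \<open>F\<close> is a union of rectangles, one in each block, then this is the ideal generated by the
  variables outside \<open>F\<close> and the 2-minors of the rectangles.
\<close>

definition margin_ideal :: "(nat \<Rightarrow> 'b) \<Rightarrow> (nat \<times> nat) set \<Rightarrow> (nat \<times> nat, 'k::field) mpoly set" where
  "margin_ideal \<beta> F = class_ideal (margin_label \<beta> F)"

lemma is_ideal_margin_ideal: "is_ideal (margin_ideal \<beta> F)"
  by (simp add: margin_ideal_def is_ideal_class_ideal additive_margin_label)

lemma single_mem_margin_ideal:
  "\<not> Poly_Mapping.keys t \<subseteq> F \<Longrightarrow> Poly_Mapping.single t a \<in> margin_ideal \<beta> F"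
  by (simp add: margin_ideal_def single_mem_class_ideal margin_label_eq_None_iff)

lemma mvar_mem_margin_ideal: "x \<notin> F \<Longrightarrow> mvar x \<in> margin_ideal \<beta> F"
  unfolding mvar_def by (intro single_mem_margin_ideal) auto

lemma binomial_mem_margin_ideal:
  "Poly_Mapping.keys t \<subseteq> F \<Longrightarrow> Poly_Mapping.keys t' \<subseteq> F \<Longrightarrow> same_margins \<beta> t t' \<Longrightarrow>
    Poly_Mapping.single t a - Poly_Mapping.single t' a \<in> margin_ideal \<beta> F"
  unfolding margin_ideal_def by (intro binomial_mem_class_ideal) (simp add: margin_label_eq_iff)

lemma margin_ideal_class_sum:
  "p \<in> margin_ideal \<beta> F \<Longrightarrow> Poly_Mapping.keys t \<subseteq> F \<Longrightarrow>
    class_sum (margin_label \<beta> F) p (margin_label \<beta> F t) = 0"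
  unfolding margin_ideal_def using class_ideal_class_sum margin_label_eq_None_iff by metis

lemma regular_mod_margin_ideal:
  assumes "x \<in> F"
  shows "regular_mod (margin_ideal \<beta> F) (mvar x)"
  unfolding margin_ideal_def mvar_def using assms
  by (intro regular_mod_class_ideal)
    (auto simp: margin_label_eq_iff margin_label_eq_None_iff keys_plus_nat same_margins_add_left
      split: if_splits)

text \<open>
  Whether a monomial avoids such a set can be seen from its label. This is why removing the set from
  \<open>F\<close> is compatible with the labels.
\<close>

definition is_margin :: "(nat \<Rightarrow> 'b) \<Rightarrow> (nat \<times> nat) set \<Rightarrow> bool" where
  "is_margin \<beta> Q \<longleftrightarrow> (\<exists>k. Q = column k) \<or> (\<exists>i b. Q = block_row \<beta> i b)"

lemma is_margin_column: "is_margin \<beta> (column k)"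
  and is_margin_block_row: "is_margin \<beta> (block_row \<beta> i b)"
  by (auto simp: is_margin_def)

lemma same_margins_degree_in:
  "same_margins \<beta> t t' \<Longrightarrow> is_margin \<beta> Q \<Longrightarrow> degree_in Q t = degree_in Q t'"
  by (auto simp: is_margin_def same_margins_def)

lemma same_margins_keys_disjoint:
  "same_margins \<beta> t t' \<Longrightarrow> is_margin \<beta> Q \<Longrightarrow>
    Poly_Mapping.keys t \<inter> Q = {} \<longleftrightarrow> Poly_Mapping.keys t' \<inter> Q = {}"
  using same_margins_degree_in degree_in_eq_0_iff by metis

lemma keys_subset_Diff: "Poly_Mapping.keys t \<subseteq> F - Q \<longleftrightarrow>
    Poly_Mapping.keys t \<subseteq> F \<and> Poly_Mapping.keys t \<inter> Q = {}"
  by blast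

lemma margin_label_Diff:
  assumes "is_margin \<beta> Q" "margin_label \<beta> F t = margin_label \<beta> F t'"
  shows "margin_label \<beta> (F - Q) t = margin_label \<beta> (F - Q) t'"
  using assms(2) same_margins_keys_disjoint[of \<beta> t t' Q] assms(1)
  by (simp add: margin_label_eq_iff keys_subset_Diff split: if_splits)

lemma margin_ideal_Diff_mono:
  assumes "is_margin \<beta> Q"
  shows "margin_ideal \<beta> F \<subseteq> margin_ideal \<beta> (F - Q)"
  unfolding margin_ideal_def
proof (rule class_ideal_subset)
  fix t t' assume "margin_label \<beta> F t = margin_label \<beta> F t'"
  then show "margin_label \<beta> (F - Q) t = margin_label \<beta> (F - Q) t'"
    by (rule margin_label_Diff[OF assms])
qed (auto simp: margin_label_eq_None_iff)

lemma class_sum_margin_Diff: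
  assumes Q: "is_margin \<beta> Q" and p: "p \<in> margin_ideal \<beta> (F - Q)"
    and t: "Poly_Mapping.keys t \<subseteq> F - Q"
  shows "class_sum (margin_label \<beta> F) p (margin_label \<beta> F t) = 0"
proof -
  have "margin_label \<beta> F s = margin_label \<beta> F t \<longleftrightarrow>
      margin_label \<beta> (F - Q) s = margin_label \<beta> (F - Q) t" for s
    using t margin_label_Diff[OF Q, of F s t] by (auto simp: margin_label_eq_iff split: if_splits)
  then have "class_sum (margin_label \<beta> F) p (margin_label \<beta> F t)
      = class_sum (margin_label \<beta> (F - Q)) p (margin_label \<beta> (F - Q) t)"
    by (simp add: class_sum_def)
  then show ?thesis using margin_ideal_class_sum[OF p t] by simp
qed

text \<open>
  A monomial supported in \<open>F\<close> but not in \<open>F - Q - Q'\<close> meets \<open>Q\<close> or \<open>Q'\<close> and is killed by one of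
  the two ideals on the left.
\<close>

lemma ideal_sum_margin_ideal:
  assumes Q: "is_margin \<beta> Q" and Q': "is_margin \<beta> Q'"
  shows "ideal_sum (margin_ideal \<beta> (F - Q)) (margin_ideal \<beta> (F - Q')) = margin_ideal \<beta> (F - Q - Q')"
  unfolding margin_ideal_def
proof (rule ideal_sum_class_ideal)
  show "class_ideal (margin_label \<beta> (F - Q)) \<subseteq> class_ideal (margin_label \<beta> (F - Q - Q'))"
    using margin_ideal_Diff_mono[OF Q', of "F - Q"] by (simp add: margin_ideal_def)
  show "class_ideal (margin_label \<beta> (F - Q')) \<subseteq> class_ideal (margin_label \<beta> (F - Q - Q'))"
  proof -
    have "F - Q' - Q = F - Q - Q'" by blast
    then show ?thesis using margin_ideal_Diff_mono[OF Q, of "F - Q'"] by (simp add: margin_ideal_def)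
  qed
qed (auto simp: additive_margin_label margin_label_eq_iff margin_label_eq_None_iff split: if_splits)

text \<open>
  A union of rectangles, one for each block.
\<close>

definition cells :: "(nat \<Rightarrow> 'b) \<Rightarrow> ('b \<Rightarrow> nat set) \<Rightarrow> nat set \<Rightarrow> (nat \<times> nat) set" where
  "cells \<beta> R V = {(i, k). k \<in> V \<and> i \<in> R (\<beta> k)}"

lemma adjoin_subset:
  assumes "is_ideal I" "z \<in> I" "L \<subseteq> I"
  shows "adjoin L z \<subseteq> I"
proof
  fix u assume "u \<in> adjoin L z"
  then obtain a v where "u = a + z * v" "a \<in> L" unfolding adjoin_def by blast
  then show "u \<in> I"
    using assms is_ideal_mult[OF assms(1,2), of v] is_ideal_add[OF assms(1)]
    by (auto simp: mult.commute)
qed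

text \<open>
  In the class of a monomial that meets both row \<open>i\<close> of the block and column \<open>k\<close> there is one
  that is divisible by the variable at \<open>(i, k)\<close>: exchange an entry at \<open>(i, l)\<close> and an entry at
  \<open>(j, k)\<close> for entries at \<open>(i, k)\<close> and \<open>(j, l)\<close>. In all other classes the class sum vanishes for
  members of the right hand side.
\<close>

lemma adjoin_margin_ideal:
  assumes x: "(i, k) \<in> cells \<beta> R V"
  defines "F \<equiv> cells \<beta> R V"
  shows "adjoin (margin_ideal \<beta> F) (mvar (i, k))
    = (margin_ideal \<beta> (F - block_row \<beta> i (\<beta> k)) \<inter> margin_ideal \<beta> (F - column k)
       :: (nat \<times> nat, 'k::field) mpoly set)"
    (is "?W = ?I1 \<inter> ?I2")
proof
  let ?Q1 = "block_row \<beta> i (\<beta> k)" and ?Q2 = "column k"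
  have W: "is_ideal ?W" by (simp add: is_ideal_adjoin is_ideal_margin_ideal)
  have F_W: "margin_ideal \<beta> F \<subseteq> ?W" by (rule adjoin_superset)
  have I: "is_ideal (?I1 \<inter> ?I2)" by (simp add: is_ideal_Int is_ideal_margin_ideal)
  have "mvar (i, k) \<in> ?I1 \<inter> ?I2"
    by (auto intro!: mvar_mem_margin_ideal)
  moreover have "margin_ideal \<beta> F \<subseteq> ?I1 \<inter> ?I2"
    by (simp add: margin_ideal_Diff_mono is_margin_column is_margin_block_row)
  ultimately show "?W \<subseteq> ?I1 \<inter> ?I2" by (rule adjoin_subset[OF I])
  have x_W: "Poly_Mapping.single (Poly_Mapping.single (i, k) 1 + u) 1 \<in> ?W" for u
    using mult_in_adjoin[OF is_ideal_margin_ideal, of "mvar (i, k)" "Poly_Mapping.single u 1"]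
    by (simp add: mvar_def mult_single)
  show "?I1 \<inter> ?I2 \<subseteq> ?W"
  proof
    fix p assume p: "p \<in> ?I1 \<inter> ?I2"
    show "p \<in> ?W"
    proof (rule mem_subspace_by_classes[of _ _ "margin_label \<beta> F"])
      show "is_subspace ?W" using W by (rule is_ideal_is_subspace)
    next
      fix t t' assume "margin_label \<beta> F t = margin_label \<beta> F t'"
      then have "Poly_Mapping.single t 1 - Poly_Mapping.single t' 1 \<in> margin_ideal \<beta> F"
        unfolding margin_ideal_def by (rule binomial_mem_class_ideal)
      then show "Poly_Mapping.single t 1 - Poly_Mapping.single t' 1 \<in> ?W" by (rule subsetD[OF F_W])
    next
      fix t
      show "class_sum (margin_label \<beta> F) p (margin_label \<beta> F t) = 0 \<or> Poly_Mapping.single t 1 \<in> ?W"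
      proof (cases "Poly_Mapping.keys t \<subseteq> F - ?Q1 \<or> Poly_Mapping.keys t \<subseteq> F - ?Q2
          \<or> \<not> Poly_Mapping.keys t \<subseteq> F")
        case True
        then show ?thesis
          using class_sum_margin_Diff[OF is_margin_block_row, of p \<beta> F i "\<beta> k" t]
            class_sum_margin_Diff[OF is_margin_column, of p \<beta> F k t] p
            subsetD[OF F_W single_mem_margin_ideal[of t F 1 \<beta>]] by auto
      next
        case False
        then obtain l j where l: "(i, l) \<in> Poly_Mapping.keys t" "\<beta> l = \<beta> k"
          and j: "(j, k) \<in> Poly_Mapping.keys t" and t: "Poly_Mapping.keys t \<subseteq> F"
          by (force simp: block_row_def column_def)
        from split_off_variable[OF j] obtain u where u: "t = Poly_Mapping.single (j, k) 1 + u"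
          by metis
        show ?thesis
        proof (cases "j = i")
          case True
          then show ?thesis using x_W u by simp
        next
          case False
          then have "(i, l) \<in> Poly_Mapping.keys u" using l u by (auto simp: keys_plus_nat)
          from split_off_variable[OF this] obtain v where v: "u = Poly_Mapping.single (i, l) 1 + v"
            by metis
          let ?t = "Poly_Mapping.single (i, k) 1 + (Poly_Mapping.single (j, l) 1 + v)"
          have m: "same_margins \<beta> t ?t"
            using same_margins_swap[of \<beta> k l j i v] l(2)
            by (auto simp: u v same_margins_def degree_in_add)
          have "Poly_Mapping.keys ?t \<subseteq> F"
            using t x l(2) unfolding u v F_def by (auto simp: keys_plus_nat cells_def)
          then have "Poly_Mapping.single t 1 - Poly_Mapping.single ?t 1 \<in> ?W"
            by (intro subsetD[OF F_W] binomial_mem_margin_ideal t m)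
          then show ?thesis using x_W is_ideal_mem_iff[OF W] by simp
        qed
      qed
    qed
  qed
qed

section \<open>Depth of the margin ideals\<close>

text \<open>
  Every block contributes its number of columns plus its number of rows minus one, which is the
  dimension of the cone over a product of two projective spaces.
\<close>

definition segre_dim :: "(nat \<Rightarrow> 'b) \<Rightarrow> ('b \<Rightarrow> nat set) \<Rightarrow> nat set \<Rightarrow> nat" where
  "segre_dim \<beta> R V = card V + (\<Sum>b\<in>\<beta> ` V. card (R b) - 1)"

lemma cells_Diff_block_row: "cells \<beta> R V - block_row \<beta> i b = cells \<beta> (R(b := R b - {i})) V"
  by (auto simp: cells_def)

lemma cells_Diff_column: "cells \<beta> R V - column k = cells \<beta> R (V - {k})"
  by (auto simp: cells_def)

lemma segre_dim_remove_row:
  assumes "finite V" "k \<in> V" "finite (R (\<beta> k))" "i \<in> R (\<beta> k)" "R (\<beta> k) \<noteq> {i}"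
  shows "segre_dim \<beta> R V = Suc (segre_dim \<beta> (R(\<beta> k := R (\<beta> k) - {i})) V)"
proof -
  have "R (\<beta> k) - {i} \<noteq> {}" using assms(4,5) by blast
  then have "card (R (\<beta> k) - {i}) \<noteq> 0"
    by (metis assms(3) card_0_eq finite_Diff)
  moreover have "card (R (\<beta> k)) = Suc (card (R (\<beta> k) - {i}))"
    by (rule card.remove[OF assms(3,4)])
  ultimately show ?thesis
    using assms(1,2)
      sum.remove[of "\<beta> ` V" "\<beta> k" "\<lambda>b. card (R b) - 1"]
      sum.remove[of "\<beta> ` V" "\<beta> k" "\<lambda>b. card ((R(\<beta> k := R (\<beta> k) - {i})) b) - 1"]
    by (simp add: segre_dim_def)
qed

lemma segre_dim_remove_column:
  assumes "finite V" "k \<in> V" "\<beta> k \<in> \<beta> ` (V - {k}) \<or> card (R (\<beta> k)) = 1"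
  shows "segre_dim \<beta> R V = Suc (segre_dim \<beta> R (V - {k}))"
proof -
  have "(\<Sum>b\<in>\<beta> ` V. card (R b) - 1) = (\<Sum>b\<in>\<beta> ` (V - {k}). card (R b) - 1)"
    by (rule sum.mono_neutral_right) (use assms in auto)
  moreover have "card V = Suc (card (V - {k}))" using assms by (intro card.remove)
  ultimately show ?thesis by (simp add: segre_dim_def)
qed

lemma one_notin_margin_ideal: "(1 :: (nat \<times> nat, 'k::field) mpoly) \<notin> margin_ideal \<beta> F"
proof -
  have "class_sum (margin_label \<beta> F) (1 :: (nat \<times> nat, 'k::field) mpoly) (margin_label \<beta> F 0) = 1"
    using class_sum_single[of "margin_label \<beta> F" 0 "1::'k" "margin_label \<beta> F 0"] by simp
  then show ?thesis
    using margin_ideal_class_sum[of "1 :: (nat \<times> nat, 'k) mpoly" \<beta> F 0] by auto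
qed

lemma koszul_depth_margin_ideal_empty:
  assumes "set xs \<subseteq> range mvar"
  shows "koszul_depth xs (margin_ideal \<beta> {} :: (nat \<times> nat, 'k::field) mpoly set) 0"
proof -
  have "x * 1 \<in> (margin_ideal \<beta> {} :: (nat \<times> nat, 'k) mpoly set)" if "x \<in> set xs" for x
  proof -
    obtain y where "x = mvar y" using \<open>x \<in> set xs\<close> assms by blast
    then show ?thesis by (simp add: mvar_mem_margin_ideal)
  qed
  then show ?thesis
    by (auto simp: koszul_depth_def koszul_vanish_0_iff is_ideal_margin_ideal
        one_notin_margin_ideal intro!: exI[of _ 1])
qed

text \<open>
  The variable at \<open>(i, k)\<close> is regular, and killing it leads to the intersection of the ideals with
  row \<open>i\<close> removed from the block and with column \<open>k\<close> removed. If the block has a single row or a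
  single column, one of these ideals contains the other. Otherwise both have depth one less than
  the given one, their sum has depth two less, and the exact sequence of the intersection applies.
\<close>

lemma koszul_depth_margin_ideal:
  fixes xs :: "(nat \<times> nat, 'k::field) mpoly list"
  assumes "finite V" "\<And>k. k \<in> V \<Longrightarrow> finite (R (\<beta> k)) \<and> R (\<beta> k) \<noteq> {}"
    and xs: "set xs = mvar ` X" and "cells \<beta> R V \<subseteq> X"
  shows "koszul_depth xs (margin_ideal \<beta> (cells \<beta> R V)) (segre_dim \<beta> R V)"
  using assms(1,2,4)
proof (induction "segre_dim \<beta> R V" arbitrary: R V rule: less_induct)
  case less
  show ?case
  proof (cases "V = {}")
    case True
    then show ?thesis
      using koszul_depth_margin_ideal_empty[of xs \<beta>] xs by (auto simp: segre_dim_def cells_def)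
  next
    case False
    then obtain k where k: "k \<in> V" by blast
    then obtain i where i: "i \<in> R (\<beta> k)" using less.prems(2) by blast
    let ?F = "cells \<beta> R V" and ?b = "\<beta> k"
    let ?R = "R(?b := R ?b - {i})" and ?V = "V - {k}"
    let ?I = "\<lambda>F. margin_ideal \<beta> F :: (nat \<times> nat, 'k) mpoly set"
    have ik: "(i, k) \<in> ?F" using i k by (simp add: cells_def)
    have rows: "?F - block_row \<beta> i ?b = cells \<beta> ?R V" by (rule cells_Diff_block_row)
    have cols: "?F - column k = cells \<beta> R ?V" by (rule cells_Diff_column)
    have fin: "finite ?V" using less.prems(1) by simp
    have W: "adjoin (?I ?F) (mvar (i, k)) = ?I (cells \<beta> ?R V) \<inter> ?I (cells \<beta> R ?V)"
      using adjoin_margin_ideal[OF ik] by (simp add: rows cols)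
    have step: "koszul_depth xs (?I ?F) (Suc d)"
      if "koszul_depth xs (?I (cells \<beta> ?R V) \<inter> ?I (cells \<beta> R ?V)) d" for d
    proof (rule koszul_depth_Suc[of _ "mvar (i, k)"])
      show "mvar (i, k) \<in> is_ideal hull (set xs)"
        using ik less.prems(3) xs by (intro hull_inc) auto
    qed (use that ik in \<open>simp_all add: is_ideal_margin_ideal regular_mod_margin_ideal W\<close>)
    have sub: "cells \<beta> ?R V \<subseteq> X" "cells \<beta> R ?V \<subseteq> X" "cells \<beta> ?R ?V \<subseteq> X"
      using less.prems(3) by (auto simp: cells_def split: if_splits)
    show ?thesis
    proof (cases "R ?b = {i}")
      case True
      have d: "segre_dim \<beta> R V = Suc (segre_dim \<beta> R ?V)"
        using True less.prems(1) k by (intro segre_dim_remove_column) auto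
      have "cells \<beta> ?R V = cells \<beta> R ?V - block_row \<beta> i ?b"
        using True by (auto simp: cells_def)
      then have "?I (cells \<beta> R ?V) \<subseteq> ?I (cells \<beta> ?R V)"
        using margin_ideal_Diff_mono[OF is_margin_block_row] by simp
      moreover have "koszul_depth xs (?I (cells \<beta> R ?V)) (segre_dim \<beta> R ?V)"
        using less.prems(2) d fin sub by (intro less.hyps) auto
      ultimately show ?thesis using step[of "segre_dim \<beta> R ?V"] d by (simp add: Int_absorb1)
    next
      case False
      have d: "segre_dim \<beta> R V = Suc (segre_dim \<beta> ?R V)"
        using False less.prems k i by (intro segre_dim_remove_row) auto
      have R: "finite (?R (\<beta> l)) \<and> ?R (\<beta> l) \<noteq> {}" if "l \<in> V" for l
        using less.prems(2)[OF that] False i by auto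
      have 1: "koszul_depth xs (?I (cells \<beta> ?R V)) (segre_dim \<beta> ?R V)"
        using d less.prems(1) sub R by (intro less.hyps) auto
      show ?thesis
      proof (cases "?b \<in> \<beta> ` ?V")
        case True
        have d2: "segre_dim \<beta> R V = Suc (segre_dim \<beta> R ?V)"
          using True less.prems(1) k by (intro segre_dim_remove_column) auto
        have d12: "segre_dim \<beta> ?R V = Suc (segre_dim \<beta> ?R ?V)"
          using True less.prems(1) k by (intro segre_dim_remove_column) auto
        have 2: "koszul_depth xs (?I (cells \<beta> R ?V)) (segre_dim \<beta> R ?V)"
          using d2 less.prems(2) fin sub by (intro less.hyps) auto
        have "koszul_depth xs (?I (cells \<beta> ?R ?V)) (segre_dim \<beta> ?R ?V)"
          using d d12 fin sub R by (intro less.hyps) auto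
        moreover have "?F - block_row \<beta> i ?b - column k = cells \<beta> ?R ?V"
          by (simp add: rows cells_Diff_column)
        moreover have "ideal_sum (?I (?F - block_row \<beta> i ?b)) (?I (?F - column k))
            = ?I (?F - block_row \<beta> i ?b - column k)"
          by (intro ideal_sum_margin_ideal is_margin_block_row is_margin_column)
        ultimately have 12: "koszul_depth xs
            (ideal_sum (?I (cells \<beta> ?R V)) (?I (cells \<beta> R ?V))) (segre_dim \<beta> ?R ?V)"
          by (simp only: rows cols)
        have "koszul_depth xs (?I (cells \<beta> ?R V) \<inter> ?I (cells \<beta> R ?V)) (Suc (segre_dim \<beta> ?R ?V))"
          by (rule koszul_depth_Int[OF is_ideal_margin_ideal is_ideal_margin_ideal _ _ 12])
            (use 1 2 d d2 d12 in \<open>auto simp: koszul_depth_def\<close>)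
        then show ?thesis using step d d12 by simp
      next
        case b: False
        have "cells \<beta> R ?V = cells \<beta> ?R V - column k"
          using b by (auto simp: cells_def image_iff) (metis DiffI singletonD)
        then have "?I (cells \<beta> ?R V) \<subseteq> ?I (cells \<beta> R ?V)"
          using margin_ideal_Diff_mono[OF is_margin_column] by simp
        then show ?thesis using step[of "segre_dim \<beta> ?R V"] 1 d by (simp add: Int_absorb2)
      qed
    qed
  qed
qed

section \<open>Noetherianity of polynomial rings over a field\<close>

lemma nat_seq_has_incseq:
  fixes s :: "nat \<Rightarrow> nat"
  obtains g :: "nat \<Rightarrow> nat" where "strict_mono g" "incseq (\<lambda>n. s (g n))"
proof -
  obtain f :: "nat \<Rightarrow> nat" where f: "strict_mono f" "monoseq (\<lambda>n. s (f n))"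
    using seq_monosub by blast
  show ?thesis
  proof (cases "incseq (\<lambda>n. s (f n))")
    case True
    then show ?thesis using f that by blast
  next
    case False
    then have dec: "decseq (\<lambda>n. s (f n))" using f(2) by (simp add: monoseq_iff)
    obtain N where N: "\<And>n. s (f N) \<le> s (f n)"
      using ex_has_least_nat[of "\<lambda>_. True" 0 "\<lambda>n. s (f n)"] by blast
    have "s (f (N + n)) = s (f N)" for n
      using N[of "N + n"] decseqD[OF dec, of N "N + n"] by simp
    then have "incseq (\<lambda>n. s (f (N + n)))" by (simp add: incseq_def)
    moreover have "strict_mono (\<lambda>n. f (N + n))"
      using f(1) by (simp add: strict_mono_def)
    ultimately show ?thesis using that by blast
  qed
qed

text \<open>
  Dickson's lemma: passing to a subsequence for each variable in turn makes all exponents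
  nondecreasing.
\<close>

lemma dickson:
  fixes t :: "nat \<Rightarrow> 'x \<Rightarrow>\<^sub>0 nat"
  assumes "finite X" "\<And>n. Poly_Mapping.keys (t n) \<subseteq> X"
  obtains i j u where "i < j" "t j = t i + u"
proof -
  have "\<exists>r :: nat \<Rightarrow> nat. strict_mono r \<and> (\<forall>x\<in>X. incseq (\<lambda>n. Poly_Mapping.lookup (t (r n)) x))"
    using assms(1)
  proof (induction X rule: finite_induct)
    case empty
    show ?case by (intro exI[of _ id]) (auto simp: strict_mono_def)
  next
    case (insert x X)
    then obtain r :: "nat \<Rightarrow> nat" where r: "strict_mono r"
      "\<And>x. x \<in> X \<Longrightarrow> incseq (\<lambda>n. Poly_Mapping.lookup (t (r n)) x)" by blast
    obtain g :: "nat \<Rightarrow> nat" where g: "strict_mono g"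
      "incseq (\<lambda>n. Poly_Mapping.lookup (t (r (g n))) x)"
      using nat_seq_has_incseq[of "\<lambda>n. Poly_Mapping.lookup (t (r n)) x"] by metis
    have "incseq (\<lambda>n. Poly_Mapping.lookup (t (r (g n))) y)" if "y \<in> X" for y
      using r(2)[OF that] g(1) by (auto simp: incseq_def strict_mono_less_eq)
    then show ?case using r(1) g
      by (intro exI[of _ "r \<circ> g"]) (auto simp: strict_mono_def)
  qed
  then obtain r :: "nat \<Rightarrow> nat" where r: "strict_mono r"
    "\<And>x. x \<in> X \<Longrightarrow> incseq (\<lambda>n. Poly_Mapping.lookup (t (r n)) x)" by blast
  have le: "Poly_Mapping.lookup (t (r 0)) x \<le> Poly_Mapping.lookup (t (r 1)) x" for x
  proof (cases "x \<in> X")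
    case True
    then show ?thesis using r(2)[OF True] by (simp add: incseq_def)
  next
    case False
    then have "x \<notin> Poly_Mapping.keys (t (r 0))" using assms(2) by blast
    then show ?thesis by (simp add: in_keys_iff)
  qed
  have "r 0 < r 1" using r(1) by (simp add: strict_mono_def)
  moreover have "t (r 1) = t (r 0) + (t (r 1) - t (r 0))"
    by (rule poly_mapping_eqI) (simp add: lookup_add lookup_minus le[unfolded One_nat_def])
  ultimately show ?thesis by (rule that)
qed

lemma zero_le_monomial: "0 \<le> (u :: 'x::linorder \<Rightarrow>\<^sub>0 nat)"
proof (cases "u = 0")
  case False
  then have ne: "Poly_Mapping.keys u \<noteq> {}" by simp
  define k where "k = Min (Poly_Mapping.keys u)"
  have "k \<in> Poly_Mapping.keys u" "\<And>l. l < k \<Longrightarrow> l \<notin> Poly_Mapping.keys u"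
    unfolding k_def using ne Min_le[of "Poly_Mapping.keys u"] by (auto simp: not_less[symmetric])
  then have "less_fun (Poly_Mapping.lookup 0) (Poly_Mapping.lookup u)"
    unfolding less_fun_def by (intro exI[of _ k]) (auto simp: in_keys_iff)
  then have "0 < u" by (simp add: less_poly_mapping.rep_eq)
  then show ?thesis by simp
qed simp

text \<open>
  In an infinite descending chain Dickson's lemma would find a later member that is a multiple of
  an earlier one, hence not smaller.
\<close>

lemma wf_monomials:
  assumes "finite X"
  shows "wf {(s, t :: 'x::linorder \<Rightarrow>\<^sub>0 nat). Poly_Mapping.keys s \<subseteq> X \<and> Poly_Mapping.keys t \<subseteq> X \<and> s < t}"
    (is "wf ?r")
  unfolding wf_iff_no_infinite_down_chain
proof
  assume "\<exists>f. \<forall>i. (f (Suc i), f i) \<in> ?r"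
  then obtain f where "\<forall>i. (f (Suc i), f i) \<in> ?r" by blast
  then have f: "Poly_Mapping.keys (f i) \<subseteq> X" "f (Suc i) < f i" for i by auto
  obtain i j u where iju: "i < j" "f j = f i + u" using dickson[of X f, OF assms f(1)] by blast
  have "f j < f i" using iju(1) f(2) by (induction rule: less_Suc_induct) auto
  moreover have "f i \<le> f j" using add_left_mono[OF zero_le_monomial[of u], of "f i"] iju(2) by simp
  ultimately show False by simp
qed

text \<open>
  A monomial with a variable outside \<open>X\<close> lies in \<open>W\<close>, so it may be dropped.
\<close>

lemma mod_outside_variables:
  fixes p :: "('x, 'k::field) mpoly"
  assumes W: "is_ideal W" and out: "\<And>x. x \<notin> X \<Longrightarrow> mvar x \<in> W"
  obtains q where "q \<in> carrier (mpoly_ring X)" "p - q \<in> W"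
proof
  let ?x = "\<lambda>t. Poly_Mapping.single t (Poly_Mapping.lookup p t)"
  let ?T = "{t \<in> Poly_Mapping.keys p. Poly_Mapping.keys t \<subseteq> X}"
  let ?q = "\<Sum>t\<in>?T. ?x t"
  show "?q \<in> carrier (mpoly_ring X)"
    using keys_sum[of ?x ?T] by (fastforce simp: mpoly_ring_carrier split: if_splits)
  have "p = (\<Sum>t\<in>Poly_Mapping.keys p - ?T. ?x t) + ?q"
    using sum.subset_diff[of ?T "Poly_Mapping.keys p" ?x] poly_eq_sum_single[of p] by simp
  then have "p - ?q = (\<Sum>t\<in>Poly_Mapping.keys p - ?T. ?x t)"
    by (simp only: diff_eq_eq)
  moreover have "(\<Sum>t\<in>Poly_Mapping.keys p - ?T. ?x t) \<in> W"
  proof (rule is_ideal_sum[OF W])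
    fix t assume "t \<in> Poly_Mapping.keys p - ?T"
    then obtain x where x: "x \<in> Poly_Mapping.keys t" "x \<notin> X" by auto
    from split_off_variable[OF x(1)] obtain u where u: "t = Poly_Mapping.single x 1 + u" by metis
    have "?x t = Poly_Mapping.single u (Poly_Mapping.lookup p t) * mvar x"
      by (simp add: u mvar_def mult_single add.commute)
    then show "?x t \<in> W" using is_ideal_mult[OF W out[OF x(2)]] by simp
  qed
  ultimately show "p - ?q \<in> W" by (simp only:)
qed

text \<open>
  In a strictly ascending chain choose in each step a new polynomial over \<open>X\<close> with the smallest
  possible leading monomial. By Dickson's lemma the leading monomial of some later choice is
  divisible by that of an earlier one; subtracting a multiple of the earlier polynomial lowers it,
  against the choice.
\<close>

lemma noetherian_above_variables:
  fixes L0 :: "('x::linorder, 'k::field) mpoly set"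
  assumes X: "finite X" and out: "\<And>x. x \<notin> X \<Longrightarrow> mvar x \<in> L0"
  shows "noetherian_above L0"
  unfolding noetherian_above_def
proof (intro allI impI)
  fix \<C> :: "('x, 'k) mpoly set set"
  assume ne: "\<C> \<noteq> {}" and \<C>: "\<forall>L\<in>\<C>. is_ideal L \<and> L0 \<subseteq> L"
  show "\<exists>M\<in>\<C>. \<forall>L\<in>\<C>. M \<subseteq> L \<longrightarrow> L = M"
  proof (rule ccontr)
    assume "\<not> ?thesis"
    then have up: "\<And>M. M \<in> \<C> \<Longrightarrow> \<exists>L\<in>\<C>. M \<subset> L" by blast
    have "\<exists>L. \<forall>n. L n \<in> \<C> \<and> L n \<subset> L (Suc n)"
      by (rule dependent_nat_choice) (use ne up in auto)
    then obtain L where L: "\<And>n. L n \<in> \<C>" "\<And>n. L n \<subset> L (Suc n)" by blast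
    have ideal: "is_ideal (L n)" and out_L: "\<And>x. x \<notin> X \<Longrightarrow> mvar x \<in> L n" for n
      using L(1)[of n] \<C> out by auto
    have mono: "L i \<subseteq> L j" if "i \<le> j" for i j
      using L(2) lift_Suc_mono_le[of L i j] that by blast
    define D where "D n = {f \<in> carrier (mpoly_ring X). f \<in> L (Suc n) \<and> f \<notin> L n}" for n
    define lm where "lm f = Max (Poly_Mapping.keys f)" for f :: "('x, 'k) mpoly"
    have D_ne: "D n \<noteq> {}" for n
    proof -
      obtain f where f: "f \<in> L (Suc n)" "f \<notin> L n" using L(2) by blast
      obtain q where q: "q \<in> carrier (mpoly_ring X)" "f - q \<in> L n"
        using mod_outside_variables[OF ideal[of n] out_L, of X f] by blast
      have "q \<in> L (Suc n)"
        using is_ideal_mem_iff[OF ideal[of "Suc n"], of f q] q(2) f(1) mono[of n "Suc n"] by auto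
      moreover have "q \<notin> L n" using is_ideal_mem_iff[OF ideal q(2)] f(2) by simp
      ultimately show ?thesis using q(1) unfolding D_def by blast
    qed
    have lm: "lm f \<in> Poly_Mapping.keys f" "Poly_Mapping.keys (lm f) \<subseteq> X"
        "\<And>s. s \<in> Poly_Mapping.keys f \<Longrightarrow> s \<le> lm f" if "f \<in> D n" for f n
    proof -
      have "f \<noteq> 0" using that is_ideal_zero[OF ideal] unfolding D_def by blast
      then show *: "lm f \<in> Poly_Mapping.keys f" unfolding lm_def by simp
      then show "Poly_Mapping.keys (lm f) \<subseteq> X"
        using that unfolding D_def mpoly_ring_carrier by blast
      show "\<And>s. s \<in> Poly_Mapping.keys f \<Longrightarrow> s \<le> lm f" unfolding lm_def by simp
    qed
    have "\<exists>f\<in>D n. \<forall>g\<in>D n. \<not> lm g < lm f" for n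
    proof -
      obtain m where m: "m \<in> lm ` D n" "\<And>s. (s, m) \<in> {(s, t). Poly_Mapping.keys s \<subseteq> X
          \<and> Poly_Mapping.keys t \<subseteq> X \<and> s < t} \<Longrightarrow> s \<notin> lm ` D n"
        using wfE_min'[OF wf_monomials[OF X], of "lm ` D n"] D_ne by auto
      then obtain f where "f \<in> D n" "m = lm f" by blast
      then show ?thesis using m(2) lm(2) by (intro bexI[of _ f]) auto
    qed
    then obtain f where f: "\<And>n. f n \<in> D n" "\<And>n g. g \<in> D n \<Longrightarrow> \<not> lm g < lm (f n)" by metis
    obtain i j u where ij: "i < j" and u: "lm (f j) = lm (f i) + u"
      using dickson[of X "\<lambda>n. lm (f n)", OF X lm(2)[OF f(1)]] by blast
    define c where "c = Poly_Mapping.lookup (f j) (lm (f j)) / Poly_Mapping.lookup (f i) (lm (f i))"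
    define g where "g = f j - Poly_Mapping.single u c * f i"
    have keys_g: "s \<in> Poly_Mapping.keys (f j) \<or> (\<exists>r\<in>Poly_Mapping.keys (f i). s = u + r)"
      if "s \<in> Poly_Mapping.keys g" for s
    proof -
      have "Poly_Mapping.keys (Poly_Mapping.single u c * f i) \<subseteq> (+) u ` Poly_Mapping.keys (f i)"
        using keys_mult[of "Poly_Mapping.single u c" "f i"] by (auto split: if_splits)
      moreover have "s \<in> Poly_Mapping.keys (f j) \<union> Poly_Mapping.keys (Poly_Mapping.single u c * f i)"
        using that unfolding g_def by (auto simp: in_keys_iff lookup_minus)
      ultimately show ?thesis by auto
    qed
    have fi: "f i \<in> L (Suc i)" "f i \<in> carrier (mpoly_ring X)"
      and fj: "f j \<in> L (Suc j)" "f j \<notin> L j" "f j \<in> carrier (mpoly_ring X)"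
      using f(1) unfolding D_def by auto
    have "f i \<in> L j" using fi(1) mono[of "Suc i" j] ij by auto
    then have sub_j: "Poly_Mapping.single u c * f i \<in> L j" by (rule is_ideal_mult[OF ideal])
    then have "Poly_Mapping.single u c * f i \<in> L (Suc j)" using mono[of j "Suc j"] by auto
    then have "g \<in> L (Suc j)" unfolding g_def by (intro is_ideal_diff[OF ideal] fj(1))
    moreover have "g \<notin> L j"
      using is_ideal_mem_iff[OF ideal[of j], of "f j" g] sub_j fj(2) unfolding g_def by simp
    moreover have "g \<in> carrier (mpoly_ring X)"
    proof -
      have "Poly_Mapping.keys u \<subseteq> X"
        using lm(2)[OF f(1)[of j]] unfolding u by (simp add: keys_plus_nat)
      have "Poly_Mapping.keys s \<subseteq> X" if s: "s \<in> Poly_Mapping.keys g" for s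
      proof -
        from keys_g[OF s] show ?thesis
        proof
          assume "\<exists>r\<in>Poly_Mapping.keys (f i). s = u + r"
          then obtain r where "r \<in> Poly_Mapping.keys (f i)" "s = u + r" by blast
          then show ?thesis
            using fi(2) \<open>Poly_Mapping.keys u \<subseteq> X\<close> by (simp add: mpoly_ring_carrier keys_plus_nat)
        qed (use fj(3) in \<open>simp add: mpoly_ring_carrier\<close>)
      qed
      then show ?thesis by (simp add: mpoly_ring_carrier)
    qed
    ultimately have gD: "g \<in> D j" unfolding D_def by simp
    have "lm g \<le> lm (f j)"
    proof -
      from keys_g[OF lm(1)[OF gD]] show ?thesis
      proof
        assume "\<exists>r\<in>Poly_Mapping.keys (f i). lm g = u + r"
        then obtain r where r: "r \<in> Poly_Mapping.keys (f i)" "lm g = u + r" by blast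
        have "r \<le> lm (f i)" using f(1) r(1) by (rule lm(3))
        then have "u + r \<le> u + lm (f i)" by (rule add_left_mono)
        then show ?thesis by (simp only: u r(2) add.commute)
      qed (rule lm(3)[OF f(1)])
    qed
    moreover have "lm g \<noteq> lm (f j)"
    proof
      assume eq: "lm g = lm (f j)"
      have nz: "Poly_Mapping.lookup (f i) (lm (f i)) \<noteq> 0"
        using lm(1)[OF f(1)[of i]] by (simp add: in_keys_iff)
      have "lm (f j) = u + lm (f i)" by (simp only: u add.commute)
      then have "Poly_Mapping.lookup (Poly_Mapping.single u c * f i) (lm (f j))
          = c * Poly_Mapping.lookup (f i) (lm (f i))"
        by (simp only: lookup_single_mult)
      then have "Poly_Mapping.lookup g (lm (f j)) = 0"
        using nz by (simp add: g_def lookup_minus c_def)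
      then show False using lm(1)[OF gD] eq by (simp add: in_keys_iff)
    qed
    ultimately show False using f(2)[OF gD] by simp
  qed
qed

section \<open>Connecting monomials with equal margins\<close>

lemma keys_meet_if_degree_eq:
  assumes "degree_in Q t = degree_in Q t'" "x \<in> Poly_Mapping.keys t" "x \<in> Q"
  obtains y where "y \<in> Poly_Mapping.keys t'" "y \<in> Q"
  using assms degree_in_eq_0_iff[of Q t] degree_in_eq_0_iff[of Q t'] by auto

abbreviation cell :: "nat \<Rightarrow> nat \<Rightarrow> (nat \<times> nat) \<Rightarrow>\<^sub>0 nat" where
  "cell i k \<equiv> Poly_Mapping.single (i, k) 1"

text \<open>
  Moves inside rectangles connect any two monomials with equal margins. For an entry \<open>(i, k)\<close> of
  \<open>t\<close> the equality of margins yields entries \<open>(i, l)\<close> and \<open>(j, k)\<close> of \<open>t'\<close> in the same block; a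
  move turns them into \<open>(i, k)\<close> and \<open>(j, l)\<close>, whereupon \<open>(i, k)\<close> can be cancelled. The relation
  \<open>E\<close> is kept abstract because it is used with congruence modulo the edge ideal and with
  congruence after multiplication by a fixed variable.
\<close>

lemma connected_if_same_margins:
  fixes E :: "(nat \<times> nat \<Rightarrow>\<^sub>0 nat) \<Rightarrow> (nat \<times> nat \<Rightarrow>\<^sub>0 nat) \<Rightarrow> bool"
  assumes F: "F = cells \<beta> R V"
    and refl: "\<And>t. E t t" and trans: "\<And>t u v. E t u \<Longrightarrow> E u v \<Longrightarrow> E t v"
    and add: "\<And>i k t u. (i, k) \<in> F \<Longrightarrow> E t u \<Longrightarrow> E (cell i k + t) (cell i k + u)"
    and swap: "\<And>i j k l u. (i, k) \<in> F \<Longrightarrow> (j, l) \<in> F \<Longrightarrow> \<beta> k = \<beta> l \<Longrightarrow> Poly_Mapping.keys u \<subseteq> F \<Longrightarrow>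
      E (cell i k + (cell j l + u)) (cell i l + (cell j k + u))"
    and t: "Poly_Mapping.keys t \<subseteq> F" "Poly_Mapping.keys t' \<subseteq> F" "same_margins \<beta> t t'"
  shows "E t t'"
  using t
proof (induction "degree_in UNIV t" arbitrary: t t')
  case 0
  then have t: "t = 0" using degree_in_eq_0_iff[of UNIV t] by auto
  have "Poly_Mapping.keys t' = {}"
  proof (rule ccontr)
    assume "Poly_Mapping.keys t' \<noteq> {}"
    then obtain i k where "(i, k) \<in> Poly_Mapping.keys t'" by (metis all_not_in_conv surj_pair)
    then show False
      using same_margins_keys_disjoint[OF 0(4) is_margin_column[of \<beta> k]] t by auto
  qed
  then show ?case using t refl by simp
next
  case (Suc d)
  then have "Poly_Mapping.keys t \<noteq> {}" using degree_in_eq_0_iff[of UNIV t] by auto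
  then obtain i k where ik: "(i, k) \<in> Poly_Mapping.keys t" by (metis all_not_in_conv surj_pair)
  then have ikF: "(i, k) \<in> F" using Suc.prems by auto
  from split_off_variable[OF ik] obtain u where u: "t = cell i k + u" by metis
  have du: "d = degree_in UNIV u" using Suc.hyps(2) by (simp add: u degree_in_add degree_in_single)
  have uF: "Poly_Mapping.keys u \<subseteq> F" using Suc.prems by (simp add: u keys_plus_nat)
  show ?case
  proof (cases "(i, k) \<in> Poly_Mapping.keys t'")
    case True
    from split_off_variable[OF True] obtain u' where u': "t' = cell i k + u'" by metis
    have "E u u'"
      using Suc.prems uF du by (intro Suc.hyps(1)) (simp_all add: u u' keys_plus_nat same_margins_add_left)
    then show ?thesis unfolding u u' by (rule add[OF ikF])
  next
    case False
    obtain y where y: "y \<in> Poly_Mapping.keys t'" "y \<in> block_row \<beta> i (\<beta> k)"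
      using keys_meet_if_degree_eq[OF _ ik, of "block_row \<beta> i (\<beta> k)" t'] Suc.prems(3)
      by (auto simp: same_margins_def)
    obtain x where x: "x \<in> Poly_Mapping.keys t'" "x \<in> column k"
      using keys_meet_if_degree_eq[OF _ ik, of "column k" t'] Suc.prems(3)
      by (auto simp: same_margins_def)
    obtain l where l: "(i, l) \<in> Poly_Mapping.keys t'" "\<beta> l = \<beta> k" using y by (cases y) auto
    obtain j where j: "(j, k) \<in> Poly_Mapping.keys t'" using x by (cases x) auto
    from split_off_variable[OF l(1)] obtain v' where v': "t' = cell i l + v'" by metis
    have "(j, k) \<in> Poly_Mapping.keys v'" using j False l by (auto simp: v' keys_plus_nat)
    from split_off_variable[OF this] obtain v where v: "v' = cell j k + v" by metis
    have F4: "(i, l) \<in> F" "(j, k) \<in> F" "(j, l) \<in> F" "Poly_Mapping.keys v \<subseteq> F"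
      using Suc.prems(2) l(2) by (auto simp: v' v keys_plus_nat F cells_def)
    have 1: "E (cell i k + (cell j l + v)) t'"
      unfolding v' v using ikF F4 l(2) by (intro swap) auto
    have m: "same_margins \<beta> (cell i k + (cell j l + v)) t'"
      unfolding v' v using l(2) by (intro same_margins_swap) simp
    have "same_margins \<beta> (cell i k + u) (cell i k + (cell j l + v))"
      using m Suc.prems(3) unfolding u same_margins_def by simp
    then have "same_margins \<beta> u (cell j l + v)" by (simp only: same_margins_add_left)
    then have "E u (cell j l + v)"
      using uF F4 du by (intro Suc.hyps(1)) (auto simp: keys_plus_nat)
    then have "E t (cell i k + (cell j l + v))" unfolding u by (rule add[OF ikF])
    then show ?thesis using 1 by (rule trans)
  qed
qed

section \<open>The edge ideal as an intersection\<close>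

lemma ideal_restrict_mpoly_ring:
  fixes L :: "('x, 'k::field) mpoly set"
  assumes "is_ideal L"
  shows "ideal (L \<inter> carrier (mpoly_ring X)) (mpoly_ring X)"
proof -
  let ?S = "mpoly_ring X :: ('x, 'k) mpoly ring"
  interpret S: cring ?S by (rule cring_mpoly_ring)
  show ?thesis
  proof (rule idealI[OF S.ring_axioms])
    show "subgroup (L \<inter> carrier ?S) (add_monoid ?S)"
    proof (rule S.add.subgroupI)
      show "L \<inter> carrier ?S \<noteq> {}"
        using is_ideal_zero[OF assms] S.zero_closed by auto
      fix a assume a: "a \<in> L \<inter> carrier ?S"
      then have "\<ominus>\<^bsub>?S\<^esub> a = - a"
        by (intro S.minus_equality) (auto simp: uminus_mpoly_closed)
      then show "\<ominus>\<^bsub>?S\<^esub> a \<in> L \<inter> carrier ?S"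
        using a uminus_mpoly_closed is_ideal_uminus[OF assms] by auto
    next
      fix a b assume "a \<in> L \<inter> carrier ?S" "b \<in> L \<inter> carrier ?S"
      then show "a \<oplus>\<^bsub>?S\<^esub> b \<in> L \<inter> carrier ?S"
        using S.add.m_closed[of a b] is_ideal_add[OF assms] by auto
    qed auto
  next
    fix a x assume "a \<in> L \<inter> carrier ?S" "x \<in> carrier ?S"
    then show "x \<otimes>\<^bsub>?S\<^esub> a \<in> L \<inter> carrier ?S"
      "a \<otimes>\<^bsub>?S\<^esub> x \<in> L \<inter> carrier ?S"
      using S.m_closed[of x a] S.m_closed[of a x] is_ideal_mult[OF assms, of a x]
      by (auto simp: mult.commute)
  qed
qed

text \<open>
  The graphs of the theorem, apart from connectedness and incompleteness. Naming the classes of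
  adjacent vertices off \<open>C\<close> by \<open>\<beta>\<close> makes them the blocks with respect to which margins are taken.
\<close>

locale clique_cone =
  fixes m n :: nat and G :: "nat pair_pre_digraph" and C :: "nat set" and \<beta> :: "nat \<Rightarrow> 'b"
  assumes C: "C \<subseteq> {1..n}"
    and arcs: "\<And>k l. (k, l) \<in> parcs G \<longleftrightarrow>
      k \<in> {1..n} \<and> l \<in> {1..n} \<and> k \<noteq> l \<and> (k \<in> C \<or> l \<in> C \<or> \<beta> k = \<beta> l)"
begin

abbreviation (input) "X \<equiv> {1..m} \<times> {1..n}"
abbreviation (input) "Y \<equiv> {1..m} \<times> ({1..n} - C)"

lemma X_cells: "X = cells \<gamma> (\<lambda>_. {1..m}) {1..n}"
  and Y_cells: "Y = cells \<gamma> (\<lambda>_. {1..m}) ({1..n} - C)"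
  by (auto simp: cells_def)

context
  fixes J :: "(nat \<times> nat, 'k::field) mpoly set"
  defines "J \<equiv> gbei m n G"
begin

lemma generators_closed:
  "{mvar (i, k) * mvar (j, l) - mvar (i, l) * mvar (j, k) | i j k l.
        1 \<le> i \<and> i < j \<and> j \<le> m \<and> (k, l) \<in> parcs G \<and> k < l}
    \<subseteq> carrier (gbei_ring m n :: (nat \<times> nat, 'k) mpoly ring)"
proof safe
  interpret S: cring "gbei_ring m n :: (nat \<times> nat, 'k) mpoly ring" by (rule cring_mpoly_ring)
  fix i j k l assume "1 \<le> i" "i < j" "j \<le> m" "(k, l) \<in> parcs G"
  then have v: "mvar (x, y) \<in> carrier (gbei_ring m n :: (nat \<times> nat, 'k) mpoly ring)"
    if "x \<in> {i, j}" "y \<in> {k, l}" for x y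
    using that by (intro mvar_closed) (auto simp: arcs)
  have c: "mvar (i, k) * mvar (j, l) \<in> carrier (gbei_ring m n :: (nat \<times> nat, 'k) mpoly ring)"
    "mvar (i, l) * mvar (j, k) \<in> carrier (gbei_ring m n :: (nat \<times> nat, 'k) mpoly ring)"
    using S.m_closed[OF v v, of i k j l] S.m_closed[OF v v, of i l j k] by auto
  show "mvar (i, k) * mvar (j, l) - mvar (i, l) * mvar (j, k)
      \<in> carrier (gbei_ring m n :: (nat \<times> nat, 'k) mpoly ring)"
    using S.minus_closed[OF c] a_minus_mpoly_ring[OF c] by simp
qed

lemma ideal_J: "ideal J (gbei_ring m n)"
proof -
  interpret S: cring "gbei_ring m n :: (nat \<times> nat, 'k) mpoly ring" by (rule cring_mpoly_ring)
  show ?thesis unfolding J_def gbei_def by (rule S.genideal_ideal[OF generators_closed])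
qed

lemma J_add: "p \<in> J \<Longrightarrow> q \<in> J \<Longrightarrow> p + q \<in> J"
  using additive_subgroup.a_closed[OF ideal.axioms(1)[OF ideal_J], of p q] by simp

lemma J_mult: "p \<in> J \<Longrightarrow> a \<in> carrier (gbei_ring m n) \<Longrightarrow> a * p \<in> J"
  using ideal.I_l_closed[OF ideal_J, of p a] by simp

lemma J_zero: "0 \<in> J"
  using additive_subgroup.zero_closed[OF ideal.axioms(1)[OF ideal_J]] by simp

lemma single_closed:
  "Poly_Mapping.keys t \<subseteq> X \<Longrightarrow> Poly_Mapping.single t (a::'k) \<in> carrier (gbei_ring m n)"
  by (simp add: mpoly_ring_carrier)

lemma J_uminus: "p \<in> J \<Longrightarrow> - p \<in> J"
  using J_mult[of p "Poly_Mapping.single 0 (- 1)"] single_closed[of 0 "- 1"]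
  by (simp add: single_uminus)

lemma is_subspace_J: "is_subspace J"
  unfolding is_subspace_def using J_zero J_add J_mult single_closed[of 0] by auto

definition conn :: "(nat \<times> nat \<Rightarrow>\<^sub>0 nat) \<Rightarrow> (nat \<times> nat \<Rightarrow>\<^sub>0 nat) \<Rightarrow> bool" where
  "conn t t' \<longleftrightarrow> Poly_Mapping.single t 1 - Poly_Mapping.single t' 1 \<in> J"

lemma conn_refl: "conn t t"
  by (simp add: conn_def J_zero)

lemma conn_trans: "conn t u \<Longrightarrow> conn u v \<Longrightarrow> conn t v"
  unfolding conn_def using J_add[of "Poly_Mapping.single t 1 - Poly_Mapping.single u 1"
      "Poly_Mapping.single u 1 - Poly_Mapping.single v 1"] by simp

lemma conn_sym: "conn t u \<Longrightarrow> conn u t"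
  unfolding conn_def using J_uminus by fastforce

lemma conn_add: "conn t u \<Longrightarrow> Poly_Mapping.keys s \<subseteq> X \<Longrightarrow> conn (s + t) (s + u)"
  unfolding conn_def
  using J_mult[of "Poly_Mapping.single t 1 - Poly_Mapping.single u 1" "Poly_Mapping.single s 1"]
    single_closed[of s 1]
  by (simp add: right_diff_distrib mult_single)

lemma conn_generator:
  assumes "1 \<le> i" "i < j" "j \<le> m" "(k, l) \<in> parcs G" "k < l"
  shows "conn (cell i k + cell j l) (cell i l + cell j k)"
proof -
  interpret S: cring "gbei_ring m n :: (nat \<times> nat, 'k) mpoly ring" by (rule cring_mpoly_ring)
  have "mvar (i, k) * mvar (j, l) - mvar (i, l) * mvar (j, k) \<in> J"
    unfolding J_def gbei_def using S.genideal_self[OF generators_closed] assms by blast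
  then show ?thesis by (simp add: conn_def mvar_def mult_single)
qed

lemma conn_swap:
  assumes "i \<in> {1..m}" "j \<in> {1..m}" "k \<in> {1..n}" "l \<in> {1..n}"
    and kl: "k \<in> C \<or> l \<in> C \<or> \<beta> k = \<beta> l" and u: "Poly_Mapping.keys u \<subseteq> X"
  shows "conn (cell i k + (cell j l + u)) (cell i l + (cell j k + u))"
proof (cases "i = j \<or> k = l")
  case True
  then show ?thesis by (auto simp: conn_refl add.left_commute)
next
  case False
  have arc: "(k, l) \<in> parcs G" "(l, k) \<in> parcs G" using assms False by (auto simp: arcs)
  have gen: "conn (cell i k + cell j l) (cell i l + cell j k)"
    if "i < j" "k < l" "(k, l) \<in> parcs G" "1 \<le> i" "j \<le> m" for i j k l
    using conn_generator that by blast
  have "conn (cell i k + cell j l) (cell i l + cell j k)"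
  proof (cases "i < j")
    case True
    then show ?thesis
      using False arc assms(1,2) gen[of i j k l] conn_sym[OF gen[of i j l k]]
      by (cases "k < l") auto
  next
    case ge: False
    then show ?thesis
      using False arc assms(1,2) conn_sym[OF gen[of j i k l]] gen[of j i l k]
      by (cases "k < l") (auto simp: add.commute)
  qed
  from conn_add[OF this u] show ?thesis by (simp add: ac_simps)
qed

lemma conn_if_off_C:
  assumes "Poly_Mapping.keys t \<subseteq> Y" "Poly_Mapping.keys t' \<subseteq> Y" "same_margins \<beta> t t'"
  shows "conn t t'"
proof (rule connected_if_same_margins[OF Y_cells conn_refl conn_trans _ _ assms])
  show "conn (cell i k + t) (cell i k + u)" if "(i, k) \<in> Y" "conn t u" for i k t u
    using that by (intro conn_add) auto
  show "conn (cell i k + (cell j l + u)) (cell i l + (cell j k + u))"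
    if "(i, k) \<in> Y" "(j, l) \<in> Y" "\<beta> k = \<beta> l" "Poly_Mapping.keys u \<subseteq> Y" for i j k l u
    using that by (intro conn_swap) auto
qed

text \<open>
  An exchange between arbitrary columns \<open>k\<close> and \<open>l\<close> is composed of three exchanges with a column
  \<open>c\<close> in \<open>C\<close>: the entry in column \<open>c\<close> visits \<open>k\<close>, a second entry moves from \<open>l\<close> through \<open>c\<close>, and
  finally the first one returns.
\<close>

lemma conn_swap_via_C:
  assumes "a \<in> {1..m}" "c \<in> C" "i \<in> {1..m}" "j \<in> {1..m}" "k \<in> {1..n}" "l \<in> {1..n}"
    and u: "Poly_Mapping.keys u \<subseteq> X"
  shows "conn (cell a c + (cell i k + (cell j l + u))) (cell a c + (cell i l + (cell j k + u)))"
proof -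
  have c: "c \<in> {1..n}" using assms(2) C by auto
  have 1: "conn (cell a c + (cell i k + (cell j l + u))) (cell a k + (cell i c + (cell j l + u)))"
    using assms c by (intro conn_swap) (auto simp: keys_plus_nat)
  have 2: "conn (cell i c + (cell j l + (cell a k + u))) (cell i l + (cell j c + (cell a k + u)))"
    using assms c by (intro conn_swap) (auto simp: keys_plus_nat)
  have 3: "conn (cell j c + (cell a k + (cell i l + u))) (cell j k + (cell a c + (cell i l + u)))"
    using assms c by (intro conn_swap) (auto simp: keys_plus_nat)
  have "conn (cell a c + (cell i k + (cell j l + u))) (cell i l + (cell j c + (cell a k + u)))"
    using conn_trans[OF 1] 2 by (simp add: ac_simps)
  from conn_trans[OF this] 3 show ?thesis by (simp add: ac_simps)
qed

text \<open>
  After one exchange both monomials contain the variable at \<open>(a, c)\<close>. Set it aside: it makes all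
  exchanges possible for the remaining factors, which have equal margins.
\<close>

lemma conn_if_meets_C:
  fixes t t' :: "nat \<times> nat \<Rightarrow>\<^sub>0 nat"
  defines "\<gamma> \<equiv> \<lambda>_::nat. ()"
  assumes t: "Poly_Mapping.keys t \<subseteq> X" "Poly_Mapping.keys t' \<subseteq> X" "same_margins \<gamma> t t'"
    and ac: "(a, c) \<in> Poly_Mapping.keys t" "c \<in> C"
  shows "conn t t'"
proof -
  have a: "a \<in> {1..m}" and c: "c \<in> {1..n}" using ac t(1) by auto
  have conn_ac: "conn (cell a c + u) (cell a c + u')"
    if "Poly_Mapping.keys u \<subseteq> X" "Poly_Mapping.keys u' \<subseteq> X" "same_margins \<gamma> u u'" for u u'
  proof (rule connected_if_same_margins[where E = "\<lambda>u u'. conn (cell a c + u) (cell a c + u')",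
        OF X_cells conn_refl conn_trans _ _ that])
    show "conn (cell a c + (cell i k + t)) (cell a c + (cell i k + u))"
      if "(i, k) \<in> X" "conn (cell a c + t) (cell a c + u)" for i k t u
      using conn_add[OF that(2), of "cell i k"] that(1) by (auto simp: add.left_commute)
    show "conn (cell a c + (cell i k + (cell j l + u))) (cell a c + (cell i l + (cell j k + u)))"
      if "(i, k) \<in> X" "(j, l) \<in> X" "\<gamma> k = \<gamma> l" "Poly_Mapping.keys u \<subseteq> X" for i j k l u
      using that a ac(2) by (intro conn_swap_via_C) auto
  qed
  from split_off_variable[OF ac(1)] obtain u where u: "t = cell a c + u" by metis
  have uX: "Poly_Mapping.keys u \<subseteq> X" using t(1) by (simp add: u keys_plus_nat)
  show ?thesis
  proof (cases "(a, c) \<in> Poly_Mapping.keys t'")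
    case True
    from split_off_variable[OF True] obtain u' where u': "t' = cell a c + u'" by metis
    show ?thesis unfolding u u'
      using t uX by (intro conn_ac) (simp_all add: u u' keys_plus_nat same_margins_add_left)
  next
    case False
    obtain y where y: "y \<in> Poly_Mapping.keys t'" "y \<in> block_row \<gamma> a (\<gamma> c)"
      using keys_meet_if_degree_eq[OF _ ac(1), of "block_row \<gamma> a (\<gamma> c)" t'] t(3)
      by (auto simp: same_margins_def)
    obtain x where x: "x \<in> Poly_Mapping.keys t'" "x \<in> column c"
      using keys_meet_if_degree_eq[OF _ ac(1), of "column c" t'] t(3)
      by (auto simp: same_margins_def)
    obtain l where l: "(a, l) \<in> Poly_Mapping.keys t'" using y by (cases y) auto
    obtain b where b: "(b, c) \<in> Poly_Mapping.keys t'" using x by (cases x) auto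
    from split_off_variable[OF l] obtain v' where v': "t' = cell a l + v'" by metis
    have "(b, c) \<in> Poly_Mapping.keys v'" using b False l by (auto simp: v' keys_plus_nat)
    from split_off_variable[OF this] obtain v where v: "v' = cell b c + v" by metis
    have X: "(a, l) \<in> X" "(b, c) \<in> X" "Poly_Mapping.keys v \<subseteq> X"
      using t(2) by (auto simp: v' v keys_plus_nat)
    have 1: "conn (cell a c + (cell b l + v)) t'"
      unfolding v' v using X a c ac(2) by (intro conn_swap) auto
    have m: "same_margins \<gamma> (cell a c + (cell b l + v)) t'"
      unfolding v' v by (intro same_margins_swap) (simp add: \<gamma>_def)
    have "same_margins \<gamma> (cell a c + u) (cell a c + (cell b l + v))"
      using m t(3) unfolding u same_margins_def by simp
    then have "same_margins \<gamma> u (cell b l + v)" by (simp only: same_margins_add_left)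
    then have "conn t (cell a c + (cell b l + v))"
      unfolding u using uX X by (intro conn_ac) (auto simp: keys_plus_nat)
    then show ?thesis using 1 by (rule conn_trans)
  qed
qed

text \<open>
  The two components of the edge ideal: the 2-minors of the whole matrix, and the variables in \<open>C\<close>
  together with the 2-minors of the blocks, each with the variables outside the matrix.
\<close>

definition L\<^sub>A :: "(nat \<times> nat, 'k) mpoly set" where
  "L\<^sub>A = margin_ideal (\<lambda>_. ()) X"

definition L\<^sub>B :: "(nat \<times> nat, 'k) mpoly set" where
  "L\<^sub>B = margin_ideal \<beta> Y"

lemma generator_mem:
  assumes "1 \<le> i" "i < j" "j \<le> m" "(k, l) \<in> parcs G"
  shows "mvar (i, k) * mvar (j, l) - mvar (i, l) * mvar (j, k) \<in> L\<^sub>A \<inter> L\<^sub>B"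
proof -
  let ?t = "cell i k + (cell j l + 0)" and ?t' = "cell i l + (cell j k + 0)"
  have eq: "mvar (i, k) * mvar (j, l) - mvar (i, l) * mvar (j, k)
      = Poly_Mapping.single ?t 1 - (Poly_Mapping.single ?t' 1 :: (nat \<times> nat, 'k) mpoly)"
    by (simp add: mvar_def mult_single)
  have kl: "k \<in> {1..n}" "l \<in> {1..n}" "k \<in> C \<or> l \<in> C \<or> \<beta> k = \<beta> l" using assms arcs by auto
  have "Poly_Mapping.keys ?t \<subseteq> X" "Poly_Mapping.keys ?t' \<subseteq> X"
    using kl assms by (auto simp: keys_plus_nat)
  then have A: "Poly_Mapping.single ?t 1 - Poly_Mapping.single ?t' 1 \<in> L\<^sub>A"
    unfolding L\<^sub>A_def by (intro binomial_mem_margin_ideal same_margins_swap) auto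
  have "Poly_Mapping.single ?t 1 - Poly_Mapping.single ?t' 1 \<in> L\<^sub>B"
  proof (cases "k \<in> C \<or> l \<in> C")
    case True
    then show ?thesis unfolding L\<^sub>B_def
      by (intro is_ideal_diff is_ideal_margin_ideal single_mem_margin_ideal)
        (auto simp: keys_plus_nat)
  next
    case False
    then show ?thesis unfolding L\<^sub>B_def using kl assms
      by (intro binomial_mem_margin_ideal same_margins_swap) (auto simp: keys_plus_nat)
  qed
  then show ?thesis using A unfolding eq by blast
qed

text \<open>
  The classes of the congruence modulo the edge ideal are classes of \<open>L\<^sub>B\<close> off \<open>C\<close> and classes of
  \<open>L\<^sub>A\<close> for monomials that meet \<open>C\<close>, so a polynomial in both ideals has vanishing class sums.
\<close>

lemma margin_intersection_subset_J:
  assumes p: "p \<in> L\<^sub>A \<inter> L\<^sub>B" "p \<in> carrier (gbei_ring m n)"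
  shows "p \<in> J"
proof -
  define lab where "lab t = (if Poly_Mapping.keys t \<subseteq> Y then Inl (margin_label \<beta> Y t)
      else Inr (margin_label (\<lambda>_. ()) X t))" for t
  have pX: "Poly_Mapping.keys t \<subseteq> X" if "t \<in> Poly_Mapping.keys p" for t
    using p(2) that unfolding mpoly_ring_carrier by blast
  show ?thesis
  proof (rule mem_subspace_by_classes[of _ _ lab, OF is_subspace_J])
    fix t t' assume t: "t \<in> Poly_Mapping.keys p" "t' \<in> Poly_Mapping.keys p" and eq: "lab t = lab t'"
    have "conn t t'"
    proof (cases "Poly_Mapping.keys t \<subseteq> Y")
      case True
      then show ?thesis
        using eq by (intro conn_if_off_C) (auto simp: lab_def margin_label_eq_iff split: if_splits)
    next
      case False
      then obtain a c where "(a, c) \<in> Poly_Mapping.keys t" "c \<in> C" using pX[OF t(1)] by fastforce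
      then show ?thesis
        using eq False pX[OF t(1)] pX[OF t(2)]
        by (intro conn_if_meets_C[of t t' a c]) (auto simp: lab_def margin_label_eq_iff split: if_splits)
    qed
    then show "Poly_Mapping.single t 1 - Poly_Mapping.single t' 1 \<in> J" by (simp add: conn_def)
  next
    fix t assume t: "t \<in> Poly_Mapping.keys p"
    have "class_sum lab p (lab t) = 0"
    proof (cases "Poly_Mapping.keys t \<subseteq> Y")
      case True
      have "lab s = lab t \<longleftrightarrow> margin_label \<beta> Y s = margin_label \<beta> Y t" for s
        using True by (auto simp: lab_def margin_label_eq_iff)
      then have "class_sum lab p (lab t) = class_sum (margin_label \<beta> Y) p (margin_label \<beta> Y t)"
        by (simp add: class_sum_def)
      then show ?thesis using margin_ideal_class_sum[of p \<beta> Y t] True p(1) by (simp add: L\<^sub>B_def)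
    next
      case False
      then obtain a c where ac: "(a, c) \<in> Poly_Mapping.keys t" "c \<in> C" using pX[OF t] by fastforce
      let ?l = "margin_label (\<lambda>_. ()) X"
      have "lab s = lab t \<longleftrightarrow> ?l s = ?l t" for s
      proof
        assume eq: "?l s = ?l t"
        then have "same_margins (\<lambda>_. ()) s t"
          using pX[OF t] by (auto simp: margin_label_eq_iff split: if_splits)
        from same_margins_keys_disjoint[OF this is_margin_column[of _ c]]
        have "Poly_Mapping.keys s \<inter> column c \<noteq> {}" using ac by auto
        then have "\<not> Poly_Mapping.keys s \<subseteq> Y" using ac(2) by (auto simp: column_def)
        then show "lab s = lab t" using False eq by (simp add: lab_def)
      qed (use False in \<open>auto simp: lab_def split: if_splits\<close>)
      then have "class_sum lab p (lab t) = class_sum ?l p (?l t)"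
        by (simp add: class_sum_def)
      then show ?thesis using margin_ideal_class_sum[of p "\<lambda>_. ()" X t] pX[OF t] p(1) by (simp add: L\<^sub>A_def)
    qed
    then show "class_sum lab p (lab t) = 0 \<or> Poly_Mapping.single t 1 \<in> J" ..
  qed
qed

lemma gbei_eq_Int: "J = L\<^sub>A \<inter> L\<^sub>B \<inter> carrier (gbei_ring m n)"
proof
  interpret S: cring "gbei_ring m n :: (nat \<times> nat, 'k) mpoly ring" by (rule cring_mpoly_ring)
  have "is_ideal (L\<^sub>A \<inter> L\<^sub>B)"
    by (simp add: is_ideal_Int is_ideal_margin_ideal L\<^sub>A_def L\<^sub>B_def)
  then show "J \<subseteq> L\<^sub>A \<inter> L\<^sub>B \<inter> carrier (gbei_ring m n)"
    unfolding J_def gbei_def using generator_mem generators_closed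
    by (intro S.genideal_minimal ideal_restrict_mpoly_ring) blast+
qed (use margin_intersection_subset_J in blast)

lemma same_margins_coarsen:
  assumes "same_margins \<beta> t t'"
  shows "same_margins (\<lambda>_. ()) t t'"
proof -
  have "degree_in (block_row (\<lambda>_. ()) i ()) t = degree_in (block_row (\<lambda>_. ()) i ()) t'" for i
  proof -
    let ?K = "Poly_Mapping.keys t \<union> Poly_Mapping.keys t'"
    let ?B = "(\<lambda>x. \<beta> (snd x)) ` ?K"
    have sum: "degree_in (block_row (\<lambda>_. ()) i ()) s = (\<Sum>b\<in>?B. degree_in (block_row \<beta> i b) s)"
      if "Poly_Mapping.keys s \<subseteq> ?K" for s
    proof -
      have "degree_in (block_row (\<lambda>_. ()) i ()) s
          = (\<Sum>x\<in>?K \<inter> block_row (\<lambda>_. ()) i (). Poly_Mapping.lookup s x)"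
        using that by (intro degree_in_superset) auto
      also have "\<dots> = (\<Sum>b\<in>?B. \<Sum>x | x \<in> ?K \<inter> block_row (\<lambda>_. ()) i () \<and> \<beta> (snd x) = b.
          Poly_Mapping.lookup s x)"
        by (rule sum.group[symmetric]) auto
      also have "\<dots> = (\<Sum>b\<in>?B. degree_in (block_row \<beta> i b) s)"
        by (intro sum.cong refl, subst degree_in_superset[of ?K])
          (use that in \<open>auto simp: block_row_def intro!: sum.cong\<close>)
      finally show ?thesis .
    qed
    show ?thesis using assms by (simp add: sum same_margins_def)
  qed
  then show ?thesis using assms by (simp add: same_margins_def)
qed

lemma ideal_sum_L\<^sub>A_L\<^sub>B: "ideal_sum L\<^sub>A L\<^sub>B = margin_ideal (\<lambda>_. ()) Y"
  unfolding L\<^sub>A_def L\<^sub>B_def margin_ideal_def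
proof (rule ideal_sum_class_ideal)
  show "class_ideal (margin_label (\<lambda>_. ()) X) \<subseteq> class_ideal (margin_label (\<lambda>_. ()) Y)"
  proof (rule class_ideal_subset)
    fix t t' assume eq: "margin_label (\<lambda>_. ()) X t = margin_label (\<lambda>_. ()) X t'"
    have Y: "Poly_Mapping.keys s \<subseteq> Y \<longleftrightarrow> Poly_Mapping.keys s \<subseteq> X \<and>
        (\<forall>c\<in>C. Poly_Mapping.keys s \<inter> column c = {})" for s
      by (auto simp: column_def)
    have "(\<forall>c\<in>C. Poly_Mapping.keys t \<inter> column c = {}) \<longleftrightarrow>
        (\<forall>c\<in>C. Poly_Mapping.keys t' \<inter> column c = {})" if "same_margins (\<lambda>_. ()) t t'"
      using same_margins_keys_disjoint[OF that is_margin_column] by blast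
    then show "margin_label (\<lambda>_. ()) Y t = margin_label (\<lambda>_. ()) Y t'"
      using eq unfolding margin_label_eq_iff Y by (auto split: if_splits)
  qed (auto simp: margin_label_eq_None_iff)
  show "class_ideal (margin_label \<beta> Y) \<subseteq> class_ideal (margin_label (\<lambda>_. ()) Y)"
    by (rule class_ideal_subset)
      (auto simp: margin_label_eq_iff margin_label_eq_None_iff same_margins_coarsen split: if_splits)
next
  fix t t' assume "margin_label (\<lambda>_. ()) Y t = margin_label (\<lambda>_. ()) Y t'"
    "margin_label (\<lambda>_. ()) Y t \<noteq> None"
  then show "margin_label (\<lambda>_. ()) X t = margin_label (\<lambda>_. ()) X t'"
    by (auto simp: margin_label_eq_iff margin_label_eq_None_iff split: if_splits)
qed (auto simp: additive_margin_label margin_label_eq_None_iff)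

text \<open>
  The sum of the two ideals has depth \<open>m + n - card C - 1\<close>. This is less than the depth for \<open>L\<^sub>A\<close>,
  because \<open>C\<close> is nonempty, and less than the depth for \<open>L\<^sub>B\<close>, because there are at least two
  blocks and \<open>m \<ge> 2\<close>.
\<close>

lemma koszul_depth_Int_L\<^sub>A_L\<^sub>B:
  fixes xs :: "(nat \<times> nat, 'k) mpoly list"
  assumes m: "m \<ge> 2" and ne: "C \<noteq> {}" and bc: "b \<in> {1..n} - C" "c \<in> {1..n} - C" "\<beta> b \<noteq> \<beta> c"
    and xs: "set xs = mvar ` X"
  shows "koszul_depth xs (L\<^sub>A \<inter> L\<^sub>B) (m + n - card C)"
proof -
  let ?V = "{1..n} - C"
  have cV: "card ?V = n - card C" using C by (simp add: card_Diff_subset finite_subset)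
  have cC: "card C \<le> n" "0 < card C"
    using card_mono[of "{1..n}" C] C ne finite_subset[OF C] by auto
  define d where "d = n - card C + (m - 1)"
  have im: "(\<lambda>_. ()) ` ?V = {()}" "(\<lambda>_. ()) ` {1..n} = {()}" using bc(1) by auto
  have dim: "segre_dim (\<lambda>_. ()) (\<lambda>_. {1..m}) {1..n} = n + (m - 1)"
    "segre_dim (\<lambda>_. ()) (\<lambda>_. {1..m}) ?V = d"
    unfolding segre_dim_def im cV d_def by simp_all
  have A: "koszul_depth xs L\<^sub>A (n + (m - 1))"
    using koszul_depth_margin_ideal[of "{1..n}" "\<lambda>_. {1..m}" "\<lambda>_. ()" xs X] xs m
    unfolding L\<^sub>A_def X_cells[of "\<lambda>_. ()", symmetric] dim by simp
  have N: "koszul_depth xs (ideal_sum L\<^sub>A L\<^sub>B) d"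
    using koszul_depth_margin_ideal[of ?V "\<lambda>_. {1..m}" "\<lambda>_. ()" xs X] xs m
    unfolding ideal_sum_L\<^sub>A_L\<^sub>B Y_cells[of "\<lambda>_. ()", symmetric] dim by (simp add: Sigma_mono)
  have "koszul_depth xs L\<^sub>B (segre_dim \<beta> (\<lambda>_. {1..m}) ?V)"
    using koszul_depth_margin_ideal[of ?V "\<lambda>_. {1..m}" \<beta> xs X] xs m
    unfolding L\<^sub>B_def Y_cells[of \<beta>, symmetric] by (simp add: Sigma_mono)
  moreover have "d < segre_dim \<beta> (\<lambda>_. {1..m}) ?V"
  proof -
    have "card {\<beta> b, \<beta> c} \<le> card (\<beta> ` ?V)" using bc by (intro card_mono) auto
    then have "2 * (m - 1) \<le> card (\<beta> ` ?V) * (m - 1)" using bc(3) by (intro mult_le_mono1) simp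
    then have "m - 1 < card (\<beta> ` ?V) * (m - 1)" using m by linarith
    moreover have "segre_dim \<beta> (\<lambda>_. {1..m}) ?V = n - card C + card (\<beta> ` ?V) * (m - 1)"
      unfolding segre_dim_def cV by simp
    ultimately show ?thesis unfolding d_def by linarith
  qed
  ultimately have "koszul_depth xs (L\<^sub>A \<inter> L\<^sub>B) (Suc d)"
    using A cC
    by (intro koszul_depth_Int[OF _ _ _ _ N])
      (auto simp: koszul_depth_def L\<^sub>A_def L\<^sub>B_def is_ideal_margin_ideal d_def)
  moreover have "Suc d = m + n - card C" using m cC by (simp add: d_def)
  ultimately show ?thesis by simp
qed

end

end

section \<open>From Koszul cohomology to depth\<close>

definition adjoin_list :: "'a::comm_ring_1 set \<Rightarrow> 'a list \<Rightarrow> 'a set" where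
  "adjoin_list L ys = foldl adjoin L ys"

lemma adjoin_list_simps [simp]:
  "adjoin_list L [] = L" "adjoin_list L (y # ys) = adjoin_list (adjoin L y) ys"
  "adjoin_list L (ys @ [y]) = adjoin (adjoin_list L ys) y"
  by (simp_all add: adjoin_list_def)

lemma is_ideal_adjoin_list: "is_ideal L \<Longrightarrow> is_ideal (adjoin_list L ys)"
  by (induction ys arbitrary: L) (auto simp: is_ideal_adjoin)

lemma adjoin_list_superset: "L \<subseteq> adjoin_list L ys"
proof (induction ys arbitrary: L)
  case (Cons y ys)
  show ?case using subset_trans[OF adjoin_superset Cons.IH] by simp
qed simp

lemma adjoin_list_subset: "is_ideal I \<Longrightarrow> set ys \<subseteq> I \<Longrightarrow> L \<subseteq> I \<Longrightarrow> adjoin_list L ys \<subseteq> I"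
  by (induction ys arbitrary: L) (auto simp: adjoin_subset)

text \<open>
  This matches the form in which \<open>seq_submodule\<close> is defined.
\<close>

lemma adjoin_list_iff:
  "u \<in> adjoin_list L ys \<longleftrightarrow> (\<exists>v. u - (\<Sum>i<length ys. ys ! i * v i) \<in> L)"
proof (induction ys arbitrary: u rule: rev_induct)
  case (snoc y ys)
  have "u \<in> adjoin_list L (ys @ [y]) \<longleftrightarrow>
      (\<exists>w v. u - y * w - (\<Sum>i<length ys. ys ! i * v i) \<in> L)"
    by (simp add: adjoin_iff snoc.IH)
  also have "\<dots> \<longleftrightarrow> (\<exists>v. u - (\<Sum>i<length (ys @ [y]). (ys @ [y]) ! i * v i) \<in> L)"
  proof
    assume "\<exists>w v. u - y * w - (\<Sum>i<length ys. ys ! i * v i) \<in> L"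
    then obtain w v where wv: "u - y * w - (\<Sum>i<length ys. ys ! i * v i) \<in> L" by blast
    define v' where "v' i = (if i < length ys then v i else w)" for i
    have "(\<Sum>i<length (ys @ [y]). (ys @ [y]) ! i * v' i) = (\<Sum>i<length ys. ys ! i * v i) + y * w"
      by (simp add: v'_def nth_append)
    then show "\<exists>v. u - (\<Sum>i<length (ys @ [y]). (ys @ [y]) ! i * v i) \<in> L"
      using wv by (intro exI[of _ v']) (simp add: algebra_simps)
  next
    assume "\<exists>v. u - (\<Sum>i<length (ys @ [y]). (ys @ [y]) ! i * v i) \<in> L"
    then obtain v where v: "u - (\<Sum>i<length (ys @ [y]). (ys @ [y]) ! i * v i) \<in> L" by blast
    have "(\<Sum>i<length (ys @ [y]). (ys @ [y]) ! i * v i)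
        = (\<Sum>i<length ys. ys ! i * v i) + y * v (length ys)"
      by (simp add: nth_append)
    then have "u - y * v (length ys) - (\<Sum>i<length ys. ys ! i * v i) \<in> L"
      using v by (simp add: algebra_simps)
    then show "\<exists>w v. u - y * w - (\<Sum>i<length ys. ys ! i * v i) \<in> L" by blast
  qed
  finally show ?case .
qed simp

lemma regular_seq_iff:
  "regular_seq L ys \<longleftrightarrow> (\<forall>i<length ys. regular_mod (adjoin_list L (take i ys)) (ys ! i))"
proof (induction ys arbitrary: L)
  case (Cons y ys)
  have "(\<forall>i<length (y # ys). regular_mod (adjoin_list L (take i (y # ys))) ((y # ys) ! i)) \<longleftrightarrow>
      regular_mod L y \<and> (\<forall>i<length ys. regular_mod (adjoin_list (adjoin L y) (take i ys)) (ys ! i))"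
    by (simp add: All_less_Suc2)
  then show ?case using Cons.IH[of "adjoin L y"] by simp
qed simp

lemma regular_mod_cong:
  assumes "is_ideal L" "z - z' \<in> L"
  shows "regular_mod L z \<longleftrightarrow> regular_mod L z'"
proof -
  have "z * u \<in> L \<longleftrightarrow> z' * u \<in> L" for u
    using is_ideal_mem_iff[OF assms(1), of "z * u" "z' * u"] is_ideal_mult[OF assms, of u]
    by (simp add: algebra_simps)
  then show ?thesis by (simp add: regular_mod_def)
qed

lemma adjoin_cong_subset:
  assumes "is_ideal L" "z - z' \<in> L"
  shows "adjoin L z' \<subseteq> adjoin L z"
proof (rule adjoin_subset[OF is_ideal_adjoin[OF assms(1)] _ adjoin_superset])
  have "z' - z * 1 \<in> L" using is_ideal_diff_commute[OF assms] by simp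
  then show "z' \<in> adjoin L z" unfolding adjoin_iff by blast
qed

lemma adjoin_cong:
  assumes "is_ideal L" "z - z' \<in> L"
  shows "adjoin L z = adjoin L z'"
  using adjoin_cong_subset[OF assms] adjoin_cong_subset[OF assms(1) is_ideal_diff_commute[OF assms]]
  by blast

lemma regular_seq_cong:
  assumes "is_ideal L" "list_all2 (\<lambda>z z'. z - z' \<in> L) zs zs'"
  shows "regular_seq L zs \<longleftrightarrow> regular_seq L zs'"
  using assms
proof (induction zs arbitrary: zs' L)
  case (Cons z zs)
  then obtain z' zs'' where zs': "zs' = z' # zs''" "z - z' \<in> L" "list_all2 (\<lambda>z z'. z - z' \<in> L) zs zs''"
    by (auto simp: list_all2_Cons1)
  have "list_all2 (\<lambda>w w'. w - w' \<in> adjoin L z) zs zs''"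
    using zs'(3) by (rule list_all2_mono) (rule subsetD[OF adjoin_superset])
  then have "regular_seq (adjoin L z) zs \<longleftrightarrow> regular_seq (adjoin L z) zs''"
    by (intro Cons.IH is_ideal_adjoin Cons.prems)
  then show ?case
    using zs'(2) Cons.prems(1) adjoin_cong[of L z z'] regular_mod_cong[of L z z'] by (simp add: zs'(1))
qed simp

lemma is_ideal_no_constant_term:
  "is_ideal {p :: ('x, 'k::field) mpoly. Poly_Mapping.lookup p 0 = 0}"
proof -
  have single: "Poly_Mapping.lookup (Poly_Mapping.single t c * p) 0 = 0"
    if p: "Poly_Mapping.lookup p 0 = 0" for t c and p :: "('x, 'k) mpoly"
  proof (cases "t = 0")
    case True
    then show ?thesis using lookup_single_mult[of 0 c p 0] p by simp
  next
    case False
    have "0 \<notin> Poly_Mapping.keys (Poly_Mapping.single t c * p)"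
    proof
      assume "0 \<in> Poly_Mapping.keys (Poly_Mapping.single t c * p)"
      then obtain s where "0 = t + s"
        using keys_mult[of "Poly_Mapping.single t c" p] by (auto split: if_splits)
      then have "Poly_Mapping.keys t = {}" using keys_plus_nat[of t s] by simp
      then show False using False by simp
    qed
    then show ?thesis by (simp add: in_keys_iff)
  qed
  have "Poly_Mapping.lookup (a * p) 0 = 0"
    if "Poly_Mapping.lookup p 0 = 0" for a p :: "('x, 'k) mpoly"
  proof -
    have "a * p = (\<Sum>t\<in>Poly_Mapping.keys a. Poly_Mapping.single t (Poly_Mapping.lookup a t) * p)"
      unfolding sum_distrib_right[symmetric] poly_eq_sum_single[of a, symmetric] ..
    then show ?thesis using single[OF that] by (simp add: lookup_sum)
  qed
  then show ?thesis unfolding is_ideal_def by (simp add: lookup_add)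
qed

context
  fixes X :: "'x::linorder set" and L :: "('x, 'k::field) mpoly set"
  assumes X: "finite X" and L: "is_ideal L" and out: "\<And>x. x \<notin> X \<Longrightarrow> mvar x \<in> L"
begin

interpretation S: cring "mpoly_ring X :: ('x, 'k) mpoly ring"
  by (rule cring_mpoly_ring)

abbreviation (input) "S \<equiv> mpoly_ring X :: ('x, 'k) mpoly ring"
abbreviation (input) "J \<equiv> L \<inter> carrier S"
abbreviation (input) "M \<equiv> quot_module S J"

interpretation J: ideal J S
  by (rule ideal_restrict_mpoly_ring[OF L])

interpretation Q: cring "S Quot J"
  by (rule J.quotient_is_cring) (rule S.cring_axioms)

interpretation M: Module.module S M
  by (rule module_quot_module) (rule S.cring_axioms, rule J.ideal_axioms)

text \<open>
  The quotient of the ring in the variables \<open>X\<close> by the contraction of \<open>L\<close> is \<open>R / L\<close>, because \<open>L\<close>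
  contains the variables outside \<open>X\<close>. The following lemmas translate regular sequences on it into
  statements about \<open>L\<close>.
\<close>

lemma coset_eq_iff:
  assumes "u \<in> carrier S" "v \<in> carrier S"
  shows "J +>\<^bsub>S\<^esub> u = J +>\<^bsub>S\<^esub> v \<longleftrightarrow> u - v \<in> L"
proof -
  have "u \<ominus>\<^bsub>S\<^esub> v = u - v" using assms by (rule a_minus_mpoly_ring)
  moreover have "u \<ominus>\<^bsub>S\<^esub> v \<in> carrier S" using assms by simp
  ultimately show ?thesis
    using S.quotient_eq_iff_same_a_r_cos[OF J.ideal_axioms assms] by simp
qed

lemma carrier_M: "carrier M = (\<lambda>u. J +>\<^bsub>S\<^esub> u) ` carrier S"
  by (auto simp: FactRing_def A_RCOSETS_def')

lemma smult_M:
  assumes "a \<in> carrier S" "u \<in> carrier S"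
  shows "a \<odot>\<^bsub>M\<^esub> (J +>\<^bsub>S\<^esub> u) = J +>\<^bsub>S\<^esub> (a * u)"
  using assms J.rcoset_mult_add[of a u] by (simp add: FactRing_def)

lemma sum_closed:
  fixes r :: nat
  shows "(\<And>i. i < r \<Longrightarrow> f i \<in> carrier S) \<Longrightarrow> (\<Sum>i<r. f i) \<in> carrier S"
proof (induction r)
  case 0
  then show ?case using S.zero_closed by simp
next
  case (Suc r)
  then show ?case using S.a_closed[of "\<Sum>i<r. f i" "f r"] by simp
qed

lemma finsum_M:
  fixes r :: nat
  assumes "\<And>i. i < r \<Longrightarrow> f i \<in> carrier S"
  shows "finsum M (\<lambda>i. J +>\<^bsub>S\<^esub> f i) {..<r} = J +>\<^bsub>S\<^esub> (\<Sum>i<r. f i)"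
  using assms
proof (induction r)
  case 0
  have "0 \<in> J" using is_ideal_zero[OF L] S.zero_closed by simp
  then show ?case
    using S.a_rcos_zero[OF J.ideal_axioms, of 0] by (simp add: FactRing_def)
next
  case (Suc r)
  have c: "J +>\<^bsub>S\<^esub> f i \<in> carrier M" if "i < Suc r" for i
    using Suc.prems[OF that] unfolding carrier_M by blast
  have "finsum M (\<lambda>i. J +>\<^bsub>S\<^esub> f i) {..<Suc r}
      = (J +>\<^bsub>S\<^esub> f r) \<oplus>\<^bsub>M\<^esub> finsum M (\<lambda>i. J +>\<^bsub>S\<^esub> f i) {..<r}"
    unfolding lessThan_Suc using c by (intro M.finsum_insert) auto
  also have "\<dots> = (J +>\<^bsub>S\<^esub> f r) \<oplus>\<^bsub>M\<^esub> (J +>\<^bsub>S\<^esub> (\<Sum>i<r. f i))"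
    using Suc by simp
  also have "\<dots> = J +>\<^bsub>S\<^esub> (f r + (\<Sum>i<r. f i))"
    using J.a_rcos_sum[of "f r" "\<Sum>i<r. f i"] Suc.prems sum_closed[of r f]
    by (simp add: FactRing_def)
  finally show ?case by (simp add: add.commute)
qed

lemma seq_submodule_iff:
  assumes ys: "set ys \<subseteq> carrier S" and u: "u \<in> carrier S"
  shows "J +>\<^bsub>S\<^esub> u \<in> seq_submodule M ys \<longleftrightarrow> u \<in> adjoin_list L ys"
proof -
  have y: "ys ! i \<in> carrier S" if "i < length ys" for i using ys that by auto
  have mult: "ys ! i * v \<in> carrier S" if "i < length ys" "v \<in> carrier S" for i v
    using S.m_closed[OF y that(2)] that(1) by simp
  show ?thesis
  proof
    assume "J +>\<^bsub>S\<^esub> u \<in> seq_submodule M ys"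
    then obtain U where U: "U \<in> {..<length ys} \<rightarrow> carrier M"
      "J +>\<^bsub>S\<^esub> u = finsum M (\<lambda>i. ys ! i \<odot>\<^bsub>M\<^esub> U i) {..<length ys}"
      unfolding seq_submodule_def by blast
    then have "\<forall>i. \<exists>v. i < length ys \<longrightarrow> v \<in> carrier S \<and> U i = J +>\<^bsub>S\<^esub> v"
      unfolding carrier_M by blast
    then obtain v where v: "\<And>i. i < length ys \<Longrightarrow> v i \<in> carrier S"
      "\<And>i. i < length ys \<Longrightarrow> U i = J +>\<^bsub>S\<^esub> v i" by metis
    have "J +>\<^bsub>S\<^esub> u = finsum M (\<lambda>i. J +>\<^bsub>S\<^esub> (ys ! i * v i)) {..<length ys}"
      unfolding U(2)
    proof (rule M.finsum_cong')
      show "(\<lambda>i. J +>\<^bsub>S\<^esub> (ys ! i * v i)) \<in> {..<length ys} \<rightarrow> carrier M"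
        using mult v(1) unfolding carrier_M by auto
    qed (use v smult_M y in auto)
    also have "\<dots> = J +>\<^bsub>S\<^esub> (\<Sum>i<length ys. ys ! i * v i)"
      by (rule finsum_M) (rule mult, assumption, rule v(1))
    finally have "u - (\<Sum>i<length ys. ys ! i * v i) \<in> L"
      using coset_eq_iff[OF u sum_closed] mult v(1) by simp
    then show "u \<in> adjoin_list L ys" unfolding adjoin_list_iff by blast
  next
    assume "u \<in> adjoin_list L ys"
    then obtain v where v: "u - (\<Sum>i<length ys. ys ! i * v i) \<in> L" unfolding adjoin_list_iff by blast
    have "\<forall>i. \<exists>w. w \<in> carrier S \<and> v i - w \<in> L" using mod_outside_variables[OF L out] by metis
    then obtain w where w: "\<And>i. w i \<in> carrier S" "\<And>i. v i - w i \<in> L" by metis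
    have "(\<Sum>i<length ys. ys ! i * v i) - (\<Sum>i<length ys. ys ! i * w i)
        = (\<Sum>i<length ys. ys ! i * (v i - w i))"
      by (simp add: sum_subtractf right_diff_distrib)
    also have "\<dots> \<in> L" using w(2) by (intro is_ideal_sum is_ideal_mult L)
    finally have "u - (\<Sum>i<length ys. ys ! i * w i) \<in> L"
      using is_ideal_add[OF L v] by fastforce
    then have "J +>\<^bsub>S\<^esub> u = J +>\<^bsub>S\<^esub> (\<Sum>i<length ys. ys ! i * w i)"
      using coset_eq_iff[OF u sum_closed] mult w(1) by simp
    also have "\<dots> = finsum M (\<lambda>i. J +>\<^bsub>S\<^esub> (ys ! i * w i)) {..<length ys}"
      by (rule finsum_M[symmetric]) (rule mult, assumption, rule w(1))
    also have "\<dots> = finsum M (\<lambda>i. ys ! i \<odot>\<^bsub>M\<^esub> (J +>\<^bsub>S\<^esub> w i)) {..<length ys}"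
    proof (rule M.finsum_cong')
      show "(\<lambda>i. ys ! i \<odot>\<^bsub>M\<^esub> (J +>\<^bsub>S\<^esub> w i)) \<in> {..<length ys} \<rightarrow> carrier M"
        using mult w(1) smult_M y unfolding carrier_M by auto
    qed (use w smult_M y in auto)
    finally show "J +>\<^bsub>S\<^esub> u \<in> seq_submodule M ys"
      using w(1) unfolding seq_submodule_def carrier_M
      by (auto intro!: exI[of _ "\<lambda>i. J +>\<^bsub>S\<^esub> w i"])
  qed
qed

lemma regular_mod_on_carrier:
  assumes I: "is_ideal I" "L \<subseteq> I"
  shows "regular_mod I y \<longleftrightarrow> (\<forall>u\<in>carrier S. y * u \<in> I \<longrightarrow> u \<in> I)"
proof
  assume *: "\<forall>u\<in>carrier S. y * u \<in> I \<longrightarrow> u \<in> I"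
  show "regular_mod I y" unfolding regular_mod_def
  proof (intro allI impI)
    fix u assume u: "y * u \<in> I"
    obtain q where q: "q \<in> carrier S" "u - q \<in> L"
      using mod_outside_variables[OF L out] by blast
    have "u - q \<in> I" using q(2) I(2) by blast
    then have "y * u - y * q \<in> I"
      using is_ideal_mult[OF I(1), of "u - q" y] by (simp add: right_diff_distrib)
    then have "y * q \<in> I" using is_ideal_mem_iff[OF I(1)] u by blast
    then have "q \<in> I" using * q(1) by blast
    then show "u \<in> I" using is_ideal_mem_iff[OF I(1) \<open>u - q \<in> I\<close>] by blast
  qed
qed (auto simp: regular_mod_def)

lemma regular_sequence_iff:
  assumes ys: "set ys \<subseteq> carrier S"
  shows "regular_sequence S M ys \<longleftrightarrow> regular_seq L ys \<and> 1 \<notin> adjoin_list L ys"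
proof -
  have nzd: "(\<forall>u \<in> carrier M. (ys ! i) \<odot>\<^bsub>M\<^esub> u \<in> seq_submodule M (take i ys)
        \<longrightarrow> u \<in> seq_submodule M (take i ys))
      \<longleftrightarrow> regular_mod (adjoin_list L (take i ys)) (ys ! i)" if i: "i < length ys" for i
  proof -
    have sub: "set (take i ys) \<subseteq> carrier S" using ys set_take_subset by fastforce
    have y: "ys ! i \<in> carrier S" using ys i by auto
    have mult: "ys ! i * u \<in> carrier S" if "u \<in> carrier S" for u
      using S.m_closed[OF y that] by simp
    show ?thesis
      unfolding regular_mod_on_carrier[OF is_ideal_adjoin_list[OF L] adjoin_list_superset] carrier_M
      using mult y by (simp add: smult_M seq_submodule_iff[OF sub] del: quot_module_simps)
  qed
  have "seq_submodule M ys \<noteq> carrier M \<longleftrightarrow> 1 \<notin> adjoin_list L ys"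
  proof -
    have sub: "seq_submodule M ys \<subseteq> carrier M"
    proof
      fix w assume "w \<in> seq_submodule M ys"
      then obtain U where U: "U \<in> {..<length ys} \<rightarrow> carrier M"
        "w = finsum M (\<lambda>i. ys ! i \<odot>\<^bsub>M\<^esub> U i) {..<length ys}"
        unfolding seq_submodule_def by blast
      have "(\<lambda>i. ys ! i \<odot>\<^bsub>M\<^esub> U i) \<in> {..<length ys} \<rightarrow> carrier M"
      proof
        fix i assume "i \<in> {..<length ys}"
        then show "ys ! i \<odot>\<^bsub>M\<^esub> U i \<in> carrier M"
          using ys U(1) by (intro M.smult_closed) auto
      qed
      then show "w \<in> carrier M" unfolding U(2) by (rule M.finsum_closed)
    qed
    have I: "is_ideal (adjoin_list L ys)" by (rule is_ideal_adjoin_list[OF L])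
    have "seq_submodule M ys = carrier M \<longleftrightarrow> carrier M \<subseteq> seq_submodule M ys"
      using sub by blast
    also have "\<dots> \<longleftrightarrow> (\<forall>u\<in>carrier S. J +>\<^bsub>S\<^esub> u \<in> seq_submodule M ys)"
      unfolding carrier_M by blast
    also have "\<dots> \<longleftrightarrow> (\<forall>u\<in>carrier S. u \<in> adjoin_list L ys)"
      using seq_submodule_iff[OF ys] by blast
    also have "\<dots> \<longleftrightarrow> 1 \<in> adjoin_list L ys"
    proof
      assume "1 \<in> adjoin_list L ys"
      then have "u * 1 \<in> adjoin_list L ys" for u by (rule is_ideal_mult[OF I])
      then show "\<forall>u\<in>carrier S. u \<in> adjoin_list L ys" by simp
    qed (use S.one_closed in simp)
    finally show ?thesis by simp
  qed
  then show ?thesis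
    unfolding regular_sequence_def regular_seq_iff using ys nzd by blast
qed

lemma mem_variable_ideal_if_no_constant_term:
  assumes "\<forall>t\<in>Poly_Mapping.keys p. t \<noteq> 0" and p: "p \<in> carrier S"
  shows "p \<in> Idl\<^bsub>S\<^esub> (mvar ` X)"
proof -
  let ?I = "Idl\<^bsub>S\<^esub> (mvar ` X) :: ('x, 'k) mpoly set"
  have sub: "mvar ` X \<subseteq> carrier S" by (auto intro: mvar_closed)
  interpret I: ideal ?I S by (rule S.genideal_ideal[OF sub])
  have I_mult: "a * q \<in> ?I" if "q \<in> ?I" "a \<in> carrier S" for a q
    using I.I_l_closed[OF that] by simp
  show ?thesis
  proof (rule mem_subspace_by_classes[of ?I p "\<lambda>t. t"])
    show "is_subspace ?I" unfolding is_subspace_def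
    proof (intro conjI ballI allI)
      show "0 \<in> ?I" using I.zero_closed by simp
      fix u v assume "u \<in> ?I" "v \<in> ?I"
      then show "u + v \<in> ?I" using I.a_closed[of u v] by simp
    next
      fix c u assume "u \<in> ?I"
      then show "Poly_Mapping.single 0 c * u \<in> ?I"
        by (rule I_mult) (simp add: mpoly_ring_carrier)
    qed
    show "Poly_Mapping.single t 1 - Poly_Mapping.single t' 1 \<in> ?I" if "t = t'" for t t'
      using that I.zero_closed by simp
    fix t assume t: "t \<in> Poly_Mapping.keys p"
    then have "Poly_Mapping.keys t \<noteq> {}" using assms(1) by auto
    then obtain x where x: "x \<in> Poly_Mapping.keys t" by blast
    from split_off_variable[OF x] obtain u where u: "t = Poly_Mapping.single x 1 + u" by metis
    have tX: "Poly_Mapping.keys t \<subseteq> X" using p t by (simp add: mpoly_ring_carrier)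
    have "mvar x \<in> ?I" using S.genideal_self[OF sub] x tX by blast
    then have "Poly_Mapping.single u 1 * mvar x \<in> ?I"
      by (rule I_mult) (use tX in \<open>simp add: mpoly_ring_carrier u keys_plus_nat\<close>)
    then show "class_sum (\<lambda>t. t) p t = 0 \<or> Poly_Mapping.single t 1 \<in> ?I"
      by (simp add: u mvar_def mult_single add.commute)
  qed
qed

text \<open>
  A regular sequence cannot be longer than the range in which cohomology vanishes, and one of that
  length exists. Its members are replaced modulo \<open>L\<close> by polynomials in the variables \<open>X\<close>; these
  have no constant term and hence lie in the ideal generated by the variables. That no constant
  term occurs also ensures that the sequence does not generate the unit ideal.
\<close>

theorem depth_eq_koszul_depth:
  assumes xs: "set xs = mvar ` X" and D: "koszul_depth xs L D"
    and const: "\<And>p. p \<in> L \<Longrightarrow> Poly_Mapping.lookup p 0 = 0"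
  shows "depth S (Idl\<^bsub>S\<^esub> (mvar ` X)) M = enat D"
proof -
  let ?I = "Idl\<^bsub>S\<^esub> (mvar ` X) :: ('x, 'k) mpoly set"
  let ?hull = "is_ideal hull (set xs)"
  define M0 where "M0 = {p :: ('x, 'k) mpoly. Poly_Mapping.lookup p 0 = 0}"
  have sub: "mvar ` X \<subseteq> carrier S" by (auto intro: mvar_closed)
  interpret I: ideal ?I S by (rule S.genideal_ideal[OF sub])
  have I_hull: "?I \<subseteq> ?hull"
  proof -
    have "mvar ` X \<subseteq> ?hull \<inter> carrier S" using sub hull_subset[of "set xs" is_ideal] xs by auto
    then have "?I \<subseteq> ?hull \<inter> carrier S"
      by (intro S.genideal_minimal ideal_restrict_mpoly_ring is_ideal_hull)
    then show ?thesis by blast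
  qed
  have M0: "is_ideal M0" unfolding M0_def by (rule is_ideal_no_constant_term)
  have hull_M0: "?hull \<subseteq> M0"
  proof (rule hull_minimal)
    show "is_ideal M0" by (rule M0)
    show "set xs \<subseteq> M0"
    proof
      fix z assume "z \<in> set xs"
      then obtain x where z: "z = mvar x" using xs by blast
      have "Poly_Mapping.keys (Poly_Mapping.single x (1::nat)) \<noteq> Poly_Mapping.keys 0" by simp
      then have "Poly_Mapping.single x (1::nat) \<noteq> 0" by metis
      then show "z \<in> M0" by (simp add: z M0_def mvar_def lookup_single)
    qed
  qed
  have L_M0: "L \<subseteq> M0" using const by (auto simp: M0_def)
  have one: "1 \<notin> M0" by (simp add: M0_def)
  show ?thesis unfolding depth_def
  proof (rule antisym)
    show "(SUP ys\<in>{ys. set ys \<subseteq> ?I \<and> regular_sequence S M ys}. enat (length ys)) \<le> enat D"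
    proof (rule SUP_least, safe)
      fix ys assume ys: "set ys \<subseteq> ?I" "regular_sequence S M ys"
      have "set ys \<subseteq> carrier S" using ys(1) I.Icarr by blast
      then have "regular_seq L ys" using ys(2) by (simp add: regular_sequence_iff)
      then have "\<not> D < length ys"
        using koszul_vanish_of_regular_seq[OF L, of ys xs D] subset_trans[OF ys(1) I_hull] D
        by (auto simp: koszul_depth_def)
      then show "enat (length ys) \<le> enat D" by simp
    qed
  next
    have "\<forall>i<D. koszul_vanish xs L i" using D by (simp add: koszul_depth_def)
    then obtain zs where zs: "length zs = D" "set zs \<subseteq> ?hull" "regular_seq L zs"
      using exists_regular_seq[OF L noetherian_above_variables[OF X out], of D xs] by blast
    have "\<forall>z. \<exists>q. q \<in> carrier S \<and> z - q \<in> L" using mod_outside_variables[OF L out] by metis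
    then obtain \<pi> where \<pi>: "\<And>z. \<pi> z \<in> carrier S" "\<And>z. z - \<pi> z \<in> L" by metis
    let ?ys = "map \<pi> zs"
    have ys_I: "set ?ys \<subseteq> ?I"
    proof
      fix y assume "y \<in> set ?ys"
      then obtain z where z: "z \<in> set zs" "y = \<pi> z" by auto
      have "y \<in> M0"
      proof -
        have "z \<in> M0" using z(1) zs(2) hull_M0 by blast
        moreover have "z - y \<in> M0" unfolding z(2) using \<pi>(2) L_M0 by blast
        ultimately show ?thesis using is_ideal_mem_iff[OF M0, of z y] by blast
      qed
      then show "y \<in> ?I"
      proof (intro mem_variable_ideal_if_no_constant_term)
        show "y \<in> carrier S" unfolding z(2) by (rule \<pi>(1))
        show "\<forall>t\<in>Poly_Mapping.keys y. t \<noteq> 0" using \<open>y \<in> M0\<close> by (auto simp: M0_def in_keys_iff)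
      qed
    qed
    have "regular_seq L ?ys"
      using regular_seq_cong[OF L, of zs ?ys] zs(3) \<pi>(2) by (simp add: list_all2_conv_all_nth)
    moreover have "1 \<notin> adjoin_list L ?ys"
      using adjoin_list_subset[OF M0 subset_trans[OF ys_I subset_trans[OF I_hull hull_M0]] L_M0] one
      by blast
    ultimately have "regular_sequence S M ?ys"
      using \<pi>(1) regular_sequence_iff[of ?ys] by auto
    then show "enat D \<le> (SUP ys\<in>{ys. set ys \<subseteq> ?I \<and> regular_sequence S M ys}. enat (length ys))"
      using ys_I zs(1) by (intro SUP_upper2[of ?ys]) auto
  qed
qed

end

section \<open>The combinatorics of the graph\<close>

lemma is_complete_induced_iff:
  assumes "pair_graph G" "finite A"
  shows "is_complete (with_proj G \<restriction> A) \<longleftrightarrow> (\<forall>u\<in>A. \<forall>v\<in>A. u \<noteq> v \<longrightarrow> (u, v) \<in> parcs G)"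
proof -
  interpret pair_graph G by fact
  let ?H = "\<lparr>pverts = A, parcs = {(u, v) \<in> parcs G. u \<in> A \<and> v \<in> A}\<rparr>"
  have "with_proj G \<restriction> A = with_proj ?H"
    by (auto simp: induce_subgraph_def with_proj_def)
  then have "is_complete (with_proj G \<restriction> A) \<longleftrightarrow>
      {(u, v) \<in> parcs G. u \<in> A \<and> v \<in> A} = {(u, v). (u, v) \<in> A \<times> A \<and> u \<noteq> v}"
    using assms(2) by (simp add: is_complete_def complete_digraph_pair_def)
  also have "\<dots> \<longleftrightarrow> (\<forall>u\<in>A. \<forall>v\<in>A. u \<noteq> v \<longrightarrow> (u, v) \<in> parcs G)"
    using no_loops' by (auto simp: set_eq_iff)
  finally show ?thesis .
qed

lemma is_complete_iff:
  assumes "pair_graph G"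
  shows "is_complete (with_proj G) \<longleftrightarrow>
    (\<forall>u\<in>pverts G. \<forall>v\<in>pverts G. u \<noteq> v \<longrightarrow> (u, v) \<in> parcs G)"
proof -
  interpret pair_graph G by fact
  have "with_proj G \<restriction> pverts G = with_proj G"
    using in_arcsD1 in_arcsD2 by (auto simp: induce_subgraph_def with_proj_def)
  then show ?thesis using is_complete_induced_iff[OF assms pair_finite_verts] by simp
qed

lemma clique_iff:
  assumes "pair_graph G"
  shows "clique (with_proj G) A \<longleftrightarrow>
    A \<subseteq> pverts G \<and> (\<forall>u\<in>A. \<forall>v\<in>A. u \<noteq> v \<longrightarrow> (u, v) \<in> parcs G)"
proof -
  interpret pair_graph G by fact
  show ?thesis
    using is_complete_induced_iff[OF assms] finite_subset[OF _ pair_finite_verts]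
    by (auto simp: clique_def)
qed

lemma clique_in_maximal_clique:
  assumes "pair_graph G" "clique (with_proj G) A"
  obtains M where "maximal_clique (with_proj G) M" "A \<subseteq> M"
proof -
  interpret pair_graph G by fact
  have "{B. clique (with_proj G) B} \<subseteq> Pow (pverts G)" by (auto simp: clique_def)
  then have "finite {B. clique (with_proj G) B}"
    using pair_finite_verts finite_subset by blast
  from finite_has_maximal2[OF this, of A] assms(2)
  obtain M where "clique (with_proj G) M" "A \<subseteq> M" "\<And>B. clique (with_proj G) B \<Longrightarrow> M \<subseteq> B \<Longrightarrow> M = B"
    by auto
  then show ?thesis using that[of M] by (auto simp: maximal_clique_def)
qed

lemma connected_invariant:
  assumes "connected H" "u \<in> verts H" "P u" "v \<in> verts H"
    and step: "\<And>x y. (x, y) \<in> arcs_ends H \<or> (y, x) \<in> arcs_ends H \<Longrightarrow> P x \<Longrightarrow> P y"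
  shows "P v"
proof -
  have "(u, v) \<in> rtrancl_on (verts H) ((arcs_ends H)\<^sup>s)"
    using assms by (simp add: connected_conv)
  then show ?thesis
    by (induction rule: rtrancl_on_induct) (use assms(3) step in \<open>auto simp: symcl_def\<close>)
qed

text \<open>
  Since the graph is not complete, there are two distinct maximal cliques, and then \<open>C\<close> is contained
  in every maximal clique; so its vertices are joined to all others. A vertex off \<open>C\<close> lies in only
  one maximal clique, which makes adjacency off \<open>C\<close> transitive. If \<open>C\<close> were empty, adjacency would
  be an equivalence relation on all vertices and the connected graph would be complete.
\<close>

lemma H1_structure:
  assumes G: "G \<in> H1" and V: "pverts G = {1..n}"
  obtains C and \<beta> :: "nat \<Rightarrow> nat set" and b c
  where "clique_cone n G C \<beta>" "C \<noteq> {}" "b \<in> {1..n} - C" "c \<in> {1..n} - C" "\<beta> b \<noteq> \<beta> c"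
proof -
  have pg: "pair_graph G" and conn: "connected (with_proj G)"
    and nc: "\<not> is_complete (with_proj G)" using G by (auto simp: H1_def)
  obtain C where C: "clique (with_proj G) C"
    and meet: "\<And>A B. maximal_clique (with_proj G) A \<Longrightarrow> maximal_clique (with_proj G) B \<Longrightarrow> A \<noteq> B
      \<Longrightarrow> A \<inter> B = C"
    using G by (auto simp: H1_def)
  interpret pair_graph G by (rule pg)
  have sym: "(v, u) \<in> parcs G" if "(u, v) \<in> parcs G" for u v
    using that arcs_symmetric by simp
  have in_V: "u \<in> {1..n}" "v \<in> {1..n}" "u \<noteq> v" if "(u, v) \<in> parcs G" for u v
    using that in_arcsD1 in_arcsD2 no_loops' V by auto
  have maximal_clique: "A \<subseteq> {1..n}" "\<And>u v. u \<in> A \<Longrightarrow> v \<in> A \<Longrightarrow> u \<noteq> v \<Longrightarrow> (u, v) \<in> parcs G"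
    if "maximal_clique (with_proj G) A" for A
    using that V by (auto simp: maximal_clique_def clique_iff[OF pg])
  have ex1: "\<exists>A. maximal_clique (with_proj G) A \<and> u \<in> A" if "u \<in> {1..n}" for u
    using clique_in_maximal_clique[OF pg, of "{u}"] that V by (auto simp: clique_iff[OF pg])
  have ex2: "\<exists>A. maximal_clique (with_proj G) A \<and> u \<in> A \<and> v \<in> A" if "(u, v) \<in> parcs G" for u v
    using clique_in_maximal_clique[OF pg, of "{u, v}"] that in_V[OF that] sym[OF that] V
    by (auto simp: clique_iff[OF pg])
  obtain b c where bc: "b \<in> {1..n}" "c \<in> {1..n}" "b \<noteq> c" "(b, c) \<notin> parcs G"
    using nc V by (auto simp: is_complete_iff[OF pg])
  obtain A B where A: "maximal_clique (with_proj G) A" "b \<in> A"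
    and B: "maximal_clique (with_proj G) B" "c \<in> B" using ex1 bc by meson
  have "A \<noteq> B" using maximal_clique(2)[OF A(1)] A(2) B(2) bc by blast
  then have C_sub: "C \<subseteq> D" if "maximal_clique (with_proj G) D" for D
    using meet[OF that A(1)] meet[OF that B(1)] by blast
  have hub: "(k, v) \<in> parcs G" if k: "k \<in> C" and v: "v \<in> {1..n}" "k \<noteq> v" for k v
  proof -
    obtain D where D: "maximal_clique (with_proj G) D" "v \<in> D" using ex1[OF v(1)] by blast
    then show ?thesis using C_sub[OF D(1)] k v(2) maximal_clique(2)[OF D(1)] by blast
  qed
  have trans: "(u, w) \<in> parcs G"
    if uv: "(u, v) \<in> parcs G" and vw: "(v, w) \<in> parcs G" and uw: "u \<noteq> w" and vC: "v \<notin> C" for u v w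
  proof -
    obtain D E where D: "maximal_clique (with_proj G) D" "u \<in> D" "v \<in> D"
      and E: "maximal_clique (with_proj G) E" "v \<in> E" "w \<in> E" using ex2[OF uv] ex2[OF vw] by blast
    have "D = E" using meet[OF D(1) E(1)] vC D(3) E(2) by blast
    then show ?thesis using maximal_clique(2)[OF D(1)] D E uw by blast
  qed
  \<comment> \<open>Off \<open>C\<close> the closed neighbourhood of a vertex is the maximal clique that contains it.\<close>
  define \<beta> where "\<beta> v = {u. u = v \<or> (u, v) \<in> parcs G}" for v
  have \<beta>: "(k, l) \<in> parcs G \<longleftrightarrow> \<beta> k = \<beta> l" if kl: "k \<notin> C" "l \<notin> C" "k \<noteq> l" for k l
  proof
    assume arc: "(k, l) \<in> parcs G"
    have "u \<in> \<beta> l" if "u \<in> \<beta> k" for u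
      using that arc trans[of u k l] kl(1) by (auto simp: \<beta>_def)
    moreover have "u \<in> \<beta> k" if "u \<in> \<beta> l" for u
      using that sym[OF arc] trans[of u l k] kl(2) by (auto simp: \<beta>_def)
    ultimately show "\<beta> k = \<beta> l" by blast
  next
    assume "\<beta> k = \<beta> l"
    moreover have "k \<in> \<beta> k" by (simp add: \<beta>_def)
    ultimately show "(k, l) \<in> parcs G" using kl(3) by (auto simp: \<beta>_def)
  qed
  have bcC: "b \<notin> C" "c \<notin> C"
    using hub[of b c] hub[of c b] sym[of c b] bc by auto
  show ?thesis
  proof (rule that[of C \<beta> b c])
    show "clique_cone n G C \<beta>"
    proof
      show "C \<subseteq> {1..n}" using C V by (simp add: clique_iff[OF pg])
      fix k l
      show "(k, l) \<in> parcs G \<longleftrightarrow>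
        k \<in> {1..n} \<and> l \<in> {1..n} \<and> k \<noteq> l \<and> (k \<in> C \<or> l \<in> C \<or> \<beta> k = \<beta> l)"
        using in_V[of k l] \<beta>[of k l] hub[of k l] hub[of l k] sym[of l k] by metis
    qed
    show "b \<in> {1..n} - C" "c \<in> {1..n} - C" using bc bcC by auto
    show "\<beta> b \<noteq> \<beta> c" using \<beta>[OF bcC bc(3)] bc(4) by simp
    show "C \<noteq> {}"
    proof
      assume C0: "C = {}"
      have "c = b \<or> (b, c) \<in> parcs G"
      proof (rule connected_invariant[OF conn, of b "\<lambda>v. v = b \<or> (b, v) \<in> parcs G"])
        fix x y
        assume "(x, y) \<in> arcs_ends (with_proj G) \<or> (y, x) \<in> arcs_ends (with_proj G)"
          and x: "x = b \<or> (b, x) \<in> parcs G"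
        then have xy: "(x, y) \<in> parcs G" using sym[of y x] by auto
        show "y = b \<or> (b, y) \<in> parcs G"
        proof (cases "x = b \<or> y = b")
          case False
          then show ?thesis using trans[of b x y] x xy C0 by simp
        qed (use xy in auto)
      qed (use bc V in auto)
      then show False using bc by simp
    qed
  qed
qed

context clique_cone
begin

context
  fixes b c :: nat
  assumes ne: "C \<noteq> {}" and b: "b \<in> {1..n} - C" and c: "c \<in> {1..n} - C" and bc: "\<beta> b \<noteq> \<beta> c"
    and pg: "pair_graph G" and V: "pverts G = {1..n}"
begin

interpretation pair_graph G by (rule pg)

lemma hub_vertex: obtains z where "z \<in> C" "z \<in> {1..n}" "\<And>v. v \<in> {1..n} \<Longrightarrow> v \<noteq> z \<Longrightarrow> (v, z) \<in> parcs G \<and> (z, v) \<in> parcs G"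
proof -
  obtain z where "z \<in> C" using ne by blast
  then show ?thesis using C that[of z] arcs by auto
qed

lemma num_free_eq: "num_free (with_proj G) = n - card C"
proof -
  have "free_vertex (with_proj G) v \<longleftrightarrow> v \<in> {1..n} - C" for v
  proof -
    have nb: "neighbours (with_proj G) v = {u. (v, u) \<in> parcs G}" by (simp add: neighbours_def)
    have "neighbours (with_proj G) v \<subseteq> {1..n}" by (simp add: nb arcs subset_iff)
    then have fin: "finite (neighbours (with_proj G) v)" by (rule finite_subset) simp
    have "is_complete (with_proj G \<restriction> neighbours (with_proj G) v) \<longleftrightarrow> v \<notin> C" if v: "v \<in> {1..n}"
    proof
      assume "v \<notin> C"
      then show "is_complete (with_proj G \<restriction> neighbours (with_proj G) v)"
        unfolding is_complete_induced_iff[OF pg fin]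
      proof (intro ballI impI)
        fix u w assume "u \<in> neighbours (with_proj G) v" "w \<in> neighbours (with_proj G) v" "u \<noteq> w"
        then show "(u, w) \<in> parcs G" using \<open>v \<notin> C\<close> by (auto simp: nb arcs)
      qed
    next
      assume comp: "is_complete (with_proj G \<restriction> neighbours (with_proj G) v)"
      show "v \<notin> C"
      proof
        assume "v \<in> C"
        moreover have "v \<noteq> b" "v \<noteq> c" using \<open>v \<in> C\<close> b c by auto
        ultimately have "(v, b) \<in> parcs G" "(v, c) \<in> parcs G" using b c v by (simp_all add: arcs)
        then have "b \<in> neighbours (with_proj G) v" "c \<in> neighbours (with_proj G) v"
          by (simp_all only: nb mem_Collect_eq)
        moreover have "b \<noteq> c" using bc by auto
        ultimately have "(b, c) \<in> parcs G"
          using comp unfolding is_complete_induced_iff[OF pg fin] by blast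
        then show False using b c bc arcs by simp
      qed
    qed
    then show ?thesis by (auto simp: free_vertex_def V)
  qed
  then have "{v. free_vertex (with_proj G) v} = {1..n} - C" by blast
  then have "num_free (with_proj G) = card ({1..n} - C)" by (simp only: num_free_def)
  then show ?thesis using C by (simp add: card_Diff_subset finite_subset)
qed

lemma num_isolated_eq: "num_isolated (with_proj G) = 0"
proof -
  obtain z where z: "z \<in> C" "z \<in> {1..n}"
    "\<And>v. v \<in> {1..n} \<Longrightarrow> v \<noteq> z \<Longrightarrow> (v, z) \<in> parcs G \<and> (z, v) \<in> parcs G" using hub_vertex by blast
  have "neighbours (with_proj G) v \<noteq> {}" if v: "v \<in> {1..n}" for v
  proof (cases "v = z")
    case True
    then have "(v, b) \<in> parcs G" using z(1) z(3)[of b] b by auto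
    then show ?thesis by (auto simp: neighbours_def)
  next
    case False
    then show ?thesis using z(3)[OF v] by (auto simp: neighbours_def)
  qed
  then show ?thesis by (simp add: num_isolated_def V)
qed

lemma graph_dist_le_2:
  assumes "u \<in> {1..n}" "v \<in> {1..n}"
  shows "graph_dist (with_proj G) u v \<le> 2"
proof -
  obtain z where z: "z \<in> C" "z \<in> {1..n}"
    "\<And>v. v \<in> {1..n} \<Longrightarrow> v \<noteq> z \<Longrightarrow> (v, z) \<in> parcs G \<and> (z, v) \<in> parcs G" using hub_vertex by blast
  have le: "graph_dist (with_proj G) u v \<le> k" if "awalk u p v" "length p = k" for p k
    unfolding graph_dist_def using that by (intro Least_le) blast
  consider "u = v" | "u \<noteq> v" "u = z" | "u \<noteq> v" "v = z" | "u \<noteq> z" "v \<noteq> z" by blast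
  then show ?thesis
  proof cases
    case 1
    then show ?thesis using le[of "[]" 0] assms V by (simp add: awalk_Nil_iff)
  next
    case 2
    then show ?thesis using le[of "[(u, v)]" 1] z(3)[of v] assms V
      by (simp add: awalk_Nil_iff awalk_Cons_iff)
  next
    case 3
    then show ?thesis using le[of "[(u, v)]" 1] z(3)[of u] assms V
      by (simp add: awalk_Nil_iff awalk_Cons_iff)
  next
    case 4
    then show ?thesis using le[of "[(u, z), (z, v)]" 2] z(3)[of u] z(3)[of v] assms V
      by (simp add: awalk_Nil_iff awalk_Cons_iff)
  qed
qed

lemma graph_dist_eq_2: "graph_dist (with_proj G) b c = 2"
proof -
  obtain z where z: "z \<in> C" "z \<in> {1..n}"
    "\<And>v. v \<in> {1..n} \<Longrightarrow> v \<noteq> z \<Longrightarrow> (v, z) \<in> parcs G \<and> (z, v) \<in> parcs G" using hub_vertex by blast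
  have "b \<noteq> z" "c \<noteq> z" using b c z(1) by auto
  then have walk: "awalk b [(b, z), (z, c)] c"
    using z(3)[of b] z(3)[of c] b c V by (simp add: awalk_Nil_iff awalk_Cons_iff)
  have no: "(b, c) \<notin> parcs G" using b c bc arcs by simp
  show ?thesis unfolding graph_dist_def
  proof (rule Least_equality)
    show "\<exists>p. awalk b p c \<and> length p = 2"
      using walk by (intro exI[of _ "[(b, z), (z, c)]"]) simp
    fix k assume "\<exists>p. awalk b p c \<and> length p = k"
    then obtain p where p: "awalk b p c" "length p = k" by blast
    show "2 \<le> k"
    proof (rule ccontr)
      assume "\<not> 2 \<le> k"
      then consider "p = []" | e where "p = [e]" using p(2) by (cases p; cases "tl p") auto
      then show False
      proof cases
        case 1
        then show ?thesis using p(1) bc by (simp add: awalk_Nil_iff)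
      next
        case 2
        then show ?thesis using p(1) no by (cases e) (simp add: awalk_Nil_iff awalk_Cons_iff)
      qed
    qed
  qed
qed

lemma diam_eq: "diam (with_proj G) = 2"
proof -
  let ?D = "{graph_dist (with_proj G) u v | u v. u \<in> {1..n} \<and> v \<in> {1..n}}"
  have "?D \<subseteq> {..2}" using graph_dist_le_2 by auto
  then have "finite ?D" using finite_subset by blast
  moreover have "2 \<in> ?D" using graph_dist_eq_2 b c by (intro CollectI exI[of _ b] exI[of _ c]) simp
  ultimately show ?thesis
    using graph_dist_le_2 unfolding diam_def with_proj_simps V by (intro Max_eqI) auto
qed

lemma sccs_eq: "sccs = {with_proj G}"
proof -
  obtain z where z: "z \<in> C" "z \<in> {1..n}"
    "\<And>v. v \<in> {1..n} \<Longrightarrow> v \<noteq> z \<Longrightarrow> (v, z) \<in> parcs G \<and> (z, v) \<in> parcs G" using hub_vertex by blast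
  have "u \<rightarrow>\<^sup>*\<^bsub>with_proj G\<^esub> z \<and> z \<rightarrow>\<^sup>*\<^bsub>with_proj G\<^esub> u" if u: "u \<in> {1..n}" for u
  proof (cases "u = z")
    case True
    then show ?thesis using u V by simp
  next
    case False
    then show ?thesis using z(3)[OF u False] by (auto intro: reachable_adjI)
  qed
  then have sc: "strongly_connected (with_proj G)"
    using V z(2) by (intro strongly_connectedI) (auto intro: reachable_trans)
  have ind: "induced_subgraph (with_proj G) (with_proj G)"
    using in_arcsD1 in_arcsD2 by (auto simp: induced_subgraph_def subgraph_def compatible_def)
      unfold_locales
  show ?thesis
  proof safe
    fix H assume H: "H \<in> sccs"
    have indH: "induced_subgraph H (with_proj G)" using H by (simp add: sccs_def)
    have "verts H \<subseteq> pverts G" using indH by (auto simp: induced_subgraph_def subgraph_def)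
    moreover have "\<not> verts H \<subset> verts (with_proj G)" using H sc ind unfolding sccs_def by blast
    ultimately have "verts H = verts (with_proj G)" by auto
    then show "H = with_proj G" using induced_eq_verts_imp_eq[OF indH ind] by simp
  next
    have "\<not> verts (with_proj G) \<subset> verts H" if "induced_subgraph H (with_proj G)" for H
      using that by (auto simp: induced_subgraph_def subgraph_def)
    then show "with_proj G \<in> sccs" unfolding sccs_def using sc ind by blast
  qed
qed

lemma diam_sum_eq: "diam_sum (with_proj G) = 2"
  unfolding diam_sum_def sccs_eq by (simp add: num_isolated_eq diam_eq)

lemma connected_if_meets_C:
  assumes "z \<in> C" "z \<in> W" "W \<subseteq> {1..n}"
  shows "connected (with_proj G \<restriction> W)"
proof -
  let ?H = "with_proj G \<restriction> W"
  have arc: "(u, z) \<in> (arcs_ends ?H)\<^sup>s \<and> (z, u) \<in> (arcs_ends ?H)\<^sup>s" if "u \<in> W" "u \<noteq> z" for u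
  proof -
    have "(u, z) \<in> parcs G" using assms that arcs by auto
    then have "(u, z) \<in> arcs_ends ?H"
      using that(1) assms(2) by (auto simp: arcs_ends_conv intro!: image_eqI[of _ _ "(u, z)"])
    then show ?thesis by (auto simp: symcl_def)
  qed
  have to: "(u, z) \<in> rtrancl_on W ((arcs_ends ?H)\<^sup>s) \<and> (z, u) \<in> rtrancl_on W ((arcs_ends ?H)\<^sup>s)"
    if "u \<in> W" for u
    using arc[of u] that assms(2) by (cases "u = z") (auto intro: rtrancl_on_into_rtrancl_on)
  show ?thesis unfolding connected_conv
    using to assms(2) by (auto intro: rtrancl_on_trans)
qed

text \<open>
  A set that does not contain \<open>C\<close> leaves a vertex which is joined to all others; removing \<open>C\<close> itself
  separates the blocks.
\<close>

lemma vertex_connectivity_eq: "vertex_connectivity (with_proj G) = card C"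
proof -
  let ?\<T> = "{T. T \<subset> {1..n} \<and> \<not> connected (with_proj G \<restriction> ({1..n} - T))}"
  have "finite ?\<T>" by (rule finite_subset[of _ "Pow {1..n}"]) auto
  moreover have "card C \<le> card T" if T: "T \<in> ?\<T>" for T
  proof -
    have "C \<subseteq> T"
    proof
      fix z assume z: "z \<in> C"
      show "z \<in> T"
      proof (rule ccontr)
        assume "z \<notin> T"
        then have "connected (with_proj G \<restriction> ({1..n} - T))"
          using z C by (intro connected_if_meets_C[of z]) auto
        then show False using T by simp
      qed
    qed
    moreover have "finite T" using T finite_subset[of T "{1..n}"] by auto
    ultimately show ?thesis by (intro card_mono)
  qed
  moreover have "C \<in> ?\<T>"
  proof -
    have "\<not> connected (with_proj G \<restriction> ({1..n} - C))"
    proof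
      assume conn: "connected (with_proj G \<restriction> ({1..n} - C))"
      have "\<beta> c = \<beta> b"
      proof (rule connected_invariant[OF conn, of b "\<lambda>v. \<beta> v = \<beta> b"])
        fix x y assume "(x, y) \<in> arcs_ends (with_proj G \<restriction> ({1..n} - C)) \<or>
            (y, x) \<in> arcs_ends (with_proj G \<restriction> ({1..n} - C))" "\<beta> x = \<beta> b"
        then show "\<beta> y = \<beta> b" by (auto simp: arcs_ends_conv arcs)
      qed (use b c in auto)
      then show False using bc by simp
    qed
    then show ?thesis using C b by auto
  qed
  ultimately show ?thesis
    unfolding vertex_connectivity_def with_proj_simps V by (intro Min_eqI) auto
qed

end

end

section \<open>Depth of the edge ideal\<close>

text \<open>
  Members of the intersection have no constant term, since the monomial 1 is the only one whose
  margins all vanish.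
\<close>

lemma (in clique_cone) depth_gbei:
  assumes m: "m \<ge> 2" and ne: "C \<noteq> {}" and bc: "b \<in> {1..n} - C" "c \<in> {1..n} - C" "\<beta> b \<noteq> \<beta> c"
  shows "depth (gbei_ring m n :: (nat \<times> nat, 'k::field) mpoly ring) (hom_max_ideal m n)
    (quot_module (gbei_ring m n) (gbei m n G)) = enat (m + n - card C)"
proof -
  let ?L = "L\<^sub>A \<inter> L\<^sub>B :: (nat \<times> nat, 'k) mpoly set"
  obtain xs :: "(nat \<times> nat, 'k) mpoly list" where xs: "set xs = mvar ` X"
    using finite_list[of "mvar ` X"] by auto
  have no_const: "Poly_Mapping.lookup p 0 = 0" if "p \<in> ?L" for p
  proof -
    have "class_sum (margin_label (\<lambda>_. ()) X) p (margin_label (\<lambda>_. ()) X 0) = 0"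
      using that by (intro margin_ideal_class_sum) (auto simp: L\<^sub>A_def)
    moreover have "margin_label (\<lambda>_. ()) X t = margin_label (\<lambda>_. ()) X 0 \<longleftrightarrow> t = 0" for t
    proof
      assume eq: "margin_label (\<lambda>_. ()) X t = margin_label (\<lambda>_. ()) X 0"
      then have "same_margins (\<lambda>_. ()) t 0" by (auto simp: margin_label_eq_iff split: if_splits)
      then have "Poly_Mapping.keys t \<inter> column k = {}" for k
        using same_margins_keys_disjoint[OF _ is_margin_column, of "\<lambda>_. ()" t 0 k] by simp
      then have "x \<notin> Poly_Mapping.keys t" for x by (fastforce simp: column_def)
      then have "Poly_Mapping.keys t = {}" by blast
      then show "t = 0" by simp
    qed simp
    ultimately show ?thesis by (simp add: class_sum_def in_keys_iff split: if_splits)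
  qed
  have "depth (gbei_ring m n) (Idl\<^bsub>gbei_ring m n\<^esub> (mvar ` X))
      (quot_module (gbei_ring m n) (?L \<inter> carrier (gbei_ring m n))) = enat (m + n - card C)"
  proof (rule depth_eq_koszul_depth)
    show "is_ideal ?L" by (simp add: L\<^sub>A_def L\<^sub>B_def is_ideal_Int is_ideal_margin_ideal)
    show "mvar x \<in> ?L" if "x \<notin> X" for x
      using that by (auto simp: L\<^sub>A_def L\<^sub>B_def intro!: mvar_mem_margin_ideal)
    show "koszul_depth xs ?L (m + n - card C)" by (rule koszul_depth_Int_L\<^sub>A_L\<^sub>B[OF m ne bc xs])
  qed (use xs no_const in auto)
  then show ?thesis by (simp add: hom_max_ideal_def gbei_eq_Int)
qed

theorem theorem5p1:
  fixes m n :: nat and G :: "nat pair_pre_digraph"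
  assumes "m \<ge> 2" and "n \<ge> 1"
    and "G \<in> H1" and "pverts G = {1..n}"
  shows "depth (gbei_ring m n :: (nat \<times> nat, 'k::field) mpoly ring) (hom_max_ideal m n)
           (quot_module (gbei_ring m n) (gbei m n G))
         = enat ((m - 2) + num_free (with_proj G) + diam_sum (with_proj G))
       \<and> int ((m - 2) + num_free (with_proj G) + diam_sum (with_proj G))
         = int m + int n - int (vertex_connectivity (with_proj G))"
proof -
  obtain C and \<beta> :: "nat \<Rightarrow> nat set" and b c where cone: "clique_cone n G C \<beta>"
    and blocks: "C \<noteq> {}" "b \<in> {1..n} - C" "c \<in> {1..n} - C" "\<beta> b \<noteq> \<beta> c"
    using H1_structure[OF assms(3,4)] by metis
  interpret clique_cone m n G C \<beta> by (rule cone)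
  have G: "pair_graph G" using assms(3) by (simp add: H1_def)
  have "card C \<le> n" using card_mono[OF _ C] by simp
  then show ?thesis
    using depth_gbei[OF assms(1) blocks, where 'k = 'k] num_free_eq[OF blocks G assms(4)]
      diam_sum_eq[OF blocks G assms(4)] vertex_connectivity_eq[OF blocks G assms(4)] assms(1)
    by simp
qed

end
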